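(* Let $\mathcal{M}$ be a properly infinite von Neumann algebra with center $\mathcal{Z}(\mathcal{M})$, and let $h\in\mathcal{M}$ be any operator (not necessarily normal). Then $$\overline{\mathcal{U}(h)}^{s}\cap\mathcal{Z}(\mathcal{M})=\mathrm{sp}^{lec}(h),$$ where $\overline{\mathcal{U}(h)}^{s}$ is the strong closure of the unitary orbit of $h$ and $\mathrm{sp}^{lec}(h)$ is the left essential central spectrum of $h$.
   Context: $\mathcal{U}(h)=\{uhu^*\mid u\in\mathcal{M}\text{ unitary}\}$. $\mathcal{M}$ is properly infinite if $\mathcal{M}\neq 0$ and every nonzero central projection of $\mathcal{M}$ is infinite. The strong operator topology is representation-independent on bounded sets. $\mathcal{K}$ denotes the norm-closed two-sided ideal of $\mathcal{M}$ generated by the finite projections of $\mathcal{M}$. $\Omega(\mathcal{Z}(\mathcal{M}))$ is the maximal ideal space of $\mathcal{Z}(\mathcal{M})$; for a maximal ideal $\zeta\in\Omega(\mathcal{Z}(\mathcal{M}))$, $\zeta+\mathcal{K}$ denotes the sum ideal in $\mathcal{M}$, i.e. the sum of $\mathcal{K}$ and the norm-closed two-sided ideal of $\mathcal{M}$ generated by $\zeta$. The left essential central spectrum $\mathrm{sp}^{lec}(h)$ is the set of all $z\in\mathcal{Z}(\mathcal{M})$ such that, for every $\zeta\in\Omega(\mathcal{Z}(\mathcal{M}))$, the element $h-z+(\zeta+\mathcal{K})$ is not left invertible in the quotient algebra $\mathcal{M}/(\zeta+\mathcal{K})$. *)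

theory Defs
  imports "HOL-Analysis.Analysis" "HOL-Algebra.QuotRing"
begin

section \<open>Complex Hilbert spaces\<close>

text \<open>The sesquilinear form is linear in the first argument; its real part is the library's
  real inner product, so norm and topology are the library's. Completeness is part of the class.\<close>

class complex_hilbert = real_inner + complete_space +
  fixes scaleC :: "complex \<Rightarrow> 'a \<Rightarrow> 'a"
    and cinner :: "'a \<Rightarrow> 'a \<Rightarrow> complex"
  assumes scaleC_add_right: "scaleC c (x + y) = scaleC c x + scaleC c y"
    and scaleC_add_left: "scaleC (c + d) x = scaleC c x + scaleC d x"
    and scaleC_scaleC: "scaleC c (scaleC d x) = scaleC (c * d) x"
    and scaleC_of_real: "scaleC (complex_of_real r) x = scaleR r x"
    and cinner_commute: "cinner x y = cnj (cinner y x)"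
    and cinner_add_left: "cinner (x + y) z = cinner x z + cinner y z"
    and cinner_scaleC_left: "cinner (scaleC c x) y = c * cinner x y"
    and Re_cinner: "Re (cinner x y) = inner x y"

section \<open>Bounded operators\<close>

text \<open>The type \<^typ>\<open>'a \<Rightarrow>\<^sub>L 'a\<close> consists of the bounded real-linear maps, with the operator norm;
  \<open>bounded_ops\<close> is the algebra of bounded complex-linear operators.\<close>

definition bounded_ops :: "('a::complex_hilbert \<Rightarrow>\<^sub>L 'a) set" where
  "bounded_ops = {a. \<forall>c x. blinfun_apply a (scaleC c x) = scaleC c (blinfun_apply a x)}"

definition adj :: "('a::complex_hilbert \<Rightarrow>\<^sub>L 'a) \<Rightarrow> ('a \<Rightarrow>\<^sub>L 'a)" where
  "adj a = (THE b. \<forall>x y. cinner (blinfun_apply a x) y = cinner x (blinfun_apply b y))"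

lemma riesz_real:
  fixes g :: "'a::{real_inner, complete_space} \<Rightarrow> real"
  assumes "bounded_linear g"
  shows "\<exists>w. \<forall>x. g x = inner x w"
proof -
  interpret g: bounded_linear g by fact
  define F where "F x = inner x x - 2 * g x" for x
  obtain K where K: "\<And>x. norm (g x) \<le> norm x * K" using g.bounded by blast
  have lower: "- (K^2) \<le> F x" for x
  proof -
    have "g x \<le> norm x * K" using K[of x] by simp
    moreover have "0 \<le> (norm x - K)^2" by simp
    ultimately show ?thesis
      unfolding F_def power2_norm_eq_inner[symmetric] by (simp add: power2_diff)
  qed
  define m where "m = (INF x. F x)"
  have bdd: "bdd_below (range F)" using lower by (auto intro!: bdd_belowI)
  have m_le: "m \<le> F x" for x unfolding m_def by (rule cINF_lower[OF bdd]) simp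
  have "\<exists>x. F x < m + 1 / real (Suc n)" for n
  proof -
    have "(INF x. F x) < m + 1 / real (Suc n)" unfolding m_def by simp
    then show ?thesis using cINF_less_iff[OF _ bdd] by auto
  qed
  then obtain X where X: "\<And>n. F (X n) < m + 1 / real (Suc n)" by metis
  have par: "(norm (x - y))^2 \<le> 2 * (F x - m) + 2 * (F y - m)" for x y
  proof -
    have "2 * F x + 2 * F y - 4 * F ((1/2) *\<^sub>R (x + y)) = (norm (x - y))^2"
      unfolding F_def power2_norm_eq_inner
      by (simp add: g.scaleR g.add inner_add_left inner_add_right inner_diff_left
          inner_diff_right inner_commute algebra_simps)
    moreover have "4 * m \<le> 4 * F ((1/2) *\<^sub>R (x + y))"
      by (intro mult_left_mono m_le) simp
    ultimately show ?thesis by argo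
  qed
  have "Cauchy X"
  proof (rule metric_CauchyI)
    fix e :: real assume e: "e > 0"
    obtain N where N: "4 / e^2 < real N" using reals_Archimedean2 by blast
    have small: "1 / real (Suc n) < e^2 / 4" if "n \<ge> N" for n
    proof -
      have "4 / e^2 < real (Suc n)" using N that by linarith
      then show ?thesis using e by (simp add: field_simps)
    qed
    have "dist (X i) (X j) < e" if "i \<ge> N" "j \<ge> N" for i j
    proof -
      have "(norm (X i - X j))^2 < e^2"
        using par[of "X i" "X j"] X[of i] X[of j] small[OF that(1)] small[OF that(2)] by argo
      then show ?thesis unfolding dist_norm using e power2_less_imp_less by fastforce
    qed
    then show "\<exists>M. \<forall>i\<ge>M. \<forall>j\<ge>M. dist (X i) (X j) < e" by blast
  qed
  then obtain w where w: "X \<longlonglongrightarrow> w" using Cauchy_convergent convergent_def by blast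
  have "(\<lambda>n. F (X n)) \<longlonglongrightarrow> F w"
    unfolding F_def by (intro tendsto_intros w g.tendsto)
  moreover have "(\<lambda>n. m + 1 / real (Suc n)) \<longlonglongrightarrow> m + 0"
    by (intro tendsto_intros LIMSEQ_Suc lim_1_over_n)
  ultimately have "F w \<le> m + 0"
    using X by (intro LIMSEQ_le[of "\<lambda>n. F (X n)" _ "\<lambda>n. m + 1 / real (Suc n)"]) (auto intro: less_imp_le)
  then have Fw: "F w \<le> F x" for x using m_le[of x] by linarith
  have "g v = inner v w" for v
  proof (rule ccontr)
    assume ne: "g v \<noteq> inner v w"
    define c where "c = inner v w - g v"
    have c: "c \<noteq> 0" using ne by (simp add: c_def)
    have q: "0 \<le> 2 * t * c + t^2 * inner v v" for t
      using Fw[of "w + t *\<^sub>R v"] unfolding F_def c_def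
      by (simp add: g.scaleR g.add inner_add_left inner_add_right inner_commute
          power2_eq_square algebra_simps)
    have "v \<noteq> 0" using ne by auto
    then have v: "inner v v > 0" by simp
    have "2 * (- c / inner v v) * c + (- c / inner v v)^2 * inner v v = - (c^2 / inner v v)"
      using v by (simp add: field_simps power2_eq_square)
    with q[of "- c / inner v v"] have "c^2 / inner v v \<le> 0" by simp
    moreover have "c^2 / inner v v > 0" using c v by simp
    ultimately show False by simp
  qed
  then show ?thesis by blast
qed

lemma cinner_eqI:
  fixes u v :: "'a::complex_hilbert"
  assumes "\<And>x. cinner x u = cinner x v"
  shows "u = v"
proof -
  have "inner x u = inner x v" for x using assms[of x] by (metis Re_cinner)
  then show ?thesis by (metis inner_commute vector_eq_rdot)
qed

lemma cinner_add_right: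
  "cinner (x::'a::complex_hilbert) (y + z) = cinner x y + cinner x z"
  by (metis cinner_add_left cinner_commute complex_cnj_add)

lemma cinner_scaleC_right:
  "cinner (x::'a::complex_hilbert) (scaleC c y) = cnj c * cinner x y"
  by (metis cinner_scaleC_left cinner_commute complex_cnj_mult)

text \<open>The definite description in \<^const>\<open>adj\<close> is uniquely satisfied on \<^const>\<open>bounded_ops\<close>.\<close>

lemma adj_unique:
  fixes a b :: "'a::complex_hilbert \<Rightarrow>\<^sub>L 'a"
  assumes "\<And>x y. cinner (blinfun_apply a x) y = cinner x (blinfun_apply b y)"
  shows "adj a = b"
  unfolding adj_def
proof (rule the_equality)
  fix b' assume "\<forall>x y. cinner (blinfun_apply a x) y = cinner x (blinfun_apply b' y)"
  then show "b' = b" using assms by (metis blinfun_eqI cinner_eqI)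
qed (use assms in blast)

lemma cinner_adj:
  fixes a :: "'a::complex_hilbert \<Rightarrow>\<^sub>L 'a"
  assumes a: "a \<in> bounded_ops"
  shows "cinner (blinfun_apply a x) y = cinner x (blinfun_apply (adj a) y)"
proof -
  have "\<exists>w. \<forall>x. cinner (blinfun_apply a x) y = cinner x w" for y
  proof -
    have "bounded_linear (\<lambda>x. inner (blinfun_apply a x) y)"
      by (intro bounded_linear_compose[OF bounded_linear_inner_left] blinfun.bounded_linear_right)
    from riesz_real[OF this] obtain w where w: "\<And>x. inner (blinfun_apply a x) y = inner x w"
      by blast
    have re: "Re (cinner (blinfun_apply a x) y) = Re (cinner x w)" for x
      using w[of x] by (simp add: Re_cinner)
    have "Im (cinner (blinfun_apply a x) y) = Im (cinner x w)" for x
      using re[of "scaleC \<i> x"] a by (simp add: bounded_ops_def cinner_scaleC_left)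
    with re show ?thesis by (metis complex_eqI)
  qed
  then obtain B where B: "\<And>x y. cinner (blinfun_apply a x) y = cinner x (B y)" by metis
  have "bounded_linear B"
  proof (rule bounded_linear_intro[where K = "norm a"])
    fix y z :: 'a and r :: real
    show "B (y + z) = B y + B z"
      by (rule cinner_eqI) (metis B cinner_add_right)
    show "B (r *\<^sub>R y) = r *\<^sub>R B y"
      by (rule cinner_eqI) (metis B cinner_scaleC_right scaleC_of_real)
    have "(norm (B y))^2 = inner (blinfun_apply a (B y)) y"
      by (metis B Re_cinner power2_norm_eq_inner)
    also have "\<dots> \<le> norm (blinfun_apply a (B y)) * norm y" by (rule norm_cauchy_schwarz)
    also have "\<dots> \<le> norm a * norm (B y) * norm y"
      by (intro mult_right_mono norm_blinfun) simp
    finally have "norm (B y) * norm (B y) \<le> norm (B y) * (norm y * norm a)"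
      by (simp add: power2_eq_square mult_ac)
    then show "norm (B y) \<le> norm y * norm a"
      by (cases "norm (B y) = 0") (auto simp: mult_le_cancel_left)
  qed
  then have "\<And>x y. cinner (blinfun_apply a x) y = cinner x (blinfun_apply (Blinfun B) y)"
    by (simp add: B bounded_linear_Blinfun_apply)
  then show ?thesis using adj_unique by metis
qed

section \<open>Von Neumann algebras\<close>

definition commutant :: "('a::complex_hilbert \<Rightarrow>\<^sub>L 'a) set \<Rightarrow> ('a \<Rightarrow>\<^sub>L 'a) set" where
  "commutant S = {b \<in> bounded_ops. \<forall>a\<in>S. a o\<^sub>L b = b o\<^sub>L a}"

definition von_neumann_algebra :: "('a::complex_hilbert \<Rightarrow>\<^sub>L 'a) set \<Rightarrow> bool" where
  "von_neumann_algebra M \<longleftrightarrow> adj ` M \<subseteq> M \<and> commutant (commutant M) = M"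

definition center :: "('a::complex_hilbert \<Rightarrow>\<^sub>L 'a) set \<Rightarrow> ('a \<Rightarrow>\<^sub>L 'a) set" where
  "center M = {z \<in> M. \<forall>a\<in>M. a o\<^sub>L z = z o\<^sub>L a}"

definition projections :: "('a::complex_hilbert \<Rightarrow>\<^sub>L 'a) set \<Rightarrow> ('a \<Rightarrow>\<^sub>L 'a) set" where
  "projections M = {p \<in> M. adj p = p \<and> p o\<^sub>L p = p}"

definition mvn_equiv ::
  "('a::complex_hilbert \<Rightarrow>\<^sub>L 'a) set \<Rightarrow> ('a \<Rightarrow>\<^sub>L 'a) \<Rightarrow> ('a \<Rightarrow>\<^sub>L 'a) \<Rightarrow> bool" where
  "mvn_equiv M p q \<longleftrightarrow> (\<exists>v\<in>M. adj v o\<^sub>L v = p \<and> v o\<^sub>L adj v = q)"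

text \<open>For projections, \<open>q o\<^sub>L p = q\<close> is the order relation \<open>q \<le> p\<close>.\<close>

definition finite_projection ::
  "('a::complex_hilbert \<Rightarrow>\<^sub>L 'a) set \<Rightarrow> ('a \<Rightarrow>\<^sub>L 'a) \<Rightarrow> bool" where
  "finite_projection M p \<longleftrightarrow>
     p \<in> projections M \<and> (\<forall>q\<in>projections M. q o\<^sub>L p = q \<and> mvn_equiv M q p \<longrightarrow> q = p)"

definition properly_infinite :: "('a::complex_hilbert \<Rightarrow>\<^sub>L 'a) set \<Rightarrow> bool" where
  "properly_infinite M \<longleftrightarrow>
     M \<noteq> {0} \<and> (\<forall>p \<in> projections M \<inter> center M. p \<noteq> 0 \<longrightarrow> \<not> finite_projection M p)"

definition unitaries :: "('a::complex_hilbert \<Rightarrow>\<^sub>L 'a) set \<Rightarrow> ('a \<Rightarrow>\<^sub>L 'a) set" where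
  "unitaries M = {u \<in> M. adj u o\<^sub>L u = id_blinfun \<and> u o\<^sub>L adj u = id_blinfun}"

definition unitary_orbit ::
  "('a::complex_hilbert \<Rightarrow>\<^sub>L 'a) set \<Rightarrow> ('a \<Rightarrow>\<^sub>L 'a) \<Rightarrow> ('a \<Rightarrow>\<^sub>L 'a) set" where
  "unitary_orbit M h = {u o\<^sub>L h o\<^sub>L adj u |u. u \<in> unitaries M}"

section \<open>Ideals, quotients and the left essential central spectrum\<close>

definition op_ring :: "('a::complex_hilbert \<Rightarrow>\<^sub>L 'a) set \<Rightarrow> ('a \<Rightarrow>\<^sub>L 'a) ring" where
  "op_ring A = \<lparr>carrier = A, mult = (o\<^sub>L), one = id_blinfun, zero = 0, add = (+)\<rparr>"

lemma ring_commutant: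
  fixes S :: "('a::complex_hilbert \<Rightarrow>\<^sub>L 'a) set"
  shows "ring (op_ring (commutant S))"
proof -
  interpret bilin: bounded_bilinear "(o\<^sub>L) :: ('a \<Rightarrow>\<^sub>L 'a) \<Rightarrow> _"
    by (rule bounded_bilinear_blinfun_compose)
  have sc0: "scaleC c (0::'a) = 0" for c
    using scaleC_add_right[of c 0 0] by simp
  have scm: "scaleC c (- x) = - scaleC c x" for c and x :: 'a
    using scaleC_add_right[of c x "- x"] by (simp add: sc0 eq_neg_iff_add_eq_0 add.commute)
  have zero: "0 \<in> commutant S" and one: "id_blinfun \<in> commutant S"
    by (auto simp: commutant_def bounded_ops_def sc0 intro!: blinfun_eqI)
  have plus: "a + b \<in> commutant S" if "a \<in> commutant S" "b \<in> commutant S" for a b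
    using that by (auto simp: commutant_def bounded_ops_def blinfun.add_left scaleC_add_right
        bilin.add_left bilin.add_right)
  have minus: "- a \<in> commutant S" if "a \<in> commutant S" for a
    using that by (auto simp: commutant_def bounded_ops_def blinfun.minus_left scm
        bilin.minus_left bilin.minus_right)
  have assoc: "(a o\<^sub>L b) o\<^sub>L c = a o\<^sub>L (b o\<^sub>L c)" for a b c :: "'a \<Rightarrow>\<^sub>L 'a"
    by (rule blinfun_eqI) simp
  have comp: "a o\<^sub>L b \<in> commutant S" if "a \<in> commutant S" "b \<in> commutant S" for a b
    using that by (auto simp: commutant_def bounded_ops_def) (metis assoc)
  show ?thesis
  proof (rule ringI)
    show "abelian_group (op_ring (commutant S))"
      by (rule abelian_groupI)
        (auto simp: op_ring_def zero plus add.assoc add.commute intro!: bexI[OF _ minus])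
    show "Group.monoid (op_ring (commutant S))"
      by (rule monoidI) (auto simp: op_ring_def one comp assoc intro!: blinfun_eqI)
  qed (auto simp: op_ring_def bilin.add_left bilin.add_right)
qed

lemma ring_op_ring: "von_neumann_algebra M \<Longrightarrow> ring (op_ring M)"
  using ring_commutant[of "commutant M"] by (simp add: von_neumann_algebra_def)

lemma ring_op_ring_center:
  assumes "von_neumann_algebra M"
  shows "ring (op_ring (center M))"
proof -
  have M: "commutant (commutant M) = M" using assms by (simp add: von_neumann_algebra_def)
  then have "M \<subseteq> bounded_ops" by (auto simp: commutant_def)
  then have "center M = commutant M \<inter> commutant (commutant M)"
    unfolding M by (auto simp: center_def commutant_def)
  also have "\<dots> = commutant (M \<union> commutant M)"
    by (auto simp: commutant_def)
  finally show ?thesis using ring_commutant by metis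
qed

text \<open>As \<open>M\<close> and its center contain the scalars, their ring ideals are automatically complex
  subspaces. \<open>M\<close> is norm closed, so \<^const>\<open>closed\<close> means closed in \<open>M\<close>.\<close>

definition closed_ideal_generated ::
  "('a::complex_hilbert \<Rightarrow>\<^sub>L 'a) set \<Rightarrow> ('a \<Rightarrow>\<^sub>L 'a) set \<Rightarrow> ('a \<Rightarrow>\<^sub>L 'a) set" where
  "closed_ideal_generated M S = \<Inter>{I. ideal I (op_ring M) \<and> closed I \<and> S \<subseteq> I}"

definition compact_ideal :: "('a::complex_hilbert \<Rightarrow>\<^sub>L 'a) set \<Rightarrow> ('a \<Rightarrow>\<^sub>L 'a) set" where
  "compact_ideal M = closed_ideal_generated M {p. finite_projection M p}"

definition maximal_ideal_space ::
  "('a::complex_hilbert \<Rightarrow>\<^sub>L 'a) set \<Rightarrow> ('a \<Rightarrow>\<^sub>L 'a) set set" where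
  "maximal_ideal_space Z = {\<zeta>. maximalideal \<zeta> (op_ring Z)}"

definition sum_ideal ::
  "('a::complex_hilbert \<Rightarrow>\<^sub>L 'a) set \<Rightarrow> ('a \<Rightarrow>\<^sub>L 'a) set \<Rightarrow> ('a \<Rightarrow>\<^sub>L 'a) set" where
  "sum_ideal M \<zeta> = closed_ideal_generated M \<zeta> <+>\<^bsub>op_ring M\<^esub> compact_ideal M"

definition left_invertible :: "('b, 'c) monoid_scheme \<Rightarrow> 'b \<Rightarrow> bool" where
  "left_invertible R x \<longleftrightarrow> (\<exists>y\<in>carrier R. y \<otimes>\<^bsub>R\<^esub> x = \<one>\<^bsub>R\<^esub>)"

definition left_essential_central_spectrum ::
  "('a::complex_hilbert \<Rightarrow>\<^sub>L 'a) set \<Rightarrow> ('a \<Rightarrow>\<^sub>L 'a) \<Rightarrow> ('a \<Rightarrow>\<^sub>L 'a) set" where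
  "left_essential_central_spectrum M h =
     {z \<in> center M. \<forall>\<zeta>\<in>maximal_ideal_space (center M).
        \<not> left_invertible (op_ring M Quot sum_ideal M \<zeta>)
             (sum_ideal M \<zeta> +>\<^bsub>op_ring M\<^esub> (h - z))}"

end

theory Submission
  imports Defs "HOL-Algebra.Ring_Divisibility"
begin

text \<open>
  Translating by \<open>z\<close>, put \<open>x = h - z\<close>; then \<open>z\<close> lies in the strong closure of the orbit iff for
  finitely many vectors there is a unitary \<open>u\<close> making all \<open>\<parallel>x u \<xi>\<parallel>\<close> small.

  If \<open>x\<close> is nowhere left invertible modulo \<open>\<zeta> + K\<close>, then every spectral projection \<open>q\<close> of \<open>x\<^sup>* x\<close> at
  \<open>0\<close> is infinite on each nonzero central projection. Hence every nonzero projection has a nonzero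
  subprojection with infinitely many orthogonal copies inside \<open>q\<close>: if \<open>w\<close> maps \<open>c q\<close> isometrically onto
  a proper subprojection, with defect \<open>r\<close>, the ranges of \<open>w\<^sup>i r\<close> are orthogonal and equivalent. A maximal orthogonal family of such subprojections exhausts \<open>1 - q\<close>, and
  exchanging finitely many of them with copies on which the given vectors are small moves these
  vectors almost into \<open>q\<close>, where \<open>x\<close> is small.

  Conversely, if \<open>1 - y x\<close> lies in \<open>\<zeta> + K\<close>, then on a suitable nonzero central projection \<open>e\<close> it is
  within \<open>1/2\<close> of a finite sum \<open>k\<close> of terms \<open>a p b\<close> with \<open>p\<close> finite. On some finite projection there is
  a vector state which is tracial up to a constant (Murray--von Neumann). Transporting it along
  infinitely many orthogonal copies yields unit vectors \<open>\<xi> i\<close> in the range of \<open>e\<close> for which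
  \<open>\<Sum>i<N. \<parallel>k u \<xi> i\<parallel>\<^sup>2\<close> is bounded uniformly in \<open>N\<close> and in the unitary \<open>u\<close>. If \<open>x u \<xi> i\<close> is small for all
  \<open>i < N\<close>, then \<open>\<parallel>k u \<xi> i\<parallel> \<ge> 1/4\<close>, a contradiction for large \<open>N\<close>.
\<close>

section \<open>The algebra of bounded operators\<close>

text \<open>Each direction turns a failure into a central object. If \<open>c * q\<close> is finite
  for a nonzero central projection \<open>c\<close>, the annihilator of \<open>c\<close> in the
  center lies in a maximal ideal \<open>\<zeta>\<close>, which contains \<open>1 - c\<close>; then
  \<open>q = (1 - c) * q + c * q\<close> lies in \<open>\<zeta> + K\<close>. But
  \<open>1 - q\<close> has the form \<open>y * x\<close>, so \<open>x\<close> would be left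
  invertible there. Conversely, finitely many \<open>s\<close> in \<open>\<zeta>\<close> are
  simultaneously small on one nonzero central projection, because the sum of the
  \<open>s\<^sup>\<dagger> * s\<close> stays in \<open>\<zeta>\<close> and hence is not invertible
  in the center.

  The obstacle is size: the Hilbert space is arbitrary and no faithful trace is at hand. Exhaustion
  families may be uncountable; since a strong neighbourhood tests finitely many vectors, a finite
  subfamily suffices in the end. The trace is replaced by one vector state that is tracial up to the
  factor 4, and Bessel's inequality plays the part of its boundedness. Two projections are compared
  only through one alternative: a nonzero partial isometry links them, or a central projection
  separates them.\<close>

typedef (overloaded) 'a endo = "UNIV :: ('a::real_normed_vector \<Rightarrow>\<^sub>L 'a) set"
  morphisms blinfun_of_endo Endo ..

setup_lifting type_definition_endo

text \<open>Composition becomes \<open>*\<close>, so the ring laws apply to operators. The unit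
  comes from \<open>monoid_mult\<close>, since \<open>real_normed_algebra_1\<close> would demand
  \<open>0 \<noteq> 1\<close>, which fails on the zero space.\<close>

instantiation endo :: (real_normed_vector) "{real_normed_algebra, monoid_mult}"
begin

lift_definition zero_endo :: "'a endo" is 0 .
lift_definition one_endo :: "'a endo" is id_blinfun .
lift_definition plus_endo :: "'a endo \<Rightarrow> 'a endo \<Rightarrow> 'a endo" is "(+)" .
lift_definition minus_endo :: "'a endo \<Rightarrow> 'a endo \<Rightarrow> 'a endo" is "(-)" .
lift_definition uminus_endo :: "'a endo \<Rightarrow> 'a endo" is uminus .
lift_definition times_endo :: "'a endo \<Rightarrow> 'a endo \<Rightarrow> 'a endo" is "(o\<^sub>L)" .
lift_definition scaleR_endo :: "real \<Rightarrow> 'a endo \<Rightarrow> 'a endo" is "(*\<^sub>R)" .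
lift_definition norm_endo :: "'a endo \<Rightarrow> real" is norm .

definition sgn_endo :: "'a endo \<Rightarrow> 'a endo" where "sgn_endo a = scaleR (inverse (norm a)) a"
definition dist_endo :: "'a endo \<Rightarrow> 'a endo \<Rightarrow> real" where "dist_endo a b = norm (a - b)"
definition uniformity_endo :: "('a endo \<times> 'a endo) filter" where
  "uniformity_endo = (INF e\<in>{0<..}. principal {(x, y). dist x y < e})"
definition open_endo :: "'a endo set \<Rightarrow> bool" where
  "open_endo U = (\<forall>x\<in>U. eventually (\<lambda>(x', y). x' = x \<longrightarrow> y \<in> U) uniformity)"

instance
proof
  fix a b c :: "'a endo" and r t :: real
  show "a * b * c = a * (b * c)" by transfer (rule blinfun_eqI, simp)
  show "1 * a = a" "a * 1 = a" by (transfer, rule blinfun_eqI, simp)+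
  show "(a + b) * c = a * c + b * c" "a * (b + c) = a * b + a * c"
    "(r *\<^sub>R a) * b = r *\<^sub>R (a * b)" "a * (r *\<^sub>R b) = r *\<^sub>R (a * b)"
    by (transfer, rule blinfun_eqI,
        simp add: blinfun.add_left blinfun.add_right blinfun.scaleR_left blinfun.scaleR_right)+
  show "norm (a * b) \<le> norm a * norm b" by transfer (rule norm_blinfun_compose)
  show "norm (a + b) \<le> norm a + norm b" by transfer (rule norm_triangle_ineq)
  show "norm (r *\<^sub>R a) = \<bar>r\<bar> * norm a" "(norm a = 0) = (a = 0)" by (transfer, simp)+
  show "a + b + c = a + (b + c)" "a + b = b + a" "0 + a = a" "- a + a = 0" "a - b = a + - b"
    "r *\<^sub>R (a + b) = r *\<^sub>R a + r *\<^sub>R b" "(r + t) *\<^sub>R a = r *\<^sub>R a + t *\<^sub>R a"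
    "r *\<^sub>R t *\<^sub>R a = (r * t) *\<^sub>R a" "1 *\<^sub>R a = a"
    by (transfer, simp add: algebra_simps)+
qed (rule dist_endo_def sgn_endo_def uniformity_endo_def open_endo_def)+

end

lift_definition eapp :: "'a::real_normed_vector endo \<Rightarrow> 'a \<Rightarrow> 'a" (infixr "\<cdot>" 75) is blinfun_apply .

lemma endo_eqI: "(\<And>x. a \<cdot> x = b \<cdot> x) \<Longrightarrow> a = b"
  by transfer (rule blinfun_eqI)

interpretation eapp: bounded_bilinear "eapp :: 'a::real_normed_vector endo \<Rightarrow> 'a \<Rightarrow> 'a"
proof
  fix a b :: "'a endo" and x y :: 'a and r :: real
  show "(a + b) \<cdot> x = a \<cdot> x + b \<cdot> x" by transfer (rule blinfun.add_left)
  show "a \<cdot> (x + y) = a \<cdot> x + a \<cdot> y" by transfer (rule blinfun.add_right)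
  show "(r *\<^sub>R a) \<cdot> x = r *\<^sub>R a \<cdot> x" by transfer (rule blinfun.scaleR_left)
  show "a \<cdot> (r *\<^sub>R x) = r *\<^sub>R a \<cdot> x" by transfer (rule blinfun.scaleR_right)
  show "\<exists>K. \<forall>(a :: 'a endo) x. norm (a \<cdot> x) \<le> norm a * norm x * K"
    by (rule exI[of _ 1], transfer) (simp add: norm_blinfun)
qed

lemma eapp_mult [simp]: "(a * b) \<cdot> x = a \<cdot> b \<cdot> x"
  by transfer simp

lemma eapp_one [simp]: "1 \<cdot> x = x"
  by transfer simp

declare eapp.add_left [simp] eapp.diff_left [simp] eapp.minus_left [simp] eapp.scaleR_left [simp]
  eapp.zero_left [simp] eapp.zero_right [simp]

lemma norm_eapp: "norm (a \<cdot> x) \<le> norm a * norm x"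
  by transfer (rule norm_blinfun)

lemma norm_endo_bound: "0 \<le> B \<Longrightarrow> (\<And>x. norm (a \<cdot> x) \<le> B * norm x) \<Longrightarrow> norm a \<le> B"
  by transfer (rule norm_blinfun_bound)

definition endo_of :: "('a::real_normed_vector \<Rightarrow> 'a) \<Rightarrow> 'a endo" where
  "endo_of f = Endo (Blinfun f)"

lemma eapp_endo_of: "bounded_linear f \<Longrightarrow> endo_of f \<cdot> x = f x"
  by (simp add: endo_of_def eapp.rep_eq Endo_inverse bounded_linear_Blinfun_apply)

instance endo :: (banach) banach
proof
  fix X :: "nat \<Rightarrow> 'a endo" assume X: "Cauchy X"
  have "Cauchy (\<lambda>n. blinfun_of_endo (X n))"
    using X unfolding Cauchy_def dist_norm by (simp add: norm_endo.rep_eq minus_endo.rep_eq)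
  then obtain L where L: "(\<lambda>n. blinfun_of_endo (X n)) \<longlonglongrightarrow> L"
    using Cauchy_convergent convergent_def by blast
  have "X \<longlonglongrightarrow> Endo L"
    using L unfolding LIMSEQ_def dist_norm
    by (simp add: norm_endo.rep_eq minus_endo.rep_eq Endo_inverse)
  then show "convergent X" by (auto simp: convergent_def)
qed

instance complex_hilbert \<subseteq> banach ..

section \<open>Adjoints and projections\<close>

text \<open>The adjoint for the real inner product. It agrees with \<open>adj\<close> on
  complex-linear operators (\<open>dag_Endo\<close>) and sends multiplication by \<open>c\<close> to
  multiplication by its conjugate (\<open>scal_dag\<close>), so one involution serves the algebra
  and the scalars it commutes with.\<close>

definition dag :: "'a::{real_inner,banach} endo \<Rightarrow> 'a endo" ("_\<^sup>\<dagger>" [1000] 1000) where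
  "a\<^sup>\<dagger> = (THE b. \<forall>x y. inner (a \<cdot> x) y = inner x (b \<cdot> y))"

lemma inner_eqI: "(\<And>x. inner x u = inner x v) \<Longrightarrow> u = v"
  by (metis inner_commute vector_eq_rdot)

lemma dag_unique:
  assumes "\<And>x y. inner (a \<cdot> x) y = inner x (b \<cdot> y)"
  shows "a\<^sup>\<dagger> = b"
  unfolding dag_def
proof (rule the_equality)
  fix b' assume "\<forall>x y. inner (a \<cdot> x) y = inner x (b' \<cdot> y)"
  then show "b' = b" using assms by (metis endo_eqI inner_eqI)
qed (use assms in blast)

lemma inner_dag: "inner (a \<cdot> x) y = inner x (a\<^sup>\<dagger> \<cdot> y)"
proof -
  have "\<exists>w. \<forall>x. inner (a \<cdot> x) y = inner x w" for y
    by (rule riesz_real)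
      (intro bounded_linear_compose[OF bounded_linear_inner_left] eapp.bounded_linear_right)
  then obtain B where B: "\<And>x y. inner (a \<cdot> x) y = inner x (B y)" by metis
  have "bounded_linear B"
  proof (rule bounded_linear_intro[where K = "norm a"])
    fix y z and r :: real
    show "B (y + z) = B y + B z"
      by (rule inner_eqI) (metis B inner_add_right)
    show "B (r *\<^sub>R y) = r *\<^sub>R B y"
      by (rule inner_eqI) (metis B inner_scaleR_right)
    have "(norm (B y))^2 = inner (a \<cdot> B y) y"
      by (metis B power2_norm_eq_inner)
    also have "\<dots> \<le> norm (a \<cdot> B y) * norm y" by (rule norm_cauchy_schwarz)
    also have "\<dots> \<le> norm a * norm (B y) * norm y"
      by (intro mult_right_mono norm_eapp) simp
    finally have "norm (B y) * norm (B y) \<le> norm (B y) * (norm y * norm a)"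
      by (simp add: power2_eq_square mult_ac)
    then show "norm (B y) \<le> norm y * norm a"
      by (cases "norm (B y) = 0") (auto simp: mult_le_cancel_left)
  qed
  then show ?thesis using dag_unique[of a "endo_of B"] B by (simp add: eapp_endo_of)
qed

lemma inner_dag': "inner (a\<^sup>\<dagger> \<cdot> x) y = inner x (a \<cdot> y)"
  by (metis inner_dag inner_commute)

lemma dag_dag [simp]: "a\<^sup>\<dagger>\<^sup>\<dagger> = a"
  by (rule dag_unique) (rule inner_dag')

lemma dag_mult [simp]: "(a * b)\<^sup>\<dagger> = b\<^sup>\<dagger> * a\<^sup>\<dagger>"
  by (rule dag_unique) (simp add: inner_dag)

lemma dag_add [simp]: "(a + b)\<^sup>\<dagger> = a\<^sup>\<dagger> + b\<^sup>\<dagger>"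
  by (rule dag_unique) (simp add: inner_dag inner_add_left inner_add_right)

lemma dag_diff [simp]: "(a - b)\<^sup>\<dagger> = a\<^sup>\<dagger> - b\<^sup>\<dagger>"
  by (rule dag_unique) (simp add: inner_dag inner_diff_left inner_diff_right)

lemma dag_minus [simp]: "(- a)\<^sup>\<dagger> = - a\<^sup>\<dagger>"
  by (rule dag_unique) (simp add: inner_dag)

lemma dag_scaleR [simp]: "(r *\<^sub>R a)\<^sup>\<dagger> = r *\<^sub>R a\<^sup>\<dagger>"
  by (rule dag_unique) (simp add: inner_dag)

lemma dag_one [simp]: "1\<^sup>\<dagger> = 1"
  by (rule dag_unique) simp

lemma dag_zero [simp]: "0\<^sup>\<dagger> = 0"
  by (rule dag_unique) simp

lemma dag_sum: "(sum f A)\<^sup>\<dagger> = (\<Sum>i\<in>A. (f i)\<^sup>\<dagger>)"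
  by (induction A rule: infinite_finite_induct) simp_all

lemma dag_eq_zero_iff [simp]: "a\<^sup>\<dagger> = 0 \<longleftrightarrow> a = 0"
  by (metis dag_dag dag_zero)

lemma norm_eapp_sq: "(norm (a \<cdot> x))\<^sup>2 = inner ((a\<^sup>\<dagger> * a) \<cdot> x) x"
  by (simp add: power2_norm_eq_inner inner_dag')

lemma dag_mult_self_eq_zero: "a\<^sup>\<dagger> * a = 0 \<Longrightarrow> a = 0"
  by (rule endo_eqI) (use norm_eapp_sq[of a] in simp)

lemma norm_dag_le: "norm (a\<^sup>\<dagger>) \<le> norm a"
proof (rule norm_endo_bound)
  fix y
  have "(norm (a\<^sup>\<dagger> \<cdot> y))^2 = inner (a \<cdot> a\<^sup>\<dagger> \<cdot> y) y"
    by (simp add: inner_dag power2_norm_eq_inner)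
  also have "\<dots> \<le> norm (a \<cdot> a\<^sup>\<dagger> \<cdot> y) * norm y" by (rule norm_cauchy_schwarz)
  also have "\<dots> \<le> norm a * norm (a\<^sup>\<dagger> \<cdot> y) * norm y"
    by (intro mult_right_mono norm_eapp) simp
  finally have "norm (a\<^sup>\<dagger> \<cdot> y) * norm (a\<^sup>\<dagger> \<cdot> y) \<le> norm (a\<^sup>\<dagger> \<cdot> y) * (norm a * norm y)"
    by (simp add: power2_eq_square mult_ac)
  then show "norm (a\<^sup>\<dagger> \<cdot> y) \<le> norm a * norm y"
    by (cases "norm (a\<^sup>\<dagger> \<cdot> y) = 0") (auto simp: mult_le_cancel_left)
qed simp

lemma norm_dag [simp]: "norm (a\<^sup>\<dagger>) = norm a"
  by (metis norm_dag_le dag_dag order_antisym)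

lemma bounded_linear_dag: "bounded_linear dag"
  by (rule bounded_linear_intro[where K = 1]) simp_all

definition proj :: "'a::{real_inner,banach} endo \<Rightarrow> bool" where
  "proj p \<longleftrightarrow> p\<^sup>\<dagger> = p \<and> p * p = p"

lemma projD: "proj p \<Longrightarrow> p\<^sup>\<dagger> = p" "proj p \<Longrightarrow> p * p = p"
  by (simp_all add: proj_def)

lemma proj_1 [simp]: "proj 1"
  by (simp add: proj_def)

lemma proj_app [simp]: "proj p \<Longrightarrow> p \<cdot> p \<cdot> x = p \<cdot> x"
  by (metis eapp_mult projD(2))

lemma inner_proj: "proj p \<Longrightarrow> inner (p \<cdot> x) x = (norm (p \<cdot> x))\<^sup>2"
  using norm_eapp_sq[of p x] by (simp add: proj_def)

lemma proj_complement: "proj p \<Longrightarrow> proj (1 - p)"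
  by (simp add: proj_def algebra_simps)

lemma proj_swap:
  assumes "proj p" "proj q" "q * p = q"
  shows "p * q = q"
proof -
  have "(q * p)\<^sup>\<dagger> = q\<^sup>\<dagger>" by (simp only: assms(3))
  then show ?thesis using assms(1,2) by (simp add: projD)
qed

lemma proj_diff: "proj p \<Longrightarrow> proj q \<Longrightarrow> q * p = q \<Longrightarrow> proj (p - q)"
  using proj_swap[of p q] by (simp add: proj_def algebra_simps)

lemma proj_pythagoras:
  assumes "proj p"
  shows "(norm x)\<^sup>2 = (norm (p \<cdot> x))\<^sup>2 + (norm (x - p \<cdot> x))\<^sup>2"
proof -
  have "inner (p \<cdot> x) (x - p \<cdot> x) = 0"
    using assms by (simp add: inner_diff_right inner_proj power2_norm_eq_inner[symmetric])
  then show ?thesis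
    by (simp add: power2_norm_eq_inner inner_diff_left inner_diff_right inner_commute)
qed

lemma norm_proj_app: "proj p \<Longrightarrow> norm (p \<cdot> x) \<le> norm x"
  by (rule power2_le_imp_le) (use proj_pythagoras[of p x] zero_le_power2[of "norm (x - p \<cdot> x)"] in linarith, simp)

lemma norm_proj: "proj p \<Longrightarrow> norm p \<le> 1"
  by (rule norm_endo_bound) (simp_all add: norm_proj_app)

section \<open>Orthogonal projections onto closed subspaces, kernels and ranges\<close>

lemma nearest_point_orthogonal:
  fixes S :: "'a::{real_inner,banach} set"
  assumes S: "closed S" "subspace S"
  shows "\<exists>s\<in>S. \<forall>v\<in>S. inner (y - s) v = 0"
proof -
  define F where "F x = (norm (y - x))\<^sup>2" for x
  define m where "m = (INF x\<in>S. F x)"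
  have ne: "S \<noteq> {}" using S(2) subspace_0 by blast
  have bdd: "bdd_below (F ` S)" by (auto intro!: bdd_belowI[of _ 0] simp: F_def)
  have m_le: "m \<le> F x" if "x \<in> S" for x unfolding m_def by (rule cINF_lower[OF bdd that])
  have "\<exists>x\<in>S. F x < m + 1 / real (Suc n)" for n
    using cINF_less_iff[OF ne bdd, of "m + 1 / real (Suc n)"] by (simp add: m_def)
  then obtain X where XS: "\<And>n. X n \<in> S" and X: "\<And>n. F (X n) < m + 1 / real (Suc n)" by metis
  \<comment> \<open>The parallelogram identity: two almost minimizing points are close, because
    their midpoint lies in \<open>S\<close> too and cannot do better than \<open>m\<close>.\<close>
  have par: "(norm (x - z))^2 \<le> 2 * (F x - m) + 2 * (F z - m)" if "x \<in> S" "z \<in> S" for x z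
  proof -
    have "2 * F x + 2 * F z - 4 * F ((1/2) *\<^sub>R (x + z)) = (norm (x - z))^2"
      unfolding F_def power2_norm_eq_inner
      by (simp add: inner_add_left inner_add_right inner_diff_left
          inner_diff_right inner_commute algebra_simps)
    moreover have "4 * m \<le> 4 * F ((1/2) *\<^sub>R (x + z))"
      using that S(2) by (intro mult_left_mono m_le) (auto simp: subspace_add subspace_scale)
    ultimately show ?thesis by argo
  qed
  have "Cauchy X"
  proof (rule metric_CauchyI)
    fix e :: real assume e: "e > 0"
    obtain N where N: "4 / e^2 < real N" using reals_Archimedean2 by blast
    have small: "1 / real (Suc n) < e^2 / 4" if "n \<ge> N" for n
    proof -
      have "4 / e^2 < real (Suc n)" using N that by linarith
      then show ?thesis using e by (simp add: field_simps)
    qed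
    have "dist (X i) (X j) < e" if "i \<ge> N" "j \<ge> N" for i j
    proof -
      have "(norm (X i - X j))^2 < e^2"
        using par[OF XS[of i] XS[of j]] X[of i] X[of j] small[OF that(1)] small[OF that(2)] by argo
      then show ?thesis unfolding dist_norm using e power2_less_imp_less by fastforce
    qed
    then show "\<exists>M. \<forall>i\<ge>M. \<forall>j\<ge>M. dist (X i) (X j) < e" by blast
  qed
  then obtain w where w: "X \<longlonglongrightarrow> w" using Cauchy_convergent convergent_def by blast
  have wS: "w \<in> S" using closed_sequentially[OF S(1) XS w] .
  have "(\<lambda>n. F (X n)) \<longlonglongrightarrow> F w"
    unfolding F_def by (intro tendsto_intros w)
  moreover have "(\<lambda>n. m + 1 / real (Suc n)) \<longlonglongrightarrow> m + 0"
    by (intro tendsto_intros LIMSEQ_Suc lim_1_over_n)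
  ultimately have Fw: "F w \<le> m"
    using X by (intro LIMSEQ_le[of "\<lambda>n. F (X n)" _ "\<lambda>n. m + 1 / real (Suc n)"])
      (auto intro: less_imp_le)
  have "inner (y - w) v = 0" if v: "v \<in> S" for v
  proof (rule ccontr)
    define c where "c = inner (y - w) v"
    assume "inner (y - w) v \<noteq> 0"
    then have c: "c \<noteq> 0" by (simp add: c_def)
    have q: "0 \<le> - 2 * t * c + t^2 * inner v v" for t
    proof -
      have "w + t *\<^sub>R v \<in> S" using S(2) wS v by (simp add: subspace_add subspace_scale)
      then have "F w \<le> F (w + t *\<^sub>R v)" using Fw m_le by force
      then show ?thesis unfolding F_def c_def power2_norm_eq_inner
        by (simp add: inner_add_left inner_add_right inner_diff_left inner_diff_right
            inner_commute power2_eq_square algebra_simps)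
    qed
    have "v \<noteq> 0" using c by (auto simp: c_def)
    then have v: "inner v v > 0" by simp
    \<comment> \<open>\<open>c / inner v v\<close> minimizes the quadratic polynomial in
      \<open>q\<close>; its value there is negative unless \<open>c = 0\<close>.\<close>
    have "- 2 * (c / inner v v) * c + (c / inner v v)^2 * inner v v = - (c^2 / inner v v)"
      using v by (simp add: field_simps power2_eq_square)
    with q[of "c / inner v v"] have "c^2 / inner v v \<le> 0" by simp
    moreover have "c^2 / inner v v > 0" using c v by simp
    ultimately show False by simp
  qed
  with wS show ?thesis by blast
qed

lemma projection_onto_closed_subspace:
  fixes S :: "'a::{real_inner,banach} set"
  assumes S: "closed S" "subspace S"
  obtains p where "proj p" "\<And>x. p \<cdot> x \<in> S" "\<And>x. x \<in> S \<Longrightarrow> p \<cdot> x = x"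
proof -
  have "\<forall>y. \<exists>s. s \<in> S \<and> (\<forall>v\<in>S. inner (y - s) v = 0)"
    using nearest_point_orthogonal[OF S] by blast
  from choice[OF this] obtain P where
    "\<forall>y. P y \<in> S \<and> (\<forall>v\<in>S. inner (y - P y) v = 0)" ..
  then have PS: "P y \<in> S" and P: "v \<in> S \<Longrightarrow> inner (y - P y) v = 0" for y v by blast+
  have P': "inner (P y) v = inner y v" if "v \<in> S" for y v
    using P[OF that, of y] by (simp add: inner_diff_left)
  have uniq: "P y = s" if s: "s \<in> S" and "\<And>v. v \<in> S \<Longrightarrow> inner s v = inner y v" for y s
  proof -
    have "P y - s \<in> S" using S(2) PS s by (simp add: subspace_diff)
    then have "inner (P y - s) (P y - s) = 0"
      using that(2)[of "P y - s"] P'[of "P y - s" y] by (simp add: inner_diff_left)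
    then show ?thesis by simp
  qed
  have "bounded_linear P"
  proof (rule bounded_linear_intro[where K = 1])
    fix y z and r :: real
    show "P (y + z) = P y + P z"
      using S(2) PS by (intro uniq) (simp_all add: subspace_add P' inner_add_left)
    show "P (r *\<^sub>R y) = r *\<^sub>R P y"
      using S(2) PS by (intro uniq) (simp_all add: subspace_scale P')
    have "(norm (P y))\<^sup>2 = inner y (P y)"
      by (simp add: P' PS power2_norm_eq_inner)
    also have "\<dots> \<le> norm y * norm (P y)" by (rule norm_cauchy_schwarz)
    finally show "norm (P y) \<le> norm y * 1"
      by (cases "norm (P y) = 0") (auto simp: power2_eq_square mult_le_cancel_right)
  qed
  then have app: "endo_of P \<cdot> x = P x" for x by (rule eapp_endo_of)
  have id: "P x = x" if "x \<in> S" for x by (rule uniq) (simp_all add: that)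
  have "inner (P x) y = inner x (P y)" for x y
    using P'[OF PS, of y x] P'[OF PS, of x y] by (simp add: inner_commute)
  then have "(endo_of P)\<^sup>\<dagger> = endo_of P" by (intro dag_unique) (simp add: app)
  moreover have "endo_of P * endo_of P = endo_of P" by (rule endo_eqI) (simp add: app id PS)
  ultimately show ?thesis using that[of "endo_of P"] by (simp add: proj_def app PS id)
qed

text \<open>Invariance of \<open>S\<close> under \<open>b\<close> gives only
  \<open>p * b * p = b * p\<close>; invariance under the adjoint gives the mirror image, and both
  together make \<open>S\<close> reducing.\<close>

lemma projection_commute:
  assumes p: "proj p" "\<And>x. p \<cdot> x \<in> S" "\<And>x. x \<in> S \<Longrightarrow> p \<cdot> x = x"
    and b: "\<And>x. x \<in> S \<Longrightarrow> b \<cdot> x \<in> S" "\<And>x. x \<in> S \<Longrightarrow> b\<^sup>\<dagger> \<cdot> x \<in> S"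
  shows "p * b = b * p"
proof -
  have 1: "p * b * p = b * p" by (rule endo_eqI) (simp add: p b)
  have "p * b\<^sup>\<dagger> * p = b\<^sup>\<dagger> * p" by (rule endo_eqI) (simp add: p b)
  then have "(p * b\<^sup>\<dagger> * p)\<^sup>\<dagger> = (b\<^sup>\<dagger> * p)\<^sup>\<dagger>" by simp
  then have "p * b * p = p * b" using p(1) by (simp add: projD mult.assoc)
  with 1 show ?thesis by simp
qed

text \<open>The common source of range projections, central supports and supports of vectors. The
  last clause places the projection in a commutant: it suffices that \<open>b\<close> and its
  adjoint preserve the common kernel.\<close>

lemma kernel_projection:
  fixes A :: "'a::{real_inner,banach} endo set"
  obtains p where "proj p" "\<And>a. a \<in> A \<Longrightarrow> a * p = 0"
    "\<And>\<xi>. (\<And>a. a \<in> A \<Longrightarrow> a \<cdot> \<xi> = 0) \<Longrightarrow> p \<cdot> \<xi> = \<xi>"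
    "\<And>x. (\<And>a. a \<in> A \<Longrightarrow> a * x = 0) \<Longrightarrow> p * x = x"
    "\<And>b. (\<And>a \<xi>. a \<in> A \<Longrightarrow> (\<And>a. a \<in> A \<Longrightarrow> a \<cdot> \<xi> = 0) \<Longrightarrow> a \<cdot> b \<cdot> \<xi> = 0 \<and> a \<cdot> b\<^sup>\<dagger> \<cdot> \<xi> = 0)
      \<Longrightarrow> p * b = b * p"
proof -
  define N where "N = (\<Inter>a\<in>A. {\<xi>. a \<cdot> \<xi> = 0})"
  have N: "\<xi> \<in> N \<longleftrightarrow> (\<forall>a\<in>A. a \<cdot> \<xi> = 0)" for \<xi> by (simp add: N_def)
  have "closed N" unfolding N_def
    by (intro closed_INT ballI closed_Collect_eq continuous_on_const linear_continuous_on
        eapp.bounded_linear_right)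
  moreover have "subspace N"
    by (rule subspaceI) (simp_all add: N eapp.add_right eapp.scaleR_right)
  ultimately obtain p where p: "proj p" "\<And>x. p \<cdot> x \<in> N" "\<And>x. x \<in> N \<Longrightarrow> p \<cdot> x = x"
    using projection_onto_closed_subspace by metis
  have 1: "a * p = 0" if "a \<in> A" for a
    by (rule endo_eqI) (use p(2) that N in simp)
  have 2: "p \<cdot> \<xi> = \<xi>" if "\<And>a. a \<in> A \<Longrightarrow> a \<cdot> \<xi> = 0" for \<xi>
    by (rule p(3)) (use N that in simp)
  have 3: "p * x = x" if "\<And>a. a \<in> A \<Longrightarrow> a * x = 0" for x
  proof (rule endo_eqI)
    fix \<xi>
    have "a \<cdot> x \<cdot> \<xi> = 0" if "a \<in> A" for a
      by (metis that \<open>\<And>a. a \<in> A \<Longrightarrow> a * x = 0\<close> eapp_mult eapp.zero_left)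
    then show "(p * x) \<cdot> \<xi> = x \<cdot> \<xi>" by (simp add: 2)
  qed
  have 4: "p * b = b * p"
    if "\<And>a \<xi>. a \<in> A \<Longrightarrow> (\<And>a. a \<in> A \<Longrightarrow> a \<cdot> \<xi> = 0) \<Longrightarrow> a \<cdot> b \<cdot> \<xi> = 0 \<and> a \<cdot> b\<^sup>\<dagger> \<cdot> \<xi> = 0" for b
    by (rule projection_commute[OF p]) (use N that in auto)
  show ?thesis using that[OF p(1) 1 2 3 4] by simp
qed

text \<open>The closed range of \<open>a\<close> is the orthogonal complement of the kernel of
  \<open>a\<^sup>\<dagger>\<close>, so \<open>p = 1 - q\<close> for the kernel projection
  \<open>q\<close>.\<close>

lemma range_projection:
  fixes a :: "'a::{real_inner,banach} endo"
  obtains p where "proj p" "p * a = a" "\<And>x. x * a = 0 \<Longrightarrow> x * p = 0"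
    "\<And>b. a * b = b * a \<Longrightarrow> a * b\<^sup>\<dagger> = b\<^sup>\<dagger> * a \<Longrightarrow> p * b = b * p"
proof -
  obtain q where q: "proj q" "a\<^sup>\<dagger> * q = 0" "\<And>x. a\<^sup>\<dagger> * x = 0 \<Longrightarrow> q * x = x"
    and comm: "\<And>b. (\<And>\<xi>. a\<^sup>\<dagger> \<cdot> \<xi> = 0 \<Longrightarrow> a\<^sup>\<dagger> \<cdot> b \<cdot> \<xi> = 0 \<and> a\<^sup>\<dagger> \<cdot> b\<^sup>\<dagger> \<cdot> \<xi> = 0) \<Longrightarrow> q * b = b * q"
    by (rule kernel_projection[of "{a\<^sup>\<dagger>}"]) auto
  have "(q * a)\<^sup>\<dagger> = 0" using q by (simp add: projD)
  then have qa: "q * a = 0" by (simp del: dag_mult)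
  have "x * (1 - q) = 0" if "x * a = 0" for x
  proof -
    have "(x * a)\<^sup>\<dagger> = 0" using that by (simp del: dag_mult)
    then have "q * x\<^sup>\<dagger> = x\<^sup>\<dagger>" using q(3) by simp
    then have "(q * x\<^sup>\<dagger>)\<^sup>\<dagger> = x" by simp
    then show ?thesis using q(1) by (simp add: projD algebra_simps)
  qed
  moreover have "(1 - q) * b = b * (1 - q)" if ab: "a * b = b * a" "a * b\<^sup>\<dagger> = b\<^sup>\<dagger> * a" for b
  proof -
    have "(a * b)\<^sup>\<dagger> = (b * a)\<^sup>\<dagger>" "(a * b\<^sup>\<dagger>)\<^sup>\<dagger> = (b\<^sup>\<dagger> * a)\<^sup>\<dagger>" using ab by simp_all
    then have "a\<^sup>\<dagger> * b\<^sup>\<dagger> = b\<^sup>\<dagger> * a\<^sup>\<dagger>" "a\<^sup>\<dagger> * b = b * a\<^sup>\<dagger>" by simp_all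
    then have "a\<^sup>\<dagger> \<cdot> b\<^sup>\<dagger> \<cdot> \<xi> = b\<^sup>\<dagger> \<cdot> a\<^sup>\<dagger> \<cdot> \<xi>" "a\<^sup>\<dagger> \<cdot> b \<cdot> \<xi> = b \<cdot> a\<^sup>\<dagger> \<cdot> \<xi>" for \<xi>
      by (metis eapp_mult)+
    then have "q * b = b * q" by (intro comm) simp
    then show ?thesis by (simp add: algebra_simps)
  qed
  ultimately show ?thesis
    using that[of "1 - q"] q(1) qa by (simp add: proj_complement left_diff_distrib)
qed

section \<open>Square roots, inverses and spectral projections\<close>

definition pos :: "'a::{real_inner,banach} endo \<Rightarrow> bool" where
  "pos a \<longleftrightarrow> a\<^sup>\<dagger> = a \<and> (\<forall>x. 0 \<le> inner (a \<cdot> x) x)"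

text \<open>Positivity tested at \<open>x - (1/k) *\<^sub>R c \<cdot> x\<close> bounds the norm of
  \<open>c \<cdot> x\<close>, which turns an upper bound of the quadratic form into a bound of the
  norm.\<close>

lemma norm_pos_le:
  assumes c: "pos c" and k: "0 < k" "\<And>x. inner (c \<cdot> x) x \<le> k * (norm x)\<^sup>2"
  shows "norm c \<le> k"
proof (rule norm_endo_bound)
  fix x
  let ?y = "c \<cdot> x"
  have sa: "inner (c \<cdot> ?y) x = (norm ?y)\<^sup>2"
    using c by (simp add: pos_def inner_dag power2_norm_eq_inner)
  have "0 \<le> inner (c \<cdot> (x - (1/k) *\<^sub>R ?y)) (x - (1/k) *\<^sub>R ?y)"
    using c by (simp add: pos_def)
  also have "\<dots> = inner ?y x - 2 / k * (norm ?y)\<^sup>2 + (1/k)\<^sup>2 * inner (c \<cdot> ?y) ?y"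
    using sa by (simp add: eapp.diff_right eapp.scaleR_right inner_diff_left inner_diff_right
        power2_norm_eq_inner power_divide power2_eq_square[of k] diff_divide_distrib)
  also have "\<dots> \<le> k * (norm x)\<^sup>2 - 2 / k * (norm ?y)\<^sup>2 + (1/k)\<^sup>2 * (k * (norm ?y)\<^sup>2)"
    using k(2)[of x] mult_left_mono[OF k(2)[of ?y], of "(1/k)\<^sup>2"] by simp
  also have "\<dots> = (k\<^sup>2 * (norm x)\<^sup>2 - (norm ?y)\<^sup>2) / k"
    using k(1) by (simp add: field_simps power2_eq_square)
  finally have "0 \<le> k\<^sup>2 * (norm x)\<^sup>2 - (norm ?y)\<^sup>2"
    using k(1) by (simp only: pos_le_divide_eq mult_zero_left)
  then have "(norm ?y)\<^sup>2 \<le> (k * norm x)\<^sup>2"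
    by (simp add: power_mult_distrib)
  then show "norm ?y \<le> k * norm x"
    by (rule power2_le_imp_le) (use k(1) in simp)
qed (use k in simp)

lemma inner_eapp_le: "inner (a \<cdot> x) x \<le> norm a * (norm x)\<^sup>2"
proof -
  have "inner (a \<cdot> x) x \<le> norm (a \<cdot> x) * norm x" by (rule norm_cauchy_schwarz)
  also have "\<dots> \<le> norm a * norm x * norm x" by (intro mult_right_mono norm_eapp) simp
  finally show ?thesis by (simp add: power2_eq_square mult.assoc)
qed

text \<open>With \<open>c = 1 - a\<close>, the iteration \<open>y \<mapsto> (c + y\<^sup>2) / 2\<close> started at \<open>0\<close> converges to \<open>1 - \<surd>a\<close>.
  It is dominated in norm by the same iteration for the scalar \<open>c = 1\<close>, which increases to \<open>1\<close>.\<close>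

lemma pos_sqrt_contraction:
  fixes a :: "'a::{real_inner,banach} endo"
  assumes a: "pos a" "\<And>x. inner (a \<cdot> x) x \<le> (norm x)\<^sup>2"
  obtains s where "pos s" "s * s = a" "\<And>b. a * b = b * a \<Longrightarrow> s * b = b * s"
proof -
  define c where "c = 1 - a"
  have c: "pos c"
    using a by (simp add: pos_def c_def inner_diff_left power2_norm_eq_inner)
  have nc: "norm c \<le> 1"
    using norm_pos_le[OF c, of 1] a by (simp add: pos_def c_def inner_diff_left power2_norm_eq_inner)
  define y where "y n = ((\<lambda>y. (1/2) *\<^sub>R (c + y * y)) ^^ n) 0" for n
  define s where "s n = ((\<lambda>s::real. (1/2) * (1 + s * s)) ^^ n) 0" for n
  have y0: "y 0 = 0" and ySuc: "\<And>n. y (Suc n) = (1/2) *\<^sub>R (c + y n * y n)"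
    by (simp_all add: y_def)
  have s0: "s 0 = 0" and sSuc: "\<And>n. s (Suc n) = (1/2) * (1 + s n * s n)"
    by (simp_all add: s_def)
  have s01: "0 \<le> s n \<and> s n \<le> 1" for n
  proof (induction n)
    case (Suc n)
    then have "s n * s n \<le> 1" by (simp add: mult_le_one)
    with Suc show ?case by (simp add: sSuc)
  qed (simp add: s0)
  have ys: "norm (y n) \<le> s n" for n
  proof (induction n)
    case (Suc n)
    have "norm (y n * y n) \<le> s n * s n"
      using Suc by (intro order_trans[OF norm_mult_ineq] mult_mono) (auto simp: s01)
    then have "norm (c + y n * y n) \<le> 1 + s n * s n"
      using nc by (intro order_trans[OF norm_triangle_ineq]) simp
    then show ?case by (simp add: ySuc sSuc)
  qed (simp add: y0 s0)
  have step: "norm (y (Suc n) - y n) \<le> s (Suc n) - s n" for n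
  proof (induction n)
    case (Suc n)
    let ?d = "y (Suc n) - y n" and ?e = "s (Suc n) - s n"
    \<comment> \<open>The difference of squares is split as \<open>y' * d + d * y\<close>, an
      identity that holds without commutativity.\<close>
    have "y (Suc (Suc n)) - y (Suc n) = (1/2) *\<^sub>R (y (Suc n) * ?d + ?d * y n)"
      by (simp only: ySuc[of "Suc n"] ySuc[of n] scaleR_diff_right[symmetric])
        (simp add: ySuc[symmetric] algebra_simps)
    moreover have "norm (y (Suc n) * ?d) \<le> s (Suc n) * ?e" "norm (?d * y n) \<le> ?e * s n"
      using Suc ys s01 by (auto intro!: order_trans[OF norm_mult_ineq] mult_mono
          intro: order_trans[OF norm_ge_zero])
    then have "norm (y (Suc n) * ?d + ?d * y n) \<le> s (Suc n) * ?e + ?e * s n"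
      by (intro order_trans[OF norm_triangle_ineq]) simp
    moreover have "s (Suc (Suc n)) - s (Suc n) = (1/2) * (s (Suc n) * ?e + ?e * s n)"
      by (simp only: sSuc[of "Suc n"] sSuc[of n]) (simp add: algebra_simps)
    ultimately show ?case by simp
  qed (simp add: y0 ySuc s0 sSuc nc)
  have "incseq s"
    by (rule incseq_SucI) (use step norm_ge_zero order_trans in \<open>metis diff_ge_0_iff_ge\<close>)
  then have "convergent s" using s01 by (intro Bseq_monoseq_convergent incseq_imp_monoseq)
      (auto intro!: BseqI'[of _ 1] simp: abs_le_iff intro: order_trans[of _ 0])
  then have "Cauchy s" by (rule convergent_Cauchy)
  have gap: "norm (y (m + k) - y m) \<le> s (m + k) - s m" for m k
  proof (induction k)
    case (Suc k)
    have "norm (y (m + Suc k) - y m) \<le> norm (y (Suc (m + k)) - y (m + k)) + norm (y (m + k) - y m)"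
      using norm_triangle_ineq[of "y (Suc (m + k)) - y (m + k)" "y (m + k) - y m"] by simp
    then show ?case using Suc step[of "m + k"] by simp
  qed simp
  have "Cauchy y"
  proof (rule CauchyI)
    fix e :: real assume "0 < e"
    then obtain N where N: "\<And>m n. m \<ge> N \<Longrightarrow> n \<ge> N \<Longrightarrow> norm (s m - s n) < e"
      using \<open>Cauchy s\<close> CauchyD by blast
    have "norm (y m - y n) < e" if "N \<le> n" "n \<le> m" for m n
      using gap[of n "m - n"] N[of m n] that by simp
    then show "\<exists>N. \<forall>m\<ge>N. \<forall>n\<ge>N. norm (y m - y n) < e"
      by (metis nat_le_linear norm_minus_commute)
  qed
  then obtain L where L: "y \<longlonglongrightarrow> L" using Cauchy_convergent convergent_def by blast
  have "(\<lambda>n. y (Suc n)) \<longlonglongrightarrow> (1/2) *\<^sub>R (c + L * L)"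
    unfolding ySuc by (intro tendsto_intros L)
  then have "L = (1/2) *\<^sub>R (c + L * L)" using LIMSEQ_unique LIMSEQ_Suc[OF L] by blast
  then have "2 *\<^sub>R L = 2 *\<^sub>R (1/2) *\<^sub>R (c + L * L)" by (rule arg_cong)
  \<comment> \<open>The fixed point equation says \<open>(1 - L) * (1 - L) = 1 - c\<close>, so
    \<open>1 - L\<close> is the square root sought.\<close>
  then have LL: "L * L = L + L - c" by (simp add: scaleR_2 algebra_simps)
  have nL: "norm L \<le> 1"
    using ys s01 order_trans by (intro LIMSEQ_le_const2[OF tendsto_norm[OF L]]) blast
  have ydag: "(y n)\<^sup>\<dagger> = y n" for n
    using c by (induction n) (simp_all add: y0 ySuc pos_def)
  have "(\<lambda>n. (y n)\<^sup>\<dagger>) \<longlonglongrightarrow> L\<^sup>\<dagger>" by (rule bounded_linear.tendsto[OF bounded_linear_dag L])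
  then have Ld: "L\<^sup>\<dagger> = L" using L LIMSEQ_unique ydag by simp
  have comm: "L * b = b * L" if "a * b = b * a" for b
  proof -
    have cb: "c * b = b * c" using that by (simp add: c_def algebra_simps)
    have yb: "y n * b = b * y n" for n
    proof (induction n)
      case (Suc n)
      then have "y n * y n * b = b * (y n * y n)" by (metis mult.assoc)
      then show ?case by (simp add: ySuc distrib_left distrib_right cb)
    qed (simp add: y0)
    have "(\<lambda>n. y n * b) \<longlonglongrightarrow> L * b" "(\<lambda>n. b * y n) \<longlonglongrightarrow> b * L"
      by (intro tendsto_intros L)+
    then show ?thesis using LIMSEQ_unique yb by simp
  qed
  have "inner (L \<cdot> x) x \<le> inner x x" for x
    using inner_eapp_le[of L x] mult_right_mono[OF nL, of "(norm x)\<^sup>2"]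
    by (simp add: power2_norm_eq_inner)
  then have "pos (1 - L)" using Ld by (simp add: pos_def inner_diff_left)
  moreover have "(1 - L) * (1 - L) = a" by (simp add: algebra_simps LL c_def)
  moreover have "(1 - L) * b = b * (1 - L)" if "a * b = b * a" for b
    using comm[OF that] by (simp add: algebra_simps)
  ultimately show ?thesis by (rule that)
qed

lemma pos_sqrt:
  fixes a :: "'a::{real_inner,banach} endo"
  assumes a: "pos a"
  obtains s where "pos s" "s * s = a" "\<And>b. a * b = b * a \<Longrightarrow> s * b = b * s"
proof (cases "a = 0")
  case True
  then show ?thesis using that[of 0] by (simp add: pos_def)
next
  case False
  define k where "k = norm a"
  have k: "k > 0" using False by (simp add: k_def)
  have "pos ((1/k) *\<^sub>R a)" using a k by (simp add: pos_def)
  moreover have "inner (((1/k) *\<^sub>R a) \<cdot> x) x \<le> (norm x)\<^sup>2" for x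
    using inner_eapp_le[of a x] k by (simp add: k_def field_simps)
  ultimately obtain s where s: "pos s" "s * s = (1/k) *\<^sub>R a"
    "\<And>b. ((1/k) *\<^sub>R a) * b = b * ((1/k) *\<^sub>R a) \<Longrightarrow> s * b = b * s"
    by (rule pos_sqrt_contraction) blast
  show ?thesis
  proof (rule that[of "sqrt k *\<^sub>R s"])
    show "pos (sqrt k *\<^sub>R s)" using s(1) k by (simp add: pos_def)
    show "sqrt k *\<^sub>R s * sqrt k *\<^sub>R s = a" using k s(2) by simp
    show "sqrt k *\<^sub>R s * b = b * sqrt k *\<^sub>R s" if "a * b = b * a" for b
      using s(3)[of b] that by simp
  qed
qed

text \<open>A Neumann series in fixed point form: after scaling, \<open>a\<close> is
  \<open>l\<close> times \<open>1 - c\<close> with \<open>norm c < 1\<close>, and the inverse is the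
  fixed point of \<open>b \<mapsto> 1 + c * b\<close>, divided by \<open>l\<close>.\<close>

lemma pos_inverse:
  fixes a :: "'a::{real_inner,banach} endo"
  assumes a: "pos a" and d: "0 < \<delta>" "\<And>x. \<delta> * (norm x)\<^sup>2 \<le> inner (a \<cdot> x) x"
  obtains b where "a * b = 1" "b * a = 1"
proof -
  \<comment> \<open>Adding \<open>2 * \<delta>\<close> makes \<open>l\<close> positive and keeps
    \<open>1 - \<delta> / l\<close> strictly between \<open>0\<close> and \<open>1\<close>, as
    \<open>norm_pos_le\<close> and the contraction principle require.\<close>
  define l where "l = norm a + 2 * \<delta>"
  have l: "l > 0" "2 * \<delta> \<le> l" using d by (simp_all add: l_def add_nonneg_pos)
  define c where "c = 1 - (1/l) *\<^sub>R a"
  have "inner (a \<cdot> x) x \<le> l * inner x x" for x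
    using inner_eapp_le[of a x] d(1) by (simp add: l_def power2_norm_eq_inner distrib_right)
      (smt (verit) inner_ge_zero mult_nonneg_nonneg)
  then have "pos c"
    using a l by (simp add: pos_def c_def inner_diff_left field_simps)
  moreover have "inner (c \<cdot> x) x \<le> (1 - \<delta> / l) * (norm x)\<^sup>2" for x
    using d(2)[of x] l by (simp add: c_def inner_diff_left power2_norm_eq_inner field_simps)
  ultimately have nc: "norm c \<le> 1 - \<delta> / l"
    using l d by (intro norm_pos_le) (simp_all add: field_simps)
  have "\<exists>!b. 1 + c * b = b"
  proof (rule banach_fix_type)
    show "0 \<le> 1 - \<delta> / l" "1 - \<delta> / l < 1" using l d by (simp_all add: field_simps)
    show "\<forall>x y. dist (1 + c * x) (1 + c * y) \<le> (1 - \<delta> / l) * dist x y"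
      by (simp add: dist_norm flip: right_diff_distrib)
        (meson mult_right_mono nc norm_ge_zero norm_mult_ineq order_trans)
  qed
  then obtain b where "1 + c * b = b" by blast
  then have ab: "(1/l) *\<^sub>R a * b = 1" by (simp add: c_def algebra_simps)
  then have "((1/l) *\<^sub>R a * b)\<^sup>\<dagger> = 1" by simp
  then have ba: "b\<^sup>\<dagger> * (1/l) *\<^sub>R a = 1" using a by (simp add: pos_def)
  have "b\<^sup>\<dagger> = b\<^sup>\<dagger> * ((1/l) *\<^sub>R a * b)" using ab by simp
  also have "\<dots> = b" by (simp only: mult.assoc[symmetric] ba) simp
  finally have "b\<^sup>\<dagger> = b" .
  then show ?thesis using that[of "(1/l) *\<^sub>R b"] ab ba by simp
qed

text \<open>The spectral projection of \<open>a\<close> for \<open>[0,\<infinity>)\<close>, up to the kernel of \<open>a\<close>: the range projection of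
  \<open>\<bar>a\<bar> + a\<close>.\<close>

lemma spectral_projection:
  fixes a :: "'a::{real_inner,banach} endo"
  assumes a: "a\<^sup>\<dagger> = a"
  obtains p where "proj p" "\<And>b. a * b = b * a \<Longrightarrow> a * b\<^sup>\<dagger> = b\<^sup>\<dagger> * a \<Longrightarrow> p * b = b * p"
    "\<And>x. 0 \<le> inner (a \<cdot> p \<cdot> x) (p \<cdot> x)" "\<And>x. inner (a \<cdot> (x - p \<cdot> x)) (x - p \<cdot> x) \<le> 0"
proof -
  have "inner ((a * a) \<cdot> x) x = (norm (a \<cdot> x))\<^sup>2" for x
    using norm_eapp_sq[of a x] by (simp add: a)
  then have "pos (a * a)" by (simp add: pos_def a del: eapp_mult)
  then obtain s where s: "pos s" "s * s = a * a" "\<And>b. a * a * b = b * (a * a) \<Longrightarrow> s * b = b * s"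
    by (rule pos_sqrt) blast
  have sd: "s\<^sup>\<dagger> = s" using s(1) by (simp add: pos_def)
  have sb: "s * b = b * s" if "a * b = b * a" for b
    by (rule s(3)) (metis that mult.assoc)
  have sa: "s * a = a * s" by (rule sb) simp
  obtain p where p: "proj p" "p * (s + a) = s + a" "\<And>x. x * (s + a) = 0 \<Longrightarrow> x * p = 0"
    "\<And>b. (s + a) * b = b * (s + a) \<Longrightarrow> (s + a) * b\<^sup>\<dagger> = b\<^sup>\<dagger> * (s + a) \<Longrightarrow> p * b = b * p"
    by (rule range_projection) blast
  \<comment> \<open>\<open>s\<close> is the absolute value of \<open>a\<close>. On the range of
    \<open>s + a\<close> it coincides with \<open>a\<close>, and on the complement with
    \<open>- a\<close>; both sign statements are then positivity of \<open>s\<close>.\<close>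
  have "(s - a) * (s + a) = 0" by (simp add: algebra_simps s sa)
  then have "(s - a) * p = 0" by (rule p(3))
  then have 1: "s * p = a * p" by (simp add: algebra_simps)
  have "(p * (s + a))\<^sup>\<dagger> = (s + a)\<^sup>\<dagger>" by (simp only: p(2))
  then have 2: "s * p + a * p = s + a" by (simp add: sd a projD[OF p(1)] distrib_right)
  show ?thesis
  proof (rule that[OF p(1)])
    show "p * b = b * p" if "a * b = b * a" "a * b\<^sup>\<dagger> = b\<^sup>\<dagger> * a" for b
      by (rule p(4)) (simp_all add: distrib_left distrib_right that sb)
    fix x
    have "a \<cdot> p \<cdot> x = s \<cdot> p \<cdot> x" by (metis 1 eapp_mult)
    then show "0 \<le> inner (a \<cdot> p \<cdot> x) (p \<cdot> x)" using s(1) by (simp add: pos_def)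
    have "(a * (1 - p)) \<cdot> x = (- (s * (1 - p))) \<cdot> x"
      using 2 by (intro arg_cong[of _ _ "\<lambda>b. b \<cdot> x"])
        (simp add: right_diff_distrib, metis add.commute add_diff_cancel_left' diff_diff_eq2 minus_diff_eq)
    then have "a \<cdot> (x - p \<cdot> x) = - (s \<cdot> (x - p \<cdot> x))" by simp
    then show "inner (a \<cdot> (x - p \<cdot> x)) (x - p \<cdot> x) \<le> 0" using s(1) by (simp add: pos_def)
  qed
qed

text \<open>Here \<open>g\<close> is the spectral projection of \<open>x\<^sup>\<dagger> * x\<close> for \<open>[\<delta>,\<infinity>)\<close> and \<open>k = g (x\<^sup>\<dagger> * x)\<^sup>-\<^sup>1\<^sup>/\<^sup>2\<close>, so that \<open>x * k\<close>
  is a partial isometry.\<close>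

lemma spectral_cut:
  fixes x :: "'a::{real_inner,banach} endo"
  assumes d: "0 < \<delta>"
  obtains g k where "proj g" "k * g = k" "k\<^sup>\<dagger> = k" "k * k * (x\<^sup>\<dagger> * x) = g" "k * (x\<^sup>\<dagger> * x) * k = g"
    "\<And>b. x\<^sup>\<dagger> * x * b = b * (x\<^sup>\<dagger> * x) \<Longrightarrow> x\<^sup>\<dagger> * x * b\<^sup>\<dagger> = b\<^sup>\<dagger> * (x\<^sup>\<dagger> * x) \<Longrightarrow> g * b = b * g \<and> k * b = b * k"
    "\<And>\<xi>. \<delta> * (norm (g \<cdot> \<xi>))\<^sup>2 \<le> (norm (x \<cdot> g \<cdot> \<xi>))\<^sup>2"
    "\<And>\<xi>. (norm (x \<cdot> (\<xi> - g \<cdot> \<xi>)))\<^sup>2 \<le> \<delta> * (norm (\<xi> - g \<cdot> \<xi>))\<^sup>2"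
proof -
  define a where "a = x\<^sup>\<dagger> * x"
  have a: "a\<^sup>\<dagger> = a" by (simp add: a_def)
  have ax: "inner (a \<cdot> \<xi>) \<xi> = (norm (x \<cdot> \<xi>))\<^sup>2" for \<xi> by (simp add: a_def norm_eapp_sq)
  obtain g where g: "proj g"
    and gc: "\<And>b. (a - \<delta> *\<^sub>R 1) * b = b * (a - \<delta> *\<^sub>R 1) \<Longrightarrow> (a - \<delta> *\<^sub>R 1) * b\<^sup>\<dagger> = b\<^sup>\<dagger> * (a - \<delta> *\<^sub>R 1)
      \<Longrightarrow> g * b = b * g"
    and g1: "\<And>\<xi>. 0 \<le> inner ((a - \<delta> *\<^sub>R 1) \<cdot> g \<cdot> \<xi>) (g \<cdot> \<xi>)"
    and g2: "\<And>\<xi>. inner ((a - \<delta> *\<^sub>R 1) \<cdot> (\<xi> - g \<cdot> \<xi>)) (\<xi> - g \<cdot> \<xi>) \<le> 0"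
    by (rule spectral_projection[of "a - \<delta> *\<^sub>R 1"]) (auto simp: a)
  have gc: "g * b = b * g" if "a * b = b * a" "a * b\<^sup>\<dagger> = b\<^sup>\<dagger> * a" for b
    by (rule gc) (simp_all add: algebra_simps that)
  have g1: "\<delta> * (norm (g \<cdot> \<xi>))\<^sup>2 \<le> (norm (x \<cdot> g \<cdot> \<xi>))\<^sup>2" for \<xi>
    using g1[of \<xi>] by (simp add: inner_diff_left ax power2_norm_eq_inner)
  have g2: "(norm (x \<cdot> (\<xi> - g \<cdot> \<xi>)))\<^sup>2 \<le> \<delta> * (norm (\<xi> - g \<cdot> \<xi>))\<^sup>2" for \<xi>
    using g2[of \<xi>] by (simp only: eapp.diff_left eapp.scaleR_left eapp_one inner_diff_left ax)
      (simp add: power2_norm_eq_inner)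
  have ga: "g * a = a * g" by (rule gc) (simp_all add: a)
  note gg = projD[OF g]
  \<comment> \<open>Replacing \<open>a\<close> by \<open>\<delta>\<close> off \<open>g\<close> makes
    it invertible without changing it on \<open>g\<close>. The root \<open>t\<close> of the inverse
    is then \<open>a\<close> to the power \<open>-1/2\<close> on \<open>g\<close>, and
    \<open>k = g * t\<close>.\<close>
  define e where "e = a * g + \<delta> *\<^sub>R (1 - g)"
  have ed: "e\<^sup>\<dagger> = e" by (simp add: e_def a gg ga)
  have e\<xi>: "\<delta> * (norm \<xi>)\<^sup>2 \<le> inner (e \<cdot> \<xi>) \<xi>" for \<xi>
  proof -
    have "a * g = g * a * g" using ga gg by (metis mult.assoc)
    then have "inner ((a * g) \<cdot> \<xi>) \<xi> = inner (a \<cdot> g \<cdot> \<xi>) (g \<cdot> \<xi>)"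
      using gg(1) by (metis eapp_mult inner_dag)
    moreover have "inner ((1 - g) \<cdot> \<xi>) \<xi> = (norm (\<xi> - g \<cdot> \<xi>))\<^sup>2"
      using inner_proj[OF proj_complement[OF g], of \<xi>] by simp
    ultimately show ?thesis
      using g1[of \<xi>] proj_pythagoras[OF g, of \<xi>]
      by (simp only: e_def eapp.add_left eapp.scaleR_left inner_add_left inner_scaleR_left ax)
        (simp add: distrib_left)
  qed
  have "pos e" unfolding pos_def
    using ed e\<xi> d order_trans[OF mult_nonneg_nonneg[of \<delta>]] by (metis less_imp_le zero_le_power2)
  then obtain i where i: "e * i = 1" "i * e = 1"
    using d e\<xi> by (rule pos_inverse) blast
  have "(e * i)\<^sup>\<dagger> = 1" by (simp add: i(1))
  then have "i\<^sup>\<dagger> * e = 1" by (simp add: ed)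
  then have id: "i\<^sup>\<dagger> = i" by (metis i(1) mult.assoc mult_1_left mult_1_right)
  have "0 \<le> inner (i \<cdot> \<xi>) \<xi>" for \<xi>
  proof -
    have "\<xi> = e \<cdot> i \<cdot> \<xi>" by (metis eapp_mult eapp_one i(1))
    then have "inner (i \<cdot> \<xi>) \<xi> = inner (e \<cdot> i \<cdot> \<xi>) (i \<cdot> \<xi>)" by (metis inner_commute)
    then show ?thesis using \<open>pos e\<close> by (simp add: pos_def)
  qed
  with id have "pos i" by (simp add: pos_def)
  then obtain t where t: "pos t" "t * t = i" "\<And>b. i * b = b * i \<Longrightarrow> t * b = b * t"
    by (rule pos_sqrt) blast
  have td: "t\<^sup>\<dagger> = t" using t(1) by (simp add: pos_def)
  have tb: "t * b = b * t" if "e * b = b * e" for b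
  proof (rule t(3))
    have "i * (e * b) * i = i * (b * e) * i" by (simp only: that)
    then have "i * e * b * i = i * b * (e * i)" by (simp only: mult.assoc)
    then show "i * b = b * i" by (simp add: i)
  qed
  have eg: "e * g = g * e" "e * g = a * g"
  proof -
    show "e * g = a * g" by (simp add: e_def distrib_right left_diff_distrib mult.assoc gg)
    moreover have "g * e = g * a * g + \<delta> *\<^sub>R (g - g * g)"
      by (simp add: e_def distrib_left right_diff_distrib mult.assoc)
    ultimately show "e * g = g * e" by (simp add: ga mult.assoc gg)
  qed
  have tg: "t * g = g * t" by (rule tb) (rule eg(1))
  have ae: "e * a = a * e" by (simp add: e_def distrib_left distrib_right left_diff_distrib
        right_diff_distrib ga mult.assoc)
  have ta: "t * a = a * t" by (rule tb) (rule ae)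
  define k where "k = g * t"
  have kk: "k * k * a = g"
  proof -
    have "k * k * a = g * (t * t) * (g * a)"
      by (simp add: k_def tg mult.assoc) (simp add: mult.assoc[symmetric] gg tg)
    also have "\<dots> = g * (i * e) * g" by (simp add: t(2) ga eg(2)[symmetric] mult.assoc)
    finally show ?thesis by (simp add: i gg)
  qed
  have ka: "k * a = a * k" by (simp add: k_def mult.assoc ta) (simp add: mult.assoc[symmetric] ga)
  show ?thesis
  proof (rule that[OF g])
    show "k * g = k" by (simp add: k_def mult.assoc tg) (simp add: mult.assoc[symmetric] gg)
    show "k\<^sup>\<dagger> = k" by (simp add: k_def td gg tg)
    show "k * k * (x\<^sup>\<dagger> * x) = g" using kk by (simp add: a_def)
    show "k * (x\<^sup>\<dagger> * x) * k = g" using kk by (simp only: a_def[symmetric] mult.assoc ka[symmetric])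
    show "g * b = b * g \<and> k * b = b * k"
      if b: "x\<^sup>\<dagger> * x * b = b * (x\<^sup>\<dagger> * x)" "x\<^sup>\<dagger> * x * b\<^sup>\<dagger> = b\<^sup>\<dagger> * (x\<^sup>\<dagger> * x)" for b
    proof
      show gb: "g * b = b * g" using b by (intro gc) (simp_all add: a_def)
      have "a * (g * b) = b * (a * g)"
        by (metis gb a_def b(1) mult.assoc)
      then have "t * b = b * t"
        by (intro tb) (simp add: e_def distrib_left distrib_right left_diff_distrib
            right_diff_distrib gb mult.assoc)
      then show "k * b = b * k" by (simp add: k_def mult.assoc) (simp add: mult.assoc[symmetric] gb)
    qed
  qed (rule g1, rule g2)
qed

section \<open>Partial isometries and their orthogonal sums\<close>

lemma absorb_right:
  fixes v :: "'a::semigroup_mult"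
  assumes "v * q = v" "q * p = q"
  shows "v * p = v"
proof -
  have "v * p = v * (q * p)" by (simp only: assms(1) mult.assoc[symmetric])
  then show ?thesis by (simp only: assms)
qed

lemma absorb_left:
  fixes v :: "'a::semigroup_mult"
  assumes "q * v = v" "p * q = q"
  shows "p * v = v"
proof -
  have "p * v = p * q * v" by (simp only: assms(1) mult.assoc)
  then show ?thesis by (simp only: assms)
qed

definition pisom :: "'a::{real_inner,banach} endo \<Rightarrow> bool" where
  "pisom v \<longleftrightarrow> v * v\<^sup>\<dagger> * v = v"

lemma pisomD: "pisom v \<Longrightarrow> v * v\<^sup>\<dagger> * v = v" "pisom v \<Longrightarrow> v * (v\<^sup>\<dagger> * v) = v"
  by (simp_all add: pisom_def mult.assoc)

lemma pisom_dag:
  assumes "pisom v"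
  shows "pisom (v\<^sup>\<dagger>)"
proof -
  have "(v * v\<^sup>\<dagger> * v)\<^sup>\<dagger> = v\<^sup>\<dagger>" using assms by (simp only: pisom_def)
  then show ?thesis by (simp add: pisom_def mult.assoc)
qed

lemma pisom_dagD: "pisom v \<Longrightarrow> v\<^sup>\<dagger> * v * v\<^sup>\<dagger> = v\<^sup>\<dagger>" "pisom v \<Longrightarrow> v\<^sup>\<dagger> * (v * v\<^sup>\<dagger>) = v\<^sup>\<dagger>"
  using pisomD[OF pisom_dag, of v] by simp_all

lemma pisom_initial: "pisom v \<Longrightarrow> proj (v\<^sup>\<dagger> * v)"
  using pisomD[of v] by (simp add: proj_def mult.assoc)

lemma pisom_final: "pisom v \<Longrightarrow> proj (v * v\<^sup>\<dagger>)"
  using pisom_initial[OF pisom_dag, of v] by simp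

lemma proj_pisom: "proj p \<Longrightarrow> pisom p"
  by (simp add: pisom_def proj_def)

lemma pisomI:
  assumes "proj (v\<^sup>\<dagger> * v)"
  shows "pisom v"
proof -
  let ?w = "v - v * (v\<^sup>\<dagger> * v)"
  have "?w\<^sup>\<dagger> * ?w = 0"
    using projD(2)[OF assms] by (simp add: algebra_simps)
  then have "?w = 0" by (rule dag_mult_self_eq_zero)
  then show ?thesis by (simp add: pisom_def mult.assoc)
qed

lemma norm_pisom_app: "pisom v \<Longrightarrow> norm (v \<cdot> \<xi>) = norm ((v\<^sup>\<dagger> * v) \<cdot> \<xi>)"
  using norm_eapp_sq[of v \<xi>] inner_proj[OF pisom_initial, of v \<xi>]
  by (metis norm_ge_zero power2_eq_iff_nonneg)

lemma norm_pisom_app_le: "pisom v \<Longrightarrow> norm (v \<cdot> \<xi>) \<le> norm \<xi>"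
  by (metis norm_pisom_app norm_proj_app pisom_initial)

lemma norm_pisom_le: "pisom v \<Longrightarrow> norm v \<le> 1"
  by (rule norm_endo_bound) (simp_all add: norm_pisom_app_le)

section \<open>Orthogonal series and orthogonal families of partial isometries\<close>

lemma orthogonal_sum_norm_sq:
  fixes f :: "'i \<Rightarrow> 'a::real_inner"
  assumes "finite F" "\<And>i j. i \<in> F \<Longrightarrow> j \<in> F \<Longrightarrow> i \<noteq> j \<Longrightarrow> inner (f i) (f j) = 0"
  shows "(norm (sum f F))\<^sup>2 = (\<Sum>i\<in>F. (norm (f i))\<^sup>2)"
  using assms
proof (induction F)
  case (insert i F)
  have "inner (f i) (sum f F) = 0"
    using insert by (auto simp: inner_sum_right intro!: sum.neutral)
  then show ?case
    using insert by (simp add: power2_norm_eq_inner inner_add_left inner_add_right inner_commute)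
qed simp

text \<open>By Pythagoras a block of vectors away from a large finite set \<open>G\<close> is as
  small as the corresponding block of the summable squared norms; this is the Cauchy criterion for
  unconditional sums over any index set.\<close>

lemma orthogonal_summable:
  fixes f :: "'i \<Rightarrow> 'a::{real_inner,banach}"
  assumes orth: "\<And>i j. i \<in> A \<Longrightarrow> j \<in> A \<Longrightarrow> i \<noteq> j \<Longrightarrow> inner (f i) (f j) = 0"
    and bound: "\<And>F. finite F \<Longrightarrow> F \<subseteq> A \<Longrightarrow> (\<Sum>i\<in>F. (norm (f i))\<^sup>2) \<le> B"
  shows "f summable_on A"
proof -
  have "(\<lambda>i. (norm (f i))\<^sup>2) summable_on A"
    using bound by (intro nonneg_bdd_above_summable_on bdd_aboveI[of _ B]) auto
  then obtain S where S: "((\<lambda>i. (norm (f i))\<^sup>2) has_sum S) A" by (auto simp: summable_on_def)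
  have "\<exists>P. eventually P (finite_subsets_at_top A) \<and>
              (\<forall>F F'. P F \<and> P F' \<longrightarrow> dist (sum f F) (sum f F') < e)" if e: "e > 0" for e
  proof -
    \<comment> \<open>Two finite supersets of \<open>G\<close> differ by two blocks of norm at most
      \<open>e/3\<close> each, which stays below \<open>e\<close>.\<close>
    obtain G where G: "finite G" "G \<subseteq> A" "dist (\<Sum>i\<in>G. (norm (f i))\<^sup>2) S \<le> (e/3)\<^sup>2"
      using has_sum_finite_approximation[OF S, of "(e/3)\<^sup>2"] e by auto
    have small: "norm (sum f F) \<le> e/3" if F: "finite F" "F \<subseteq> A" "F \<inter> G = {}" for F
    proof -
      have "(norm (sum f F))\<^sup>2 = (\<Sum>i\<in>F. (norm (f i))\<^sup>2)"
        using F by (intro orthogonal_sum_norm_sq orth) auto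
      moreover have "(\<Sum>i\<in>F \<union> G. (norm (f i))\<^sup>2) \<le> S"
        using F G by (intro finite_sum_le_has_sum[OF S]) auto
      then have "(\<Sum>i\<in>F. (norm (f i))\<^sup>2) + (\<Sum>i\<in>G. (norm (f i))\<^sup>2) \<le> S"
        using F G by (simp add: sum.union_disjoint)
      ultimately have "(norm (sum f F))\<^sup>2 \<le> (e/3)\<^sup>2"
        using G(3) by (simp add: dist_real_def abs_le_iff)
      then show ?thesis by (rule power2_le_imp_le) (use e in simp)
    qed
    define P where "P F \<longleftrightarrow> finite F \<and> G \<subseteq> F \<and> F \<subseteq> A" for F
    have "eventually P (finite_subsets_at_top A)"
      using G unfolding P_def eventually_finite_subsets_at_top by blast
    moreover have "dist (sum f F) (sum f F') < e" if "P F" "P F'" for F F'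
    proof -
      have "sum f F - sum f F' = sum f (F - F') - sum f (F' - F)"
        using that sum.Int_Diff[of F f F'] sum.Int_Diff[of F' f F]
        by (simp add: P_def Int_commute)
      then have "dist (sum f F) (sum f F') \<le> norm (sum f (F - F')) + norm (sum f (F' - F))"
        by (simp add: dist_norm norm_triangle_ineq4)
      also have "\<dots> \<le> e/3 + e/3"
        using that unfolding P_def by (intro add_mono small) auto
      finally show ?thesis using e by simp
    qed
    ultimately show ?thesis by blast
  qed
  then have "cauchy_filter (filtermap (sum f) (finite_subsets_at_top A))"
    by (simp add: cauchy_filter_metric_filtermap)
  moreover have "complete (UNIV::'a set)"
    by (meson Cauchy_convergent UNIV_I complete_def convergent_def)
  ultimately obtain L where "(sum f \<longlongrightarrow> L) (finite_subsets_at_top A)"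
    using complete_uniform[where S = UNIV] by (force simp add: filterlim_def)
  then show ?thesis using summable_on_def has_sum_def by blast
qed

text \<open>Initial and final projections are both pairwise orthogonal, so the sum is a partial
  isometry again. Families are sets of operators, not indexed, which lets Zorn's lemma act on
  inclusion.\<close>

definition orth_family :: "'a::{real_inner,banach} endo set \<Rightarrow> bool" where
  "orth_family V \<longleftrightarrow> (\<forall>v\<in>V. pisom v) \<and> (\<forall>v\<in>V. \<forall>w\<in>V. v \<noteq> w \<longrightarrow> v\<^sup>\<dagger> * w = 0 \<and> v * w\<^sup>\<dagger> = 0)"

text \<open>The sums converge strongly. The adjoint sums are recorded as well, because taking
  adjoints is not strongly continuous; this keeps the notion symmetric under
  \<open>dag\<close>.\<close>

definition sum_of_family :: "'a::{real_inner,banach} endo set \<Rightarrow> 'a endo \<Rightarrow> bool" where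
  "sum_of_family V s \<longleftrightarrow> (\<forall>\<xi>. ((\<lambda>v. v \<cdot> \<xi>) has_sum s \<cdot> \<xi>) V) \<and>
     (\<forall>\<xi>. ((\<lambda>v. v\<^sup>\<dagger> \<cdot> \<xi>) has_sum s\<^sup>\<dagger> \<cdot> \<xi>) V)"

lemma orth_familyD:
  assumes "orth_family V"
  shows "v \<in> V \<Longrightarrow> pisom v" "v \<in> V \<Longrightarrow> w \<in> V \<Longrightarrow> v \<noteq> w \<Longrightarrow> v\<^sup>\<dagger> * w = 0"
    "v \<in> V \<Longrightarrow> w \<in> V \<Longrightarrow> v \<noteq> w \<Longrightarrow> v * w\<^sup>\<dagger> = 0"
  using assms by (auto simp: orth_family_def)

lemma orth_family_dag: "orth_family V \<Longrightarrow> orth_family (dag ` V)"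
  unfolding orth_family_def by (auto simp: pisom_dag)

lemma orthogonal_projections_bessel:
  assumes I: "finite I" and q: "\<And>i. i \<in> I \<Longrightarrow> proj (q i)"
    and orth: "\<And>i j. i \<in> I \<Longrightarrow> j \<in> I \<Longrightarrow> i \<noteq> j \<Longrightarrow> q i * q j = 0"
  shows "(\<Sum>i\<in>I. (norm (q i \<cdot> \<xi>))\<^sup>2) \<le> (norm \<xi>)\<^sup>2"
proof -
  define p where "p = (\<Sum>i\<in>I. q i)"
  have "(\<Sum>j\<in>I. q i * q j) = q i" if i: "i \<in> I" for i
  proof -
    have "(\<Sum>j\<in>I. q i * q j) = (\<Sum>j\<in>I. if i = j then q i else 0)"
      by (rule sum.cong[OF refl]) (use orth[OF i] projD(2)[OF q[OF i]] in auto)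
    then show ?thesis using i I by simp
  qed
  then have "p * p = p" by (simp add: p_def sum_product)
  moreover have "p\<^sup>\<dagger> = p" using projD(1)[OF q] by (simp add: p_def dag_sum)
  ultimately have p: "proj p" by (simp add: proj_def)
  have "(\<Sum>i\<in>I. (norm (q i \<cdot> \<xi>))\<^sup>2) = inner (p \<cdot> \<xi>) \<xi>"
    using inner_proj[OF q] by (simp add: p_def eapp.sum_left inner_sum_left)
  also have "\<dots> = (norm (p \<cdot> \<xi>))\<^sup>2" by (rule inner_proj[OF p])
  also have "\<dots> \<le> (norm \<xi>)\<^sup>2" by (intro power_mono norm_proj_app p) simp
  finally show ?thesis .
qed

lemma orth_family_bessel:
  assumes V: "orth_family V" "finite V"
  shows "(\<Sum>v\<in>V. (norm (v \<cdot> \<xi>))\<^sup>2) \<le> (norm \<xi>)\<^sup>2"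
proof -
  have "(v\<^sup>\<dagger> * v) * (w\<^sup>\<dagger> * w) = 0" if "v \<in> V" "w \<in> V" "v \<noteq> w" for v w
  proof -
    have "(v\<^sup>\<dagger> * v) * (w\<^sup>\<dagger> * w) = v\<^sup>\<dagger> * (v * w\<^sup>\<dagger>) * w" by (simp only: mult.assoc)
    then show ?thesis by (simp add: orth_familyD(3)[OF V(1) that])
  qed
  then have "(\<Sum>v\<in>V. (norm ((v\<^sup>\<dagger> * v) \<cdot> \<xi>))\<^sup>2) \<le> (norm \<xi>)\<^sup>2"
    using V by (intro orthogonal_projections_bessel) (simp_all add: orth_familyD(1) pisom_initial)
  then show ?thesis using V(1) by (simp add: norm_pisom_app orth_familyD(1))
qed

lemma orth_family_app_orthogonal:
  assumes "orth_family V" "v \<in> V" "w \<in> V" "v \<noteq> w"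
  shows "inner (v \<cdot> \<xi>) (w \<cdot> \<eta>) = 0"
proof -
  have "inner (v \<cdot> \<xi>) (w \<cdot> \<eta>) = inner \<xi> ((v\<^sup>\<dagger> * w) \<cdot> \<eta>)" by (simp add: inner_dag)
  then show ?thesis using orth_familyD(2)[OF assms] by simp
qed

lemma orth_family_summable:
  assumes V: "orth_family V"
  shows "(\<lambda>v. v \<cdot> \<xi>) summable_on V"
proof (rule orthogonal_summable)
  show "(\<Sum>v\<in>F. (norm (v \<cdot> \<xi>))\<^sup>2) \<le> (norm \<xi>)\<^sup>2" if "finite F" "F \<subseteq> V" for F
    using that V by (intro orth_family_bessel) (auto simp: orth_family_def)
qed (rule orth_family_app_orthogonal[OF V])

lemma orth_family_endo:
  assumes V: "orth_family V"
  obtains s where "\<And>\<xi>. ((\<lambda>v. v \<cdot> \<xi>) has_sum s \<cdot> \<xi>) V"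
proof -
  define f where "f \<xi> = infsum (\<lambda>v. v \<cdot> \<xi>) V" for \<xi>
  have f: "((\<lambda>v. v \<cdot> \<xi>) has_sum f \<xi>) V" for \<xi>
    unfolding f_def by (rule has_sum_infsum[OF orth_family_summable[OF V]])
  have "bounded_linear f"
  proof (rule bounded_linear_intro[where K = 1])
    show "f (\<xi> + \<eta>) = f \<xi> + f \<eta>" for \<xi> \<eta>
      by (rule has_sum_unique[OF f]) (simp add: eapp.add_right has_sum_add f)
    show "f (r *\<^sub>R \<xi>) = r *\<^sub>R f \<xi>" for r \<xi>
      by (rule has_sum_unique[OF f]) (simp add: eapp.scaleR_right has_sum_scaleR f)
    show "norm (f \<xi>) \<le> norm \<xi> * 1" for \<xi>
    proof -
      have "norm (\<Sum>v\<in>F. v \<cdot> \<xi>) \<le> norm \<xi>" if F: "finite F" "F \<subseteq> V" for F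
      proof (rule power2_le_imp_le)
        have "(norm (\<Sum>v\<in>F. v \<cdot> \<xi>))\<^sup>2 = (\<Sum>v\<in>F. (norm (v \<cdot> \<xi>))\<^sup>2)"
          using F by (intro orthogonal_sum_norm_sq orth_family_app_orthogonal[OF V]) auto
        also have "\<dots> \<le> (norm \<xi>)\<^sup>2"
          using F V by (intro orth_family_bessel) (auto simp: orth_family_def)
        finally show "(norm (\<Sum>v\<in>F. v \<cdot> \<xi>))\<^sup>2 \<le> (norm \<xi>)\<^sup>2" .
      qed simp
      then have "eventually (\<lambda>F. norm (sum (\<lambda>v. v \<cdot> \<xi>) F) \<le> norm \<xi>) (finite_subsets_at_top V)"
        by (rule eventually_finite_subsets_at_top_weakI)
      then show ?thesis
        using tendsto_upperbound[OF tendsto_norm[OF f[of \<xi>, unfolded has_sum_def]]]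
        by simp
    qed
  qed
  then have "endo_of f \<cdot> \<xi> = f \<xi>" for \<xi> by (rule eapp_endo_of)
  then show ?thesis using that[of "endo_of f"] f by simp
qed

lemma orth_family_sum_exists:
  assumes V: "orth_family V"
  obtains s where "sum_of_family V s"
proof -
  obtain s where s: "\<And>\<xi>. ((\<lambda>v. v \<cdot> \<xi>) has_sum s \<cdot> \<xi>) V"
    by (rule orth_family_endo[OF V]) blast
  obtain s' where s': "\<And>\<xi>. ((\<lambda>v. v \<cdot> \<xi>) has_sum s' \<cdot> \<xi>) (dag ` V)"
    by (rule orth_family_endo[OF orth_family_dag[OF V]]) blast
  have "inj_on dag V" by (metis dag_dag inj_onI)
  then have s'': "((\<lambda>v. v\<^sup>\<dagger> \<cdot> \<xi>) has_sum s' \<cdot> \<xi>) V" for \<xi>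
    using s'[of \<xi>] has_sum_reindex[of dag V "\<lambda>v. v \<cdot> \<xi>"] by (simp add: o_def)
  have "s\<^sup>\<dagger> = s'"
  proof (rule dag_unique)
    fix \<xi> \<eta>
    have "((\<lambda>v. inner (v \<cdot> \<xi>) \<eta>) has_sum inner (s \<cdot> \<xi>) \<eta>) V"
      by (rule has_sum_bounded_linear[OF bounded_linear_inner_left s])
    moreover have "((\<lambda>v. inner \<xi> (v\<^sup>\<dagger> \<cdot> \<eta>)) has_sum inner \<xi> (s' \<cdot> \<eta>)) V"
      by (rule has_sum_bounded_linear[OF bounded_linear_inner_right s''])
    ultimately show "inner (s \<cdot> \<xi>) \<eta> = inner \<xi> (s' \<cdot> \<eta>)"
      by (simp add: inner_dag has_sum_unique)
  qed
  then show ?thesis using that[of s] s s'' by (simp add: sum_of_family_def)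
qed

context
  fixes V :: "'a::{real_inner,banach} endo set" and s :: "'a endo"
  assumes V: "orth_family V" and s: "sum_of_family V s"
begin

lemma family_app: "((\<lambda>v. v \<cdot> \<xi>) has_sum s \<cdot> \<xi>) V"
  and family_dag_app: "((\<lambda>v. v\<^sup>\<dagger> \<cdot> \<xi>) has_sum s\<^sup>\<dagger> \<cdot> \<xi>) V"
  using s by (simp_all add: sum_of_family_def)

text \<open>A bounded operator passes through a strong sum, so identities with a factor on the left
  can be checked on the members. \<open>family_sum_eq_right\<close> is the same fact for the adjoint
  family.\<close>

lemma family_sum_eq_left: "(\<And>v. v \<in> V \<Longrightarrow> a * v = b * v) \<Longrightarrow> a * s = b * s"
proof (rule endo_eqI)
  fix \<xi> assume "\<And>v. v \<in> V \<Longrightarrow> a * v = b * v"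
  then have *: "a \<cdot> v \<cdot> \<xi> = b \<cdot> v \<cdot> \<xi>" if "v \<in> V" for v using that by (metis eapp_mult)
  have "((\<lambda>v. a \<cdot> v \<cdot> \<xi>) has_sum a \<cdot> s \<cdot> \<xi>) V" "((\<lambda>v. b \<cdot> v \<cdot> \<xi>) has_sum b \<cdot> s \<cdot> \<xi>) V"
    by (rule has_sum_bounded_linear[OF eapp.bounded_linear_right family_app])+
  then show "(a * s) \<cdot> \<xi> = (b * s) \<cdot> \<xi>"
    using has_sum_cong[of V "\<lambda>v. a \<cdot> v \<cdot> \<xi>" "\<lambda>v. b \<cdot> v \<cdot> \<xi>"] * has_sum_unique by (metis eapp_mult)
qed

lemma family_sum_commute:
  assumes "\<And>v. v \<in> V \<Longrightarrow> v * t = t * v"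
  shows "s * t = t * s"
proof (rule endo_eqI)
  fix \<xi>
  have "((\<lambda>v. v \<cdot> t \<cdot> \<xi>) has_sum s \<cdot> t \<cdot> \<xi>) V" by (rule family_app)
  moreover have "((\<lambda>v. t \<cdot> v \<cdot> \<xi>) has_sum t \<cdot> s \<cdot> \<xi>) V"
    by (rule has_sum_bounded_linear[OF eapp.bounded_linear_right family_app])
  moreover have "v \<cdot> t \<cdot> \<xi> = t \<cdot> v \<cdot> \<xi>" if "v \<in> V" for v using assms[OF that] by (metis eapp_mult)
  ultimately show "(s * t) \<cdot> \<xi> = (t * s) \<cdot> \<xi>"
    using has_sum_cong[of V "\<lambda>v. v \<cdot> t \<cdot> \<xi>" "\<lambda>v. t \<cdot> v \<cdot> \<xi>"] has_sum_unique by (metis eapp_mult)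
qed

lemma family_sum_dag: "sum_of_family (dag ` V) (s\<^sup>\<dagger>)"
proof -
  have inj: "inj_on dag V" by (metis dag_dag inj_onI)
  show ?thesis
    using s has_sum_reindex[OF inj, of "\<lambda>v. v \<cdot> \<xi>" for \<xi>]
      has_sum_reindex[OF inj, of "\<lambda>v. v\<^sup>\<dagger> \<cdot> \<xi>" for \<xi>]
    by (simp add: sum_of_family_def o_def)
qed

lemma family_sum_final: "v \<in> V \<Longrightarrow> s * v\<^sup>\<dagger> = v * v\<^sup>\<dagger>"
proof (rule endo_eqI)
  fix \<xi> assume v: "v \<in> V"
  have "w \<cdot> v\<^sup>\<dagger> \<cdot> \<xi> = 0" if "w \<in> V" "w \<noteq> v" for w
    using orth_familyD(3)[OF V that(1) v that(2)] by (metis eapp_mult eapp.zero_left)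
  then have "((\<lambda>w. w \<cdot> v\<^sup>\<dagger> \<cdot> \<xi>) has_sum v \<cdot> v\<^sup>\<dagger> \<cdot> \<xi>) V"
    using v by (subst has_sum_cong_neutral[where T = "{v}" and g = "\<lambda>w. w \<cdot> v\<^sup>\<dagger> \<cdot> \<xi>"])
      (auto intro: has_sum_finiteI)
  then show "(s * v\<^sup>\<dagger>) \<cdot> \<xi> = (v * v\<^sup>\<dagger>) \<cdot> \<xi>"
    using family_app[of "v\<^sup>\<dagger> \<cdot> \<xi>"] has_sum_unique by auto
qed

end

context
  fixes V :: "'a::{real_inner,banach} endo set" and s :: "'a endo"
  assumes V: "orth_family V" and s: "sum_of_family V s"
begin

lemma family_sum_eq_right:
  assumes "\<And>v. v \<in> V \<Longrightarrow> v * a = v * b"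
  shows "s * a = s * b"
proof -
  have "a\<^sup>\<dagger> * s\<^sup>\<dagger> = b\<^sup>\<dagger> * s\<^sup>\<dagger>"
  proof (rule family_sum_eq_left[OF orth_family_dag[OF V] family_sum_dag[OF V s]])
    fix w assume "w \<in> dag ` V"
    then obtain v where v: "v \<in> V" "w = v\<^sup>\<dagger>" by blast
    have "(v * a)\<^sup>\<dagger> = (v * b)\<^sup>\<dagger>" using assms[OF v(1)] by (simp only:)
    then show "a\<^sup>\<dagger> * w = b\<^sup>\<dagger> * w" by (simp add: v)
  qed
  then have "(a\<^sup>\<dagger> * s\<^sup>\<dagger>)\<^sup>\<dagger> = (b\<^sup>\<dagger> * s\<^sup>\<dagger>)\<^sup>\<dagger>" by (simp only:)
  then show ?thesis by simp
qed

lemma family_sum_initial: "v \<in> V \<Longrightarrow> s\<^sup>\<dagger> * v = v\<^sup>\<dagger> * v"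
  using family_sum_final[OF orth_family_dag[OF V] family_sum_dag[OF V s], of "v\<^sup>\<dagger>"] by simp

lemma family_sum_pisom: "pisom s"
proof -
  have "(s * s\<^sup>\<dagger>) * s = 1 * s"
  proof (rule family_sum_eq_left[OF V s])
    fix v assume v: "v \<in> V"
    have "s * s\<^sup>\<dagger> * v = s * v\<^sup>\<dagger> * v" by (simp add: mult.assoc family_sum_initial[OF v])
    then show "s * s\<^sup>\<dagger> * v = 1 * v"
      using v orth_familyD(1)[OF V v] by (simp add: family_sum_final[OF V s] pisomD)
  qed
  then show ?thesis by (simp add: pisom_def)
qed

lemma family_sum_norm_sq: "((\<lambda>v. (norm (v \<cdot> \<xi>))\<^sup>2) has_sum (norm (s \<cdot> \<xi>))\<^sup>2) V"
proof -
  have "((\<lambda>v. inner (s\<^sup>\<dagger> \<cdot> v \<cdot> \<xi>) \<xi>) has_sum inner (s\<^sup>\<dagger> \<cdot> s \<cdot> \<xi>) \<xi>) V"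
    by (rule has_sum_bounded_linear[OF bounded_linear_compose[OF bounded_linear_inner_left
          eapp.bounded_linear_right] family_app[OF V s]])
  moreover have "s\<^sup>\<dagger> \<cdot> v \<cdot> \<xi> = v\<^sup>\<dagger> \<cdot> v \<cdot> \<xi>" if "v \<in> V" for v
    using family_sum_initial[OF that] by (metis eapp_mult)
  then have "((\<lambda>v. inner (s\<^sup>\<dagger> \<cdot> v \<cdot> \<xi>) \<xi>) has_sum c) V \<longleftrightarrow> ((\<lambda>v. (norm (v \<cdot> \<xi>))\<^sup>2) has_sum c) V" for c
    by (intro has_sum_cong) (simp add: norm_eapp_sq)
  ultimately show ?thesis by (simp add: norm_eapp_sq)
qed

end

lemma family_sum_dag_norm_sq:
  assumes V: "orth_family V" and s: "sum_of_family V s"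
  shows "((\<lambda>v. (norm (v\<^sup>\<dagger> \<cdot> \<xi>))\<^sup>2) has_sum (norm (s\<^sup>\<dagger> \<cdot> \<xi>))\<^sup>2) V"
proof -
  have "inj_on dag V" by (metis dag_dag inj_onI)
  then show ?thesis
    using family_sum_norm_sq[OF orth_family_dag[OF V] family_sum_dag[OF V s], of \<xi>]
      has_sum_reindex[of dag V "\<lambda>v. (norm (v \<cdot> \<xi>))\<^sup>2"] by (simp add: o_def)
qed

lemma orthogonal_ranges_bessel:
  fixes u :: "nat \<Rightarrow> 'a::{real_inner,banach} endo"
  assumes u: "\<And>i. pisom (u i)" "\<And>i j. i \<noteq> j \<Longrightarrow> (u i)\<^sup>\<dagger> * u j = 0"
  shows "(\<Sum>i<N. (norm ((u i)\<^sup>\<dagger> \<cdot> \<zeta>))\<^sup>2) \<le> (norm \<zeta>)\<^sup>2"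
proof -
  have "norm ((u i)\<^sup>\<dagger> \<cdot> \<zeta>) = norm ((u i * (u i)\<^sup>\<dagger>) \<cdot> \<zeta>)" for i
    using norm_pisom_app[OF pisom_dag[OF u(1)]] by (simp only: dag_dag)
  moreover have "(u i * (u i)\<^sup>\<dagger>) * (u j * (u j)\<^sup>\<dagger>) = 0" if "i \<noteq> j" for i j
  proof -
    have "(u i * (u i)\<^sup>\<dagger>) * (u j * (u j)\<^sup>\<dagger>) = u i * ((u i)\<^sup>\<dagger> * u j) * (u j)\<^sup>\<dagger>" by (simp only: mult.assoc)
    then show ?thesis by (simp add: u(2)[OF that])
  qed
  then have "(\<Sum>i<N. (norm ((u i * (u i)\<^sup>\<dagger>) \<cdot> \<zeta>))\<^sup>2) \<le> (norm \<zeta>)\<^sup>2"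
    by (rule orthogonal_projections_bessel[OF finite_lessThan pisom_final[OF u(1)]])
  ultimately show ?thesis by (simp only:)
qed

text \<open>Bessel's inequality makes the squares summable. Hence among infinitely many orthogonal
  copies some are almost orthogonal to finitely many given vectors.\<close>

lemma orthogonal_ranges_tendsto_zero:
  fixes u :: "nat \<Rightarrow> 'a::{real_inner,banach} endo"
  assumes u: "\<And>i. pisom (u i)" "\<And>i j. i \<noteq> j \<Longrightarrow> (u i)\<^sup>\<dagger> * u j = 0"
  shows "(\<lambda>i. norm ((u i)\<^sup>\<dagger> \<cdot> \<zeta>)) \<longlonglongrightarrow> 0"
proof -
  have "summable (\<lambda>i. (norm ((u i)\<^sup>\<dagger> \<cdot> \<zeta>))\<^sup>2)"
    by (rule summableI_nonneg_bounded[where x = "(norm \<zeta>)\<^sup>2"]) (simp_all add: orthogonal_ranges_bessel[OF u])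
  then have "(\<lambda>i. (norm ((u i)\<^sup>\<dagger> \<cdot> \<zeta>))\<^sup>2) \<longlonglongrightarrow> 0" by (rule summable_LIMSEQ_zero)
  then have "(\<lambda>i. sqrt ((norm ((u i)\<^sup>\<dagger> \<cdot> \<zeta>))\<^sup>2)) \<longlonglongrightarrow> sqrt 0" by (rule tendsto_real_sqrt)
  then show ?thesis by simp
qed

lemma family_of_projections_sum:
  assumes V: "orth_family V" "sum_of_family V s" and e: "\<And>e. e \<in> V \<Longrightarrow> proj e"
  shows "proj s"
proof -
  have "((\<lambda>v. v \<cdot> \<xi>) has_sum s\<^sup>\<dagger> \<cdot> \<xi>) V" for \<xi>
    using family_dag_app[OF V, of \<xi>] has_sum_cong[of V "\<lambda>v. v\<^sup>\<dagger> \<cdot> \<xi>" "\<lambda>v. v \<cdot> \<xi>"] projD(1)[OF e] by simp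
  then have "s\<^sup>\<dagger> = s" using family_app[OF V] has_sum_unique by (intro endo_eqI) blast
  moreover have "s * x = 1 * x" if x: "x \<in> V" for x
    using family_sum_final[OF V x] projD[OF e[OF x]] by simp
  then have "s * s = 1 * s" by (rule family_sum_eq_left[OF V])
  ultimately show ?thesis by (simp add: proj_def)
qed

section \<open>Von Neumann algebras as commutants\<close>

text \<open>\<open>M\<close> is the commutant of a self-adjoint set \<open>T\<close> of real-linear operators. For a complex von Neumann
  algebra \<open>T\<close> is the commutant together with the complex scalars, which forces the elements of \<open>M\<close> to
  be complex-linear; the complex structure plays no further role.\<close>

locale commutant_algebra =
  fixes T M :: "'a::{real_inner,banach} endo set"
  assumes dag_T: "t \<in> T \<Longrightarrow> t\<^sup>\<dagger> \<in> T"
    and M_eq: "M = {x. \<forall>t\<in>T. x * t = t * x}"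
begin

lemma M_memI: "(\<And>t. t \<in> T \<Longrightarrow> x * t = t * x) \<Longrightarrow> x \<in> M"
  by (simp add: M_eq)

lemma M_memD: "x \<in> M \<Longrightarrow> t \<in> T \<Longrightarrow> x * t = t * x"
  by (simp add: M_eq)

lemma M_zero [simp, intro]: "0 \<in> M" and M_one [simp, intro]: "1 \<in> M"
  by (simp_all add: M_eq)

lemma M_add [simp, intro]: "x \<in> M \<Longrightarrow> y \<in> M \<Longrightarrow> x + y \<in> M"
  by (simp add: M_eq distrib_left distrib_right)

lemma M_diff [simp, intro]: "x \<in> M \<Longrightarrow> y \<in> M \<Longrightarrow> x - y \<in> M"
  by (simp add: M_eq left_diff_distrib right_diff_distrib)

lemma M_minus [simp, intro]: "x \<in> M \<Longrightarrow> - x \<in> M"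
  by (simp add: M_eq)

lemma M_mult [simp, intro]: "x \<in> M \<Longrightarrow> y \<in> M \<Longrightarrow> x * y \<in> M"
  by (simp add: M_eq) (metis mult.assoc)

lemma M_power [simp, intro]: "x \<in> M \<Longrightarrow> x ^ n \<in> M"
  by (induction n) simp_all

lemma M_dag [simp, intro]:
  assumes "x \<in> M"
  shows "x\<^sup>\<dagger> \<in> M"
proof (rule M_memI)
  fix t assume "t \<in> T"
  then have "(x * t\<^sup>\<dagger>)\<^sup>\<dagger> = (t\<^sup>\<dagger> * x)\<^sup>\<dagger>" by (rule arg_cong[OF M_memD[OF assms dag_T]])
  then show "x\<^sup>\<dagger> * t = t * x\<^sup>\<dagger>" by simp
qed

definition Z :: "'a endo set" where
  "Z = {z \<in> M. \<forall>m\<in>M. z * m = m * z}"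

lemma Z_memI: "z \<in> M \<Longrightarrow> (\<And>m. m \<in> M \<Longrightarrow> z * m = m * z) \<Longrightarrow> z \<in> Z"
  by (simp add: Z_def)

lemma Z_mem: "z \<in> Z \<Longrightarrow> z \<in> M" and Z_commute: "z \<in> Z \<Longrightarrow> m \<in> M \<Longrightarrow> z * m = m * z"
  by (simp_all add: Z_def)

lemma Z_zero [simp, intro]: "0 \<in> Z" and Z_one [simp, intro]: "1 \<in> Z"
  by (simp_all add: Z_def)

lemma Z_add [simp, intro]: "x \<in> Z \<Longrightarrow> y \<in> Z \<Longrightarrow> x + y \<in> Z"
  by (simp add: Z_def distrib_left distrib_right)

lemma Z_diff [simp, intro]: "x \<in> Z \<Longrightarrow> y \<in> Z \<Longrightarrow> x - y \<in> Z"
  by (simp add: Z_def left_diff_distrib right_diff_distrib)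

lemma Z_mult [simp, intro]:
  assumes "x \<in> Z" "y \<in> Z"
  shows "x * y \<in> Z"
proof (rule Z_memI)
  fix m assume m: "m \<in> M"
  have "x * y * m = x * m * y" by (simp only: mult.assoc Z_commute[OF assms(2) m])
  then show "x * y * m = m * (x * y)" by (simp only: Z_commute[OF assms(1) m] mult.assoc)
qed (use assms in \<open>simp add: Z_mem\<close>)

lemma Z_sum [intro]: "(\<And>i. i \<in> A \<Longrightarrow> f i \<in> Z) \<Longrightarrow> sum f A \<in> Z"
  by (induction A rule: infinite_finite_induct) simp_all

lemma Z_dag [simp, intro]:
  assumes "x \<in> Z"
  shows "x\<^sup>\<dagger> \<in> Z"
proof (rule Z_memI)
  fix m assume "m \<in> M"
  then have "(x * m\<^sup>\<dagger>)\<^sup>\<dagger> = (m\<^sup>\<dagger> * x)\<^sup>\<dagger>" by (rule arg_cong[OF Z_commute[OF assms M_dag]])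
  then show "x\<^sup>\<dagger> * m = m * x\<^sup>\<dagger>" by simp
qed (use assms in \<open>simp add: Z_mem\<close>)

section \<open>Spectral cuts, central supports and the linking alternative\<close>

lemma proj_central_mult:
  assumes "proj c" "c \<in> Z" "proj p" "p \<in> M"
  shows "proj (c * p)"
proof -
  have cp: "c * p = p * c" using assms by (intro Z_commute)
  have "c * p * (c * p) = c * (p * c) * p" by (simp only: mult.assoc)
  also have "\<dots> = c * (c * p) * p" by (simp only: cp)
  also have "\<dots> = (c * c) * (p * p)" by (simp only: mult.assoc)
  finally show ?thesis using assms cp by (simp add: proj_def)
qed

text \<open>\<open>T\<close> is closed under adjoints, so the commutation clause of
  \<open>spectral_cut\<close> puts \<open>g\<close> and \<open>k\<close> into the commutant
  \<open>M\<close>. The element \<open>x * k\<close> is the phase of \<open>x\<close> on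
  \<open>g\<close>, and the clause on \<open>x * g\<close> says that its final projection covers the
  range of \<open>x * g\<close>.\<close>

lemma spectral_cut_M:
  assumes x: "x \<in> M" and d: "0 < \<delta>"
  obtains g k where "proj g" "g \<in> M" "k \<in> M" "pisom (x * k)" "(x * k)\<^sup>\<dagger> * (x * k) = g"
    "k * k * (x\<^sup>\<dagger> * x) = g" "x * k * (x * k)\<^sup>\<dagger> * (x * g) = x * g" "g * (x\<^sup>\<dagger> * x) = (x\<^sup>\<dagger> * x) * g"
    "\<And>\<xi>. \<delta> * (norm (g \<cdot> \<xi>))\<^sup>2 \<le> (norm (x \<cdot> g \<cdot> \<xi>))\<^sup>2"
    "\<And>\<xi>. (norm (x \<cdot> (\<xi> - g \<cdot> \<xi>)))\<^sup>2 \<le> \<delta> * (norm (\<xi> - g \<cdot> \<xi>))\<^sup>2"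
    "x \<in> Z \<Longrightarrow> g \<in> Z"
proof -
  obtain g k where g: "proj g" and k: "k * g = k" "k\<^sup>\<dagger> = k" "k * k * (x\<^sup>\<dagger> * x) = g" "k * (x\<^sup>\<dagger> * x) * k = g"
    and comm: "\<And>b. x\<^sup>\<dagger> * x * b = b * (x\<^sup>\<dagger> * x) \<Longrightarrow> x\<^sup>\<dagger> * x * b\<^sup>\<dagger> = b\<^sup>\<dagger> * (x\<^sup>\<dagger> * x) \<Longrightarrow> g * b = b * g \<and> k * b = b * k"
    and est: "\<And>\<xi>. \<delta> * (norm (g \<cdot> \<xi>))\<^sup>2 \<le> (norm (x \<cdot> g \<cdot> \<xi>))\<^sup>2"
    "\<And>\<xi>. (norm (x \<cdot> (\<xi> - g \<cdot> \<xi>)))\<^sup>2 \<le> \<delta> * (norm (\<xi> - g \<cdot> \<xi>))\<^sup>2"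
    by (rule spectral_cut[OF d, of x]) blast
  have xM: "x\<^sup>\<dagger> * x \<in> M" using x by simp
  have "g * t = t * g \<and> k * t = t * k" if "t \<in> T" for t
    by (rule comm) (use that dag_T M_memD[OF xM] in blast)+
  then have gM: "g \<in> M" and kM: "k \<in> M" by (blast intro: M_memI)+
  have gx: "g * (x\<^sup>\<dagger> * x) = (x\<^sup>\<dagger> * x) * g" using comm[of "x\<^sup>\<dagger> * x"] by simp
  have vv: "(x * k)\<^sup>\<dagger> * (x * k) = g" using k by (simp add: mult.assoc)
  have "x * k * (x * k)\<^sup>\<dagger> * (x * g) = x * (k * k * (x\<^sup>\<dagger> * x)) * g" by (simp add: k(2) mult.assoc)
  also have "\<dots> = x * g" by (simp only: k(3) mult.assoc[of x g g] projD(2)[OF g])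
  finally have 1: "x * k * (x * k)\<^sup>\<dagger> * (x * g) = x * g" .
  have "g \<in> Z" if "x \<in> Z"
  proof -
    have "x\<^sup>\<dagger> * x \<in> Z" using that by simp
    then have "g * m = m * g" if "m \<in> M" for m
      using comm[of m] Z_commute[of "x\<^sup>\<dagger> * x"] that by blast
    then show ?thesis by (rule Z_memI[OF gM])
  qed
  moreover have "pisom (x * k)" by (rule pisomI) (simp only: vv g)
  ultimately show ?thesis by (rule that[OF g gM kM _ vv k(3) 1 gx est, rotated])
qed

text \<open>The two factorizations of \<open>v\<close> through \<open>x\<close> let it inherit every
  operator that acts as the identity on the left or on the right of \<open>x\<close>.\<close>

lemma nonzero_pisom:
  assumes x: "x \<in> M" "x \<noteq> 0"
  obtains v k l where "v \<in> M" "k \<in> M" "l \<in> M" "v \<noteq> 0" "pisom v" "v = x * k" "v = l * x"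
proof -
  have n: "norm x > 0" using x by simp
  \<comment> \<open>Were nothing of \<open>x\<^sup>\<dagger> * x\<close> above this level,
    \<open>norm x\<close> would be at most half of itself.\<close>
  have d: "(norm x)\<^sup>2 / 4 > 0" using n by simp
  obtain g k where g: "proj g" "g \<in> M" and k: "k \<in> M" "pisom (x * k)" "(x * k)\<^sup>\<dagger> * (x * k) = g"
      "k * k * (x\<^sup>\<dagger> * x) = g"
    and est: "\<And>\<xi>. (norm (x \<cdot> (\<xi> - g \<cdot> \<xi>)))\<^sup>2 \<le> (norm x)\<^sup>2 / 4 * (norm (\<xi> - g \<cdot> \<xi>))\<^sup>2"
    by (rule spectral_cut_M[OF x(1) d]) blast
  have "g \<noteq> 0"
  proof
    assume "g = 0"
    then have "(norm (x \<cdot> \<xi>))\<^sup>2 \<le> (norm x / 2 * norm \<xi>)\<^sup>2" for \<xi>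
      using est[of \<xi>] by (simp add: power_mult_distrib power_divide)
    then have "norm (x \<cdot> \<xi>) \<le> norm x / 2 * norm \<xi>" for \<xi>
      by (rule power2_le_imp_le) simp
    then have "norm x \<le> norm x / 2" by (intro norm_endo_bound) simp_all
    then show False using n by simp
  qed
  then have "x * k \<noteq> 0" using k(3) by auto
  moreover have "x * k * g = (x * k * k * k * x\<^sup>\<dagger>) * x" by (simp only: k(4)[symmetric] mult.assoc)
  then have "x * k = (x * k * k * k * x\<^sup>\<dagger>) * x" using pisomD(2)[OF k(2)] k(3) by simp
  ultimately show ?thesis
    using that[of "x * k" k "x * k * k * k * x\<^sup>\<dagger>"] k(1,2) x(1) by simp
qed

text \<open>\<open>1 - c\<close> projects onto the common kernel of the operators
  \<open>f\<^sup>\<dagger> * m\<close>. That kernel is invariant under \<open>M\<close> and under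
  \<open>T\<close>, so the projection commutes with both and is central.\<close>

lemma central_support:
  assumes f: "f \<in> M"
  obtains c where "proj c" "c \<in> Z" "c * f = f" "\<And>x. (\<And>m. m \<in> M \<Longrightarrow> x * m * f = 0) \<Longrightarrow> x * c = 0"
proof -
  let ?A = "{f\<^sup>\<dagger> * m | m. m \<in> M}"
  obtain p where p: "proj p" "\<And>a. a \<in> ?A \<Longrightarrow> a * p = 0"
    "\<And>x. (\<And>a. a \<in> ?A \<Longrightarrow> a * x = 0) \<Longrightarrow> p * x = x"
    and comm: "\<And>b. (\<And>a \<xi>. a \<in> ?A \<Longrightarrow> (\<And>a. a \<in> ?A \<Longrightarrow> a \<cdot> \<xi> = 0) \<Longrightarrow> a \<cdot> b \<cdot> \<xi> = 0 \<and> a \<cdot> b\<^sup>\<dagger> \<cdot> \<xi> = 0)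
      \<Longrightarrow> p * b = b * p"
    by (rule kernel_projection[of ?A]) blast
  have "p * m = m * p" if m: "m \<in> M" for m
  proof (rule comm)
    fix a \<xi> assume a: "a \<in> ?A" and \<xi>: "\<And>a. a \<in> ?A \<Longrightarrow> a \<cdot> \<xi> = 0"
    obtain n where n: "n \<in> M" "a = f\<^sup>\<dagger> * n" using a by blast
    have "(f\<^sup>\<dagger> * (n * m)) \<cdot> \<xi> = 0" "(f\<^sup>\<dagger> * (n * m\<^sup>\<dagger>)) \<cdot> \<xi> = 0"
      by (rule \<xi>, use n(1) m in blast)+
    then show "a \<cdot> m \<cdot> \<xi> = 0 \<and> a \<cdot> m\<^sup>\<dagger> \<cdot> \<xi> = 0" by (simp add: n(2))
  qed
  moreover have "p * t = t * p" if t: "t \<in> T" for t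
  proof (rule comm)
    fix a \<xi> assume a: "a \<in> ?A" and \<xi>: "\<And>a. a \<in> ?A \<Longrightarrow> a \<cdot> \<xi> = 0"
    have "a \<in> M" using a f by auto
    then have "a * t = t * a" "a * t\<^sup>\<dagger> = t\<^sup>\<dagger> * a" using t dag_T by (blast intro: M_memD)+
    then have "a \<cdot> t \<cdot> \<xi> = t \<cdot> a \<cdot> \<xi>" "a \<cdot> t\<^sup>\<dagger> \<cdot> \<xi> = t\<^sup>\<dagger> \<cdot> a \<cdot> \<xi>" by (metis eapp_mult)+
    then show "a \<cdot> t \<cdot> \<xi> = 0 \<and> a \<cdot> t\<^sup>\<dagger> \<cdot> \<xi> = 0" using \<xi>[OF a] by simp
  qed
  then have "p \<in> M" by (rule M_memI)
  ultimately have pZ: "p \<in> Z" by (intro Z_memI)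
  have "f\<^sup>\<dagger> * 1 * p = 0" by (rule p(2)) blast
  then have "(f\<^sup>\<dagger> * p)\<^sup>\<dagger> = 0" by simp
  then have pf: "p * f = 0" by (simp add: projD[OF p(1)])
  have "x * (1 - p) = 0" if x: "\<And>m. m \<in> M \<Longrightarrow> x * m * f = 0" for x
  proof -
    have "f\<^sup>\<dagger> * m * x\<^sup>\<dagger> = 0" if "m \<in> M" for m
    proof -
      have "(x * m\<^sup>\<dagger> * f)\<^sup>\<dagger> = 0" using x[of "m\<^sup>\<dagger>"] that by simp
      then show ?thesis by (simp add: mult.assoc)
    qed
    then have "p * x\<^sup>\<dagger> = x\<^sup>\<dagger>" by (intro p(3)) auto
    then have "(p * x\<^sup>\<dagger>)\<^sup>\<dagger> = x" by simp
    then show ?thesis by (simp add: projD[OF p(1)] right_diff_distrib)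
  qed
  then show ?thesis
    using that[of "1 - p"] p(1) pZ pf by (simp add: proj_complement left_diff_distrib)
qed

text \<open>The form of comparison used throughout. If some \<open>e * m * f\<close> is nonzero, its
  phase is the link; otherwise \<open>e\<close> annihilates the central support of \<open>f\<close>.
  The absorption clauses place the link under \<open>e\<close> and \<open>f\<close>, which are
  arbitrary elements here.\<close>

lemma link_or_disjoint:
  assumes e: "e \<in> M" and f: "f \<in> M"
  obtains (link) v where "v \<in> M" "pisom v" "v \<noteq> 0" "\<And>a. a * e = e \<Longrightarrow> a * v = v" "\<And>a. f * a = f \<Longrightarrow> v * a = v"
  | (disjoint) c where "proj c" "c \<in> Z" "c * f = f" "e * c = 0"
proof (cases "\<exists>m\<in>M. e * m * f \<noteq> 0")
  case True
  then obtain m where m: "m \<in> M" "e * m * f \<noteq> 0" by blast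
  obtain v k l where v: "v \<in> M" "v \<noteq> 0" "pisom v" "v = (e * m * f) * k" "v = l * (e * m * f)"
    by (rule nonzero_pisom[OF M_mult[OF M_mult[OF e m(1)] f] m(2)]) blast
  show ?thesis
  proof (rule link[OF v(1,3,2)])
    show "a * v = v" if "a * e = e" for a
      unfolding v(4) by (simp only: mult.assoc[symmetric] that)
    show "v * a = v" if "f * a = f" for a
      unfolding v(5) by (simp only: mult.assoc that)
  qed
next
  case False
  obtain c where "proj c" "c \<in> Z" "c * f = f" "\<And>x. (\<And>m. m \<in> M \<Longrightarrow> x * m * f = 0) \<Longrightarrow> x * c = 0"
    by (rule central_support[OF f]) blast
  with False show ?thesis by (intro disjoint) auto
qed

section \<open>Exhaustion by maximal orthogonal families\<close>

lemma family_sum_in_M: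
  assumes "V \<subseteq> M" "orth_family V" "sum_of_family V s"
  shows "s \<in> M"
  by (rule M_memI, rule family_sum_commute[OF assms(2,3)]) (use assms(1) M_memD in blast)

text \<open>Zorn's lemma, with maximality stated through the sum \<open>s\<close> alone: an
  admissible \<open>w\<close> orthogonal to \<open>s\<close> on both sides is orthogonal to every
  member, so it already belongs to the family and is orthogonal to itself.\<close>

lemma maximal_orth_family:
  fixes Q :: "'a endo \<Rightarrow> bool"
  obtains V s where "V \<subseteq> M" "orth_family V" "sum_of_family V s" "s \<in> M" "\<And>v. v \<in> V \<Longrightarrow> Q v"
    "\<And>w. w \<in> M \<Longrightarrow> pisom w \<Longrightarrow> Q w \<Longrightarrow> w\<^sup>\<dagger> * s = 0 \<Longrightarrow> w * s\<^sup>\<dagger> = 0 \<Longrightarrow> w = 0"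
proof -
  define \<F> where "\<F> = {V. V \<subseteq> {v \<in> M. Q v} \<and> orth_family V}"
  have "\<exists>V\<in>\<F>. \<forall>X\<in>\<F>. V \<subseteq> X \<longrightarrow> X = V"
  proof (rule subset_Zorn')
    fix C assume C: "subset.chain \<F> C"
    have CF: "X \<subseteq> {v \<in> M. Q v} \<and> orth_family X" if "X \<in> C" for X
      using C that unfolding subset_chain_def \<F>_def by blast
    have lin: "X \<subseteq> Y \<or> Y \<subseteq> X" if "X \<in> C" "Y \<in> C" for X Y
      using C that unfolding subset_chain_def by blast
    have "pisom v" if "v \<in> \<Union>C" for v
      using that CF orth_familyD(1) by blast
    moreover have "v\<^sup>\<dagger> * w = 0 \<and> v * w\<^sup>\<dagger> = 0" if vw: "v \<in> \<Union>C" "w \<in> \<Union>C" "v \<noteq> w" for v w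
    proof -
      obtain X Y where "X \<in> C" "v \<in> X" "Y \<in> C" "w \<in> Y" using vw by blast
      then obtain W where "W \<in> C" "v \<in> W" "w \<in> W" using lin[of X Y] by blast
      then show ?thesis using CF[of W] orth_familyD(2,3)[of W v w] vw(3) by blast
    qed
    ultimately have "orth_family (\<Union>C)" unfolding orth_family_def by blast
    moreover have "\<Union>C \<subseteq> {v \<in> M. Q v}" using CF by blast
    ultimately show "\<Union>C \<in> \<F>" unfolding \<F>_def by blast
  qed
  then obtain V where VF: "V \<in> \<F>" and mx: "\<forall>X\<in>\<F>. V \<subseteq> X \<longrightarrow> X = V" ..
  have V: "V \<subseteq> {v \<in> M. Q v}" "orth_family V" using VF by (simp_all add: \<F>_def)
  have max: "X = V" if "X \<subseteq> {v \<in> M. Q v}" "orth_family X" "V \<subseteq> X" for X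
    using mx that unfolding \<F>_def by blast
  obtain s where s: "sum_of_family V s" by (rule orth_family_sum_exists[OF V(2)])
  have "w = 0" if w: "w \<in> M" "pisom w" "Q w" "w\<^sup>\<dagger> * s = 0" "w * s\<^sup>\<dagger> = 0" for w
  proof -
    have orth: "w\<^sup>\<dagger> * v = 0 \<and> w * v\<^sup>\<dagger> = 0" if v: "v \<in> V" for v
    proof
      note pv = orth_familyD(1)[OF V(2) v]
      have "w\<^sup>\<dagger> * v = w\<^sup>\<dagger> * (v * v\<^sup>\<dagger>) * v" using pisomD(1)[OF pv] by (simp add: mult.assoc)
      also have "\<dots> = w\<^sup>\<dagger> * s * v\<^sup>\<dagger> * v" using family_sum_final[OF V(2) s v] by (simp add: mult.assoc)
      finally show "w\<^sup>\<dagger> * v = 0" using w by simp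
      have "w * v\<^sup>\<dagger> = w * (v\<^sup>\<dagger> * v) * v\<^sup>\<dagger>" using pisom_dagD(1)[OF pv] by (simp add: mult.assoc)
      also have "\<dots> = w * s\<^sup>\<dagger> * v * v\<^sup>\<dagger>" using family_sum_initial[OF V(2) s v] by (simp add: mult.assoc)
      finally show "w * v\<^sup>\<dagger> = 0" using w by simp
    qed
    have orth': "v\<^sup>\<dagger> * w = 0 \<and> v * w\<^sup>\<dagger> = 0" if "v \<in> V" for v
      using arg_cong[OF conjunct1[OF orth[OF that]], of dag]
        arg_cong[OF conjunct2[OF orth[OF that]], of dag] by simp
    have "orth_family (insert w V)"
      using V(2) w(2) orth orth' unfolding orth_family_def by auto
    then have "insert w V = V" using w V(1) by (intro max) auto
    then have "w\<^sup>\<dagger> * w = 0" using orth by blast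
    then show "w = 0" by (rule dag_mult_self_eq_zero)
  qed
  then show ?thesis
    using that[of V s] V s family_sum_in_M[of V s] by blast
qed

section \<open>Finite projections\<close>

text \<open>Every isometry of \<open>p\<close> into itself is onto. The subprojection is the final
  projection of \<open>v\<close>, which avoids a second quantifier; the agreement with
  \<open>finite_projection\<close> is \<open>finite_projection_iff\<close>.\<close>

definition fin :: "'a endo \<Rightarrow> bool" where
  "fin p \<longleftrightarrow> p \<in> M \<and> proj p \<and>
    (\<forall>v\<in>M. v\<^sup>\<dagger> * v = p \<and> v * v\<^sup>\<dagger> * p = v * v\<^sup>\<dagger> \<longrightarrow> v * v\<^sup>\<dagger> = p)"

lemma finD: "fin p \<Longrightarrow> p \<in> M" "fin p \<Longrightarrow> proj p"
  "fin p \<Longrightarrow> v \<in> M \<Longrightarrow> v\<^sup>\<dagger> * v = p \<Longrightarrow> v * v\<^sup>\<dagger> * p = v * v\<^sup>\<dagger> \<Longrightarrow> v * v\<^sup>\<dagger> = p"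
  by (auto simp: fin_def)

text \<open>With \<open>q = v\<^sup>\<dagger> * v\<close>, adding the identity on
  \<open>p - q\<close> extends \<open>v\<close> to an isometry of \<open>p\<close> into itself, to
  which finiteness of \<open>p\<close> applies. This is how finiteness passes to
  subprojections.\<close>

lemma fin_sub_eq:
  assumes p: "fin p" and v: "v \<in> M" "pisom v"
    and le: "v\<^sup>\<dagger> * v * p = v\<^sup>\<dagger> * v" "v * v\<^sup>\<dagger> * (v\<^sup>\<dagger> * v) = v * v\<^sup>\<dagger>"
  shows "v * v\<^sup>\<dagger> = v\<^sup>\<dagger> * v"
proof -
  define q where "q = v\<^sup>\<dagger> * v"
  have q: "proj q" unfolding q_def by (rule pisom_initial[OF v(2)])
  note pp = projD[OF finD(2)[OF p]] and qq = projD[OF q]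
  have vq: "v * q = v" using v(2) by (simp add: q_def pisomD)
  have "(v * v\<^sup>\<dagger> * q)\<^sup>\<dagger> = (v * v\<^sup>\<dagger>)\<^sup>\<dagger>" using le(2) by (simp only: q_def)
  then have qvv: "q * (v * v\<^sup>\<dagger>) = v * v\<^sup>\<dagger>" by (simp add: qq)
  have qv: "q * v = v"
  proof -
    have "q * v = q * (v * v\<^sup>\<dagger>) * v" using pisomD[OF v(2)] by (simp add: mult.assoc)
    then show ?thesis using qvv pisomD[OF v(2)] by simp
  qed
  have qp: "q * p = q" using le(1) by (simp add: q_def)
  have pq: "p * q = q" by (rule proj_swap[OF finD(2)[OF p] q qp])
  have dv: "v\<^sup>\<dagger> * q = v\<^sup>\<dagger>" using arg_cong[OF qv, of dag] by (simp add: qq)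
  have vp: "v * p = v" by (rule absorb_right[OF vq qp])
  have dvp: "v\<^sup>\<dagger> * p = v\<^sup>\<dagger>" by (rule absorb_right[OF dv qp])
  have pv: "p * v = v" using arg_cong[OF dvp, of dag] by (simp add: pp)
  have pdv: "p * v\<^sup>\<dagger> = v\<^sup>\<dagger>" using arg_cong[OF vp, of dag] by (simp add: pp)
  have qdv: "q * v\<^sup>\<dagger> = v\<^sup>\<dagger>" using arg_cong[OF vq, of dag] by (simp add: qq)
  define w where "w = v + (p - q)"
  have wd: "w\<^sup>\<dagger> = v\<^sup>\<dagger> + (p - q)" by (simp add: w_def pp qq)
  have ww: "w\<^sup>\<dagger> * w = p"
    unfolding wd by (simp add: w_def distrib_left distrib_right left_diff_distrib right_diff_distrib
        qv pv dv dvp pq qp pp qq q_def[symmetric])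
  have ww': "w * w\<^sup>\<dagger> = v * v\<^sup>\<dagger> + (p - q)"
    unfolding wd by (simp add: w_def distrib_left distrib_right left_diff_distrib right_diff_distrib
        vq vp qdv pdv pq qp pp qq)
  have "w * w\<^sup>\<dagger> = p"
  proof (rule finD(3)[OF p _ ww])
    show "w \<in> M" using v finD(1)[OF p] by (simp add: w_def q_def)
    show "w * w\<^sup>\<dagger> * p = w * w\<^sup>\<dagger>"
      unfolding ww' by (simp add: distrib_right left_diff_distrib mult.assoc dvp pp qp)
  qed
  then show ?thesis using ww' by (simp add: q_def)
qed

lemma fin_sub:
  assumes p: "fin p" and q: "q \<in> M" "proj q" "q * p = q"
  shows "fin q"
  unfolding fin_def
proof (intro conjI ballI impI)
  fix v assume v: "v \<in> M" and vv: "v\<^sup>\<dagger> * v = q \<and> v * v\<^sup>\<dagger> * q = v * v\<^sup>\<dagger>"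
  have "pisom v" by (rule pisomI) (simp add: vv q)
  then have "v * v\<^sup>\<dagger> = v\<^sup>\<dagger> * v" using v vv q by (intro fin_sub_eq[OF p]) simp_all
  then show "v * v\<^sup>\<dagger> = q" using vv by simp
qed (use q in simp_all)

text \<open>Shifting an infinite sequence of equivalent orthogonal projections by one is a non-unitary
  isometry.\<close>

lemma fin_no_infinite_copies:
  fixes u :: "nat \<Rightarrow> 'a endo"
  assumes p: "fin p" and f: "proj f"
    and u: "\<And>i. u i \<in> M" "\<And>i. (u i)\<^sup>\<dagger> * u i = f" "\<And>i j. i \<noteq> j \<Longrightarrow> (u i)\<^sup>\<dagger> * u j = 0"
      "\<And>i. p * u i = u i"
  shows "f = 0"
proof -
  have pu: "pisom (u i)" for i by (rule pisomI) (simp add: u f)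
  have uf: "u i * f = u i" for i using pisomD(2)[OF pu[of i]] by (simp add: u)
  have fu: "f * (u i)\<^sup>\<dagger> = (u i)\<^sup>\<dagger>" for i using arg_cong[OF uf[of i], of dag] projD[OF f] by simp
  define x where "x i = u (Suc i) * (u i)\<^sup>\<dagger>" for i
  have xi: "(x i)\<^sup>\<dagger> * x i = u i * (u i)\<^sup>\<dagger>" for i
  proof -
    have "(x i)\<^sup>\<dagger> * x i = u i * ((u (Suc i))\<^sup>\<dagger> * u (Suc i)) * (u i)\<^sup>\<dagger>" by (simp add: x_def mult.assoc)
    then show ?thesis by (simp add: u uf)
  qed
  have px: "pisom (x i)" for i by (rule pisomI) (simp add: xi pisom_final[OF pu])
  have o1: "(x i)\<^sup>\<dagger> * x j = 0" if "i \<noteq> j" for i j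
  proof -
    have "(x i)\<^sup>\<dagger> * x j = u i * ((u (Suc i))\<^sup>\<dagger> * u (Suc j)) * (u j)\<^sup>\<dagger>" by (simp add: x_def mult.assoc)
    then show ?thesis using that by (simp add: u)
  qed
  have o2: "x i * (x j)\<^sup>\<dagger> = 0" if "i \<noteq> j" for i j
  proof -
    have "x i * (x j)\<^sup>\<dagger> = u (Suc i) * ((u i)\<^sup>\<dagger> * u j) * (u (Suc j))\<^sup>\<dagger>" by (simp add: x_def mult.assoc)
    then show ?thesis using that by (simp add: u)
  qed
  have "(x i)\<^sup>\<dagger> * x j = 0 \<and> x i * (x j)\<^sup>\<dagger> = 0" if "x i \<noteq> x j" for i j
    using that o1[of i j] o2[of i j] by (cases "i = j") simp_all
  then have V: "orth_family (range x)" unfolding orth_family_def using px by blast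
  obtain s where s: "sum_of_family (range x) s" by (rule orth_family_sum_exists[OF V])
  have sM: "s \<in> M" using u by (intro family_sum_in_M[OF _ V s]) (auto simp: x_def)
  have ps: "pisom s" by (rule family_sum_pisom[OF V s])
  have initial: "(s\<^sup>\<dagger> * s) * (u i * (u i)\<^sup>\<dagger>) = u i * (u i)\<^sup>\<dagger>" for i
  proof -
    have "s * (x i)\<^sup>\<dagger> = x i * (x i)\<^sup>\<dagger>" "s\<^sup>\<dagger> * x i = (x i)\<^sup>\<dagger> * x i"
      by (rule family_sum_final[OF V s] family_sum_initial[OF V s], simp)+
    note fs = this
    have "s\<^sup>\<dagger> * s * ((x i)\<^sup>\<dagger> * x i) = s\<^sup>\<dagger> * (s * (x i)\<^sup>\<dagger>) * x i" by (simp only: mult.assoc)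
    also have "\<dots> = s\<^sup>\<dagger> * (x i * (x i)\<^sup>\<dagger> * x i)" by (simp only: fs mult.assoc)
    also have "\<dots> = (x i)\<^sup>\<dagger> * x i" by (simp only: pisomD(1)[OF px] fs)
    finally show ?thesis by (simp only: xi)
  qed
  have "(s\<^sup>\<dagger> * s) * s = 1 * s"
  proof (rule family_sum_eq_left[OF V s])
    fix v assume "v \<in> range x"
    then obtain i where v: "v = x i" by blast
    have "u (Suc i) * (u (Suc i))\<^sup>\<dagger> * x i = x i"
      using pisomD(1)[OF pu[of "Suc i"]] by (simp add: x_def mult.assoc[symmetric])
    then have "s\<^sup>\<dagger> * s * x i = x i" by (rule absorb_left[OF _ initial])
    then show "s\<^sup>\<dagger> * s * v = 1 * v" by (simp add: v)
  qed
  then have "(s\<^sup>\<dagger> * s * s)\<^sup>\<dagger> = s\<^sup>\<dagger>" by simp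
  then have sFd: "s\<^sup>\<dagger> * (s\<^sup>\<dagger> * s) = s\<^sup>\<dagger>" by simp
  have "s * p = s * 1"
  proof (rule family_sum_eq_right[OF V s])
    fix v assume "v \<in> range x"
    then obtain i where v: "v = x i" by blast
    have "(u i)\<^sup>\<dagger> * p = (u i)\<^sup>\<dagger>" using arg_cong[OF u(4)[of i], of dag] projD[OF finD(2)[OF p]] by simp
    then show "v * p = v * 1" by (simp add: v x_def mult.assoc)
  qed
  then have EF: "s * s\<^sup>\<dagger> = s\<^sup>\<dagger> * s"
    using sFd by (intro fin_sub_eq[OF p sM ps]) (simp_all add: mult.assoc)
  \<comment> \<open>The first copy is orthogonal to the range of the shift \<open>s\<close>, but
    lies in its initial space. Finiteness of \<open>p\<close> has identified the two projections, so
    the copy vanishes.\<close>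
  have "(u 0)\<^sup>\<dagger> * s = 0 * s"
    by (rule family_sum_eq_left[OF V s]) (auto simp: x_def mult.assoc[symmetric] u)
  then have "(u 0)\<^sup>\<dagger> * (s\<^sup>\<dagger> * s) = 0" unfolding EF[symmetric] by (simp add: mult.assoc[symmetric])
  then have "(u 0)\<^sup>\<dagger> * (s\<^sup>\<dagger> * s) * (u 0 * (u 0)\<^sup>\<dagger>) = 0" by simp
  then have "(u 0)\<^sup>\<dagger> * (u 0 * (u 0)\<^sup>\<dagger>) = 0" by (simp only: mult.assoc initial[of 0, unfolded mult.assoc])
  then have "(u 0)\<^sup>\<dagger> = 0" using pisom_dagD(2)[OF pu] by simp
  then show ?thesis using u(2)[of 0] by simp
qed

section \<open>Vector states that are nearly tracial on a finite projection\<close>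

text \<open>An exhaustion argument: if the conclusion failed, a maximal family of partial isometries violating
  it would sum up to an equivalence of \<open>e\<^sub>0\<close> and \<open>f\<^sub>0\<close>, by finiteness.\<close>

lemma comparison_of_states:
  assumes p: "fin p" and w0: "w0 \<in> M" "pisom w0" "w0 \<noteq> 0" "p * w0 = w0" "w0 * p = w0"
    and le: "norm (w0\<^sup>\<dagger> \<cdot> \<xi>) \<le> norm (w0 \<cdot> \<eta>)"
  obtains w where "w \<in> M" "pisom w" "w \<noteq> 0" "w0 * w0\<^sup>\<dagger> * w = w" "w * (w0\<^sup>\<dagger> * w0) = w"
    "\<And>v. v \<in> M \<Longrightarrow> pisom v \<Longrightarrow> w * w\<^sup>\<dagger> * v = v \<Longrightarrow> v * (w\<^sup>\<dagger> * w) = v \<Longrightarrow> norm (v\<^sup>\<dagger> \<cdot> \<xi>) \<le> norm (v \<cdot> \<eta>)"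
proof -
  define e0 where "e0 = w0 * w0\<^sup>\<dagger>"
  define f0 where "f0 = w0\<^sup>\<dagger> * w0"
  have e0: "proj e0" "e0 \<in> M" and f0: "proj f0" "f0 \<in> M"
    using w0 by (simp_all add: e0_def f0_def pisom_final pisom_initial)
  have f0p: "f0 * p = f0" using w0(5) by (simp add: f0_def mult.assoc)
  have dw0p: "w0\<^sup>\<dagger> * p = w0\<^sup>\<dagger>" using arg_cong[OF w0(4), of dag] projD[OF finD(2)[OF p]] by simp
  have e0p: "e0 * p = e0" by (simp add: e0_def mult.assoc dw0p)
  have w0d: "w0\<^sup>\<dagger> * e0 = w0\<^sup>\<dagger>" "e0 * w0 = w0" "w0 * f0 = w0" "f0 * w0\<^sup>\<dagger> = w0\<^sup>\<dagger>"
    using pisomD[OF w0(2)] pisom_dagD[OF w0(2)] by (simp_all add: e0_def f0_def)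
  define Q where "Q v \<longleftrightarrow> e0 * v = v \<and> v * f0 = v \<and> norm (v \<cdot> \<eta>) < norm (v\<^sup>\<dagger> \<cdot> \<xi>)" for v
  obtain V s where V: "V \<subseteq> M" "orth_family V" and s: "sum_of_family V s" "s \<in> M"
    and VQ: "\<And>v. v \<in> V \<Longrightarrow> Q v"
    and max: "\<And>w. w \<in> M \<Longrightarrow> pisom w \<Longrightarrow> Q w \<Longrightarrow> w\<^sup>\<dagger> * s = 0 \<Longrightarrow> w * s\<^sup>\<dagger> = 0 \<Longrightarrow> w = 0"
    by (rule maximal_orth_family[of Q]) blast
  have ps: "pisom s" by (rule family_sum_pisom[OF V(2) s(1)])
  have e0s: "e0 * s = s"
    using family_sum_eq_left[OF V(2) s(1), of e0 1] VQ by (simp add: Q_def)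
  have sf0: "s * f0 = s"
    using family_sum_eq_right[OF V(2) s(1), of f0 1] VQ by (simp add: Q_def)
  have se0: "s\<^sup>\<dagger> * e0 = s\<^sup>\<dagger>" using arg_cong[OF e0s, of dag] projD[OF e0(1)] by simp
  have f0s: "f0 * s\<^sup>\<dagger> = s\<^sup>\<dagger>" using arg_cong[OF sf0, of dag] projD[OF f0(1)] by simp
  \<comment> \<open>\<open>e'\<close> and \<open>f'\<close> are what the family leaves over. A link
    between them has no violating piece below it, by maximality.\<close>
  define e' where "e' = e0 - s * s\<^sup>\<dagger>"
  define f' where "f' = f0 - s\<^sup>\<dagger> * s"
  have e': "proj e'" "e' \<in> M" unfolding e'_def
    using e0 s ps by (auto intro!: proj_diff pisom_final simp: mult.assoc se0)
  have f': "proj f'" "f' \<in> M" unfolding f'_def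
    using f0 s ps by (auto intro!: proj_diff pisom_initial simp: mult.assoc sf0)
  have e0e': "e0 * e' = e'" and f'f0: "f' * f0 = f'"
    using projD[OF e0(1)] projD[OF f0(1)]
    by (simp_all add: e'_def f'_def right_diff_distrib left_diff_distrib mult.assoc sf0)
      (simp_all add: mult.assoc[symmetric] e0s)
  have e's: "e' * s = 0" and sf': "f' * s\<^sup>\<dagger> = 0"
    using pisomD[OF ps] pisom_dagD[OF ps] by (simp_all add: e'_def f'_def left_diff_distrib e0s f0s)
  show ?thesis
  proof (cases rule: link_or_disjoint[OF e'(2) f'(2)])
    case (1 w)
    have e'w: "e' * w = w" and wf': "w * f' = w" using 1 projD(2) e'(1) f'(1) by blast+
    have "e0 * w = w" by (rule absorb_left[OF e'w e0e'])
    moreover have "w * f0 = w" by (rule absorb_right[OF wf' f'f0])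
    moreover have "norm (v\<^sup>\<dagger> \<cdot> \<xi>) \<le> norm (v \<cdot> \<eta>)"
      if v: "v \<in> M" "pisom v" "w * w\<^sup>\<dagger> * v = v" "v * (w\<^sup>\<dagger> * w) = v" for v
    proof (rule ccontr)
      assume neg: "\<not> norm (v\<^sup>\<dagger> \<cdot> \<xi>) \<le> norm (v \<cdot> \<eta>)"
      have e'v: "e' * v = v" by (rule absorb_left[OF v(3)]) (simp add: mult.assoc[symmetric] e'w)
      have vf': "v * f' = v" by (rule absorb_right[OF v(4)]) (simp add: mult.assoc wf')
      have "e0 * v = v" "v * f0 = v" by (rule absorb_left[OF e'v e0e'], rule absorb_right[OF vf' f'f0])
      then have Qv: "Q v" using neg by (simp add: Q_def)
      have "v\<^sup>\<dagger> * e' = v\<^sup>\<dagger>" using arg_cong[OF e'v, of dag] projD[OF e'(1)] by simp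
      then have "v\<^sup>\<dagger> * s = v\<^sup>\<dagger> * (e' * s)" by (simp only: mult.assoc[symmetric])
      then have "v\<^sup>\<dagger> * s = 0" by (simp only: e's mult_zero_right)
      moreover have "v * s\<^sup>\<dagger> = v * (f' * s\<^sup>\<dagger>)" by (simp only: vf' mult.assoc[symmetric])
      then have "v * s\<^sup>\<dagger> = 0" by (simp only: sf' mult_zero_right)
      ultimately have "v = 0" by (rule max[OF v(1,2) Qv])
      then show False using neg by simp
    qed
    ultimately show ?thesis using that[of w] 1 by (simp add: e0_def f0_def)
  next
    case (2 c)
    note cc = projD[OF 2(1)] and cZ = Z_commute[OF 2(2)] and cM = Z_mem[OF 2(2)]
    have "e0 * c = s * s\<^sup>\<dagger> * c" using 2(4) by (simp add: e'_def left_diff_distrib)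
    then have ce0: "c * e0 = c * (s * s\<^sup>\<dagger>)" using cZ[OF e0(2)] cZ[of "s * s\<^sup>\<dagger>"] s by simp
    \<comment> \<open>On \<open>c\<close> the final side is used up, so \<open>v\<close> carries
      \<open>c * f0\<close> isometrically onto its subprojection
      \<open>c * (s\<^sup>\<dagger> * s)\<close>. Finiteness gives equality, that is
      \<open>c * f' = 0\<close>, and \<open>f'\<close> lies under \<open>c\<close>.\<close>
    define v where "v = s\<^sup>\<dagger> * w0 * c"
    have vM: "v \<in> M" using s w0 cM by (simp add: v_def)
    have vd: "v\<^sup>\<dagger> = c * (w0\<^sup>\<dagger> * s)" by (simp add: v_def cc mult.assoc)
    have vv: "v\<^sup>\<dagger> * v = c * f0"
    proof -
      have "v\<^sup>\<dagger> * v = (c * w0\<^sup>\<dagger>) * (s * s\<^sup>\<dagger>) * (w0 * c)" unfolding vd by (simp only: v_def mult.assoc)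
      also have "\<dots> = (w0\<^sup>\<dagger> * c) * (s * s\<^sup>\<dagger>) * (w0 * c)" using cZ[of "w0\<^sup>\<dagger>"] w0 by simp
      also have "\<dots> = w0\<^sup>\<dagger> * (c * (s * s\<^sup>\<dagger>)) * (w0 * c)" by (simp only: mult.assoc)
      also have "\<dots> = (w0\<^sup>\<dagger> * c) * (e0 * w0) * c" by (simp only: ce0[symmetric] mult.assoc)
      also have "\<dots> = c * w0\<^sup>\<dagger> * w0 * c" using cZ[of "w0\<^sup>\<dagger>"] w0 w0d by (simp add: mult.assoc)
      also have "\<dots> = c * (f0 * c)" by (simp only: f0_def mult.assoc)
      also have "\<dots> = c * c * f0" by (simp only: cZ[OF f0(2), symmetric] mult.assoc)
      also have "\<dots> = c * f0" by (simp only: cc)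
      finally show ?thesis .
    qed
    have vv': "v * v\<^sup>\<dagger> = c * (s\<^sup>\<dagger> * s)"
    proof -
      have "v * v\<^sup>\<dagger> = s\<^sup>\<dagger> * w0 * (c * c) * (w0\<^sup>\<dagger> * s)" unfolding vd by (simp only: v_def mult.assoc)
      also have "\<dots> = s\<^sup>\<dagger> * (w0 * c) * w0\<^sup>\<dagger> * s" by (simp only: cc mult.assoc)
      also have "\<dots> = (s\<^sup>\<dagger> * c) * (w0 * w0\<^sup>\<dagger>) * s" by (simp only: cZ[OF w0(1), symmetric] mult.assoc)
      also have "\<dots> = (c * s\<^sup>\<dagger>) * (w0 * w0\<^sup>\<dagger>) * s" by (simp only: cZ[OF M_dag[OF s(2)]])
      also have "\<dots> = c * (s\<^sup>\<dagger> * e0) * s" by (simp only: e0_def mult.assoc)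
      finally show ?thesis by (simp add: se0 mult.assoc)
    qed
    have "pisom v" by (rule pisomI) (simp only: vv proj_central_mult[OF 2(1,2) f0])
    then have "v * v\<^sup>\<dagger> = v\<^sup>\<dagger> * v"
    proof (rule fin_sub_eq[OF p vM])
      show "v\<^sup>\<dagger> * v * p = v\<^sup>\<dagger> * v" by (simp add: vv mult.assoc f0p)
      have "c * (s\<^sup>\<dagger> * s) * (c * f0) = c * (s\<^sup>\<dagger> * s * c) * f0" by (simp only: mult.assoc)
      also have "\<dots> = c * (c * (s\<^sup>\<dagger> * s)) * f0" by (simp only: cZ[OF M_mult[OF M_dag[OF s(2)] s(2)]])
      also have "\<dots> = c * c * (s\<^sup>\<dagger> * (s * f0))" by (simp only: mult.assoc)
      finally show "v * v\<^sup>\<dagger> * (v\<^sup>\<dagger> * v) = v * v\<^sup>\<dagger>" by (simp only: vv vv' cc sf0)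
    qed
    then have "c * f' = 0" by (simp add: vv vv' f'_def right_diff_distrib)
    then have F: "s\<^sup>\<dagger> * s = f0" using 2(3) by (simp add: f'_def)
    \<comment> \<open>With the initial side used up, \<open>y\<close> carries \<open>e0\<close>
      isometrically onto \<open>s * s\<^sup>\<dagger>\<close>, so finiteness exhausts the final side
      too. Now \<open>s\<close> has the initial and final projections of \<open>w0\<close>, and
      \<open>le\<close> carries over to \<open>s\<close>.\<close>
    define y where "y = s * w0\<^sup>\<dagger>"
    have yy: "y\<^sup>\<dagger> * y = e0"
    proof -
      have "y\<^sup>\<dagger> * y = w0 * (s\<^sup>\<dagger> * s) * w0\<^sup>\<dagger>" by (simp add: y_def mult.assoc)
      then show ?thesis by (simp add: F w0d e0_def)
    qed
    have yy': "y * y\<^sup>\<dagger> = s * s\<^sup>\<dagger>"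
    proof -
      have "y * y\<^sup>\<dagger> = s * f0 * s\<^sup>\<dagger>" by (simp add: y_def f0_def mult.assoc)
      then show ?thesis by (simp add: sf0)
    qed
    have "pisom y" by (rule pisomI) (simp add: yy e0)
    then have "y * y\<^sup>\<dagger> = y\<^sup>\<dagger> * y"
      using s w0 by (intro fin_sub_eq[OF p]) (simp_all add: yy yy' e0p mult.assoc se0, simp add: y_def)
    then have E: "s * s\<^sup>\<dagger> = e0" by (simp add: yy yy')
    have s_le: "norm (s\<^sup>\<dagger> \<cdot> \<xi>) \<le> norm (s \<cdot> \<eta>)"
    proof -
      have "norm (s\<^sup>\<dagger> \<cdot> \<xi>) = norm (w0\<^sup>\<dagger> \<cdot> \<xi>)" "norm (s \<cdot> \<eta>) = norm (w0 \<cdot> \<eta>)"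
        using norm_pisom_app[OF pisom_dag[OF ps]] norm_pisom_app[OF pisom_dag[OF w0(2)]]
          norm_pisom_app[OF ps] norm_pisom_app[OF w0(2)] E F
        by (simp_all del: eapp_mult add: e0_def f0_def)
      then show ?thesis using le by simp
    qed
    \<comment> \<open>One member is enough to make the summed inequality strict, contrary to
      \<open>s_le\<close>.\<close>
    have "V \<noteq> {}"
    proof
      assume "V = {}"
      then have "s = 0" using family_app[OF V(2) s(1)] by (intro endo_eqI) (metis eapp.zero_left has_sum_empty has_sum_unique)
      then have "w0\<^sup>\<dagger> = 0" using E w0d(1) by simp
      then show False using w0(3) by simp
    qed
    then obtain v where v: "v \<in> V" by blast
    have "(norm (s \<cdot> \<eta>))\<^sup>2 < (norm (s\<^sup>\<dagger> \<cdot> \<xi>))\<^sup>2"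
    proof (rule has_sum_strict_mono[OF family_sum_norm_sq[OF V(2) s(1)] family_sum_dag_norm_sq[OF V(2) s(1)] _ v])
      have lt: "(norm (x \<cdot> \<eta>))\<^sup>2 < (norm (x\<^sup>\<dagger> \<cdot> \<xi>))\<^sup>2" if "x \<in> V" for x
        using VQ[OF that] by (intro power_strict_mono) (simp_all add: Q_def)
      show "(norm (v \<cdot> \<eta>))\<^sup>2 < (norm (v\<^sup>\<dagger> \<cdot> \<xi>))\<^sup>2" by (rule lt[OF v])
      show "(norm (x \<cdot> \<eta>))\<^sup>2 \<le> (norm (x\<^sup>\<dagger> \<cdot> \<xi>))\<^sup>2" if "x \<in> V" for x by (rule less_imp_le[OF lt[OF that]])
    qed
    moreover have "(norm (s\<^sup>\<dagger> \<cdot> \<xi>))\<^sup>2 \<le> (norm (s \<cdot> \<eta>))\<^sup>2" using s_le by (intro power_mono) simp_all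
    ultimately show ?thesis by simp
  qed
qed

text \<open>The smallest projection of \<open>M\<close> fixing \<open>\<xi>\<close>, classically the
  projection onto the closure of the commutant applied to \<open>\<xi>\<close>. The last clause
  makes \<open>\<xi>\<close> separating for operators that live on \<open>q\<close>.\<close>

lemma support_of_vector:
  obtains q where "proj q" "q \<in> M" "q \<cdot> \<xi> = \<xi>" "\<And>x. x \<in> M \<Longrightarrow> x \<cdot> \<xi> = 0 \<Longrightarrow> x * q = 0"
proof -
  let ?A = "{x \<in> M. x \<cdot> \<xi> = 0}"
  obtain q where q: "proj q" "\<And>a. a \<in> ?A \<Longrightarrow> a * q = 0"
    "\<And>\<zeta>. (\<And>a. a \<in> ?A \<Longrightarrow> a \<cdot> \<zeta> = 0) \<Longrightarrow> q \<cdot> \<zeta> = \<zeta>"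
    and comm: "\<And>b. (\<And>a \<xi>. a \<in> ?A \<Longrightarrow> (\<And>a. a \<in> ?A \<Longrightarrow> a \<cdot> \<xi> = 0) \<Longrightarrow> a \<cdot> b \<cdot> \<xi> = 0 \<and> a \<cdot> b\<^sup>\<dagger> \<cdot> \<xi> = 0)
      \<Longrightarrow> q * b = b * q"
    by (rule kernel_projection[of ?A]) blast
  have "q \<in> M"
  proof (rule M_memI, rule comm)
    fix t a \<zeta> assume t: "t \<in> T" and a: "a \<in> ?A" and \<zeta>: "\<And>a. a \<in> ?A \<Longrightarrow> a \<cdot> \<zeta> = 0"
    have "a * t = t * a" "a * t\<^sup>\<dagger> = t\<^sup>\<dagger> * a" using a t dag_T by (blast intro: M_memD)+
    then have "a \<cdot> t \<cdot> \<zeta> = t \<cdot> a \<cdot> \<zeta>" "a \<cdot> t\<^sup>\<dagger> \<cdot> \<zeta> = t\<^sup>\<dagger> \<cdot> a \<cdot> \<zeta>" by (metis eapp_mult)+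
    then show "a \<cdot> t \<cdot> \<zeta> = 0 \<and> a \<cdot> t\<^sup>\<dagger> \<cdot> \<zeta> = 0" using \<zeta>[OF a] by simp
  qed
  then show ?thesis using that[OF q(1)] q(2,3) by blast
qed

text \<open>Two comparisons are played against each other. The first yields an auxiliary
  \<open>\<eta>\<close> that bounds one side with a best constant \<open>l\<close>; the second,
  started at a near-optimal \<open>v0\<close>, bounds the other side with \<open>2 * l\<close>.
  Running through both cancels \<open>l\<close>, and the factor \<open>2\<close> remains.\<close>

lemma near_tracial_vector:
  assumes p: "fin p" "p \<noteq> 0"
  obtains f \<xi> where "f \<in> M" "proj f" "f \<noteq> 0" "f * p = f" "f \<cdot> \<xi> = \<xi>"
    "\<And>x. x \<in> M \<Longrightarrow> x \<cdot> \<xi> = 0 \<Longrightarrow> x * f = 0"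
    "\<And>v. v \<in> M \<Longrightarrow> pisom v \<Longrightarrow> f * v = v \<Longrightarrow> v * f = v \<Longrightarrow> (norm (v\<^sup>\<dagger> \<cdot> \<xi>))\<^sup>2 \<le> 2 * (norm (v \<cdot> \<xi>))\<^sup>2"
proof -
  note pp = projD[OF finD(2)[OF p(1)]]
  obtain \<zeta> where "p \<cdot> \<zeta> \<noteq> 0" using p(2) by (metis endo_eqI eapp.zero_left)
  then obtain \<xi> where \<xi>: "\<xi> \<noteq> 0" "p \<cdot> \<xi> = \<xi>" using finD(2)[OF p(1)] by (metis proj_app)
  obtain q where q: "proj q" "q \<in> M" "q \<cdot> \<xi> = \<xi>"
    and faithful: "\<And>x. x \<in> M \<Longrightarrow> x \<cdot> \<xi> = 0 \<Longrightarrow> x * q = 0"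
    by (rule support_of_vector[of \<xi>]) blast
  note qq = projD[OF q(1)]
  have "(1 - p) * q = 0" using \<xi> finD(1)[OF p(1)] by (intro faithful) simp_all
  then have pq: "p * q = q" by (simp add: left_diff_distrib)
  have qp: "q * p = q" using arg_cong[OF pq, of dag] by (simp add: pp qq)
  have "q \<noteq> 0" using q(3) \<xi>(1) by auto
  obtain w1 where w1: "w1 \<in> M" "pisom w1" "w1 \<noteq> 0" "q * q\<^sup>\<dagger> * w1 = w1" "w1 * (q\<^sup>\<dagger> * q) = w1"
    and le1: "\<And>v. v \<in> M \<Longrightarrow> pisom v \<Longrightarrow> w1 * w1\<^sup>\<dagger> * v = v \<Longrightarrow> v * (w1\<^sup>\<dagger> * w1) = v \<Longrightarrow> norm (v\<^sup>\<dagger> \<cdot> \<xi>) \<le> norm (v \<cdot> \<xi>)"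
    by (rule comparison_of_states[OF p(1) q(2) proj_pisom[OF q(1)] \<open>q \<noteq> 0\<close> pq qp]) (use qq in auto)
  have qw1: "q * w1 = w1" and w1q: "w1 * q = w1" using w1 qq by simp_all
  have dw1q: "w1\<^sup>\<dagger> * q = w1\<^sup>\<dagger>" using arg_cong[OF qw1, of dag] by (simp add: qq)
  define f1 where "f1 = w1\<^sup>\<dagger> * w1"
  \<comment> \<open>Transport of \<open>\<xi>\<close> by \<open>w1\<close> turns a comparison
    between the two projections of \<open>w1\<close> into one inside the single corner of
    \<open>f1\<close>.\<close>
  define \<eta> where "\<eta> = w1\<^sup>\<dagger> \<cdot> \<xi>"
  have f1: "proj f1" "f1 \<in> M" using w1 by (simp_all add: f1_def pisom_initial)
  note ff1 = projD[OF f1(1)]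
  have f1q: "f1 * q = f1" by (simp add: f1_def mult.assoc w1q)
  have f1p: "f1 * p = f1" by (rule absorb_right[OF f1q qp])
  have pf1: "p * f1 = f1" using arg_cong[OF f1p, of dag] by (simp add: pp ff1)
  have w1f1: "w1 * f1 = w1" using w1(2) by (simp add: f1_def pisomD)
  have "f1 \<noteq> 0" using w1(3) w1f1 by auto
  have below1: "norm (v\<^sup>\<dagger> \<cdot> \<eta>) \<le> norm (v \<cdot> \<xi>)"
    if v: "v \<in> M" "pisom v" "f1 * v = v" "v * f1 = v" for v
  proof -
    have "(w1 * v)\<^sup>\<dagger> * (w1 * v) = v\<^sup>\<dagger> * (f1 * v)" by (simp add: f1_def mult.assoc)
    then have uu: "(w1 * v)\<^sup>\<dagger> * (w1 * v) = v\<^sup>\<dagger> * v" by (simp only: v(3))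
    then have pu: "pisom (w1 * v)" by (intro pisomI) (simp only: pisom_initial[OF v(2)])
    have "norm ((w1 * v)\<^sup>\<dagger> \<cdot> \<xi>) \<le> norm ((w1 * v) \<cdot> \<xi>)"
    proof (rule le1[OF _ pu])
      show "w1 * v \<in> M" using w1(1) v(1) by simp
      show "w1 * w1\<^sup>\<dagger> * (w1 * v) = w1 * v" by (simp only: mult.assoc[symmetric] pisomD(1)[OF w1(2)])
      show "w1 * v * (w1\<^sup>\<dagger> * w1) = w1 * v" by (simp only: f1_def[symmetric] mult.assoc v(4))
    qed
    also have "\<dots> = norm (v \<cdot> \<xi>)" by (simp only: norm_pisom_app[OF pu] norm_pisom_app[OF v(2)] uu)
    finally show ?thesis by (simp add: \<eta>_def)
  qed
  have faithful1: "x * f1 = 0" if "x \<in> M" "x \<cdot> \<eta> = 0" for x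
  proof -
    have "x * w1\<^sup>\<dagger> * q = 0" using that w1(1) by (intro faithful) (simp_all add: \<eta>_def)
    then have "x * w1\<^sup>\<dagger> = 0" by (simp add: mult.assoc dw1q)
    then show ?thesis by (simp add: f1_def mult.assoc[symmetric])
  qed
  define I where "I = {v \<in> M. pisom v \<and> f1 * v = v \<and> v * f1 = v \<and> v \<noteq> 0}"
  define R where "R = (\<lambda>v. (norm (v \<cdot> \<xi>))\<^sup>2 / (norm (v\<^sup>\<dagger> \<cdot> \<eta>))\<^sup>2) ` I"
  \<comment> \<open>The best constant with \<open>l * (norm (v\<^sup>\<dagger> \<cdot>
    \<eta>))\<^sup>2 \<le> (norm (v \<cdot> \<xi>))\<^sup>2\<close> in this corner. Faithfulness of
    \<open>\<eta>\<close> keeps the denominators positive, and \<open>1 \<le> l\<close> is the first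
    comparison.\<close>
  define l where "l = Inf R"
  have nz: "norm (v\<^sup>\<dagger> \<cdot> \<eta>) > 0" if "v \<in> I" for v
  proof -
    have v: "v \<in> M" "f1 * v = v" "v \<noteq> 0" using that by (simp_all add: I_def)
    have "v\<^sup>\<dagger> * f1 = v\<^sup>\<dagger>" using arg_cong[OF v(2), of dag] by (simp add: ff1)
    then have "v\<^sup>\<dagger> \<cdot> \<eta> \<noteq> 0" using faithful1[of "v\<^sup>\<dagger>"] v by auto
    then show ?thesis by simp
  qed
  have "f1 \<in> I" using f1 ff1 \<open>f1 \<noteq> 0\<close> by (simp add: I_def proj_pisom)
  then have Rne: "R \<noteq> {}" by (auto simp: R_def)
  have R1: "1 \<le> r" if "r \<in> R" for r
  proof -
    from that obtain v where v: "v \<in> I" "r = (norm (v \<cdot> \<xi>))\<^sup>2 / (norm (v\<^sup>\<dagger> \<cdot> \<eta>))\<^sup>2"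
      unfolding R_def by blast
    have "(norm (v\<^sup>\<dagger> \<cdot> \<eta>))\<^sup>2 \<le> (norm (v \<cdot> \<xi>))\<^sup>2"
      using v(1) by (intro power_mono below1) (auto simp: I_def)
    then show ?thesis using nz[OF v(1)] by (simp add: v(2) pos_le_divide_eq)
  qed
  have l1: "1 \<le> l" unfolding l_def by (rule cInf_greatest[OF Rne R1])
  have bdd: "bdd_below R" using R1 by (rule bdd_belowI)
  have lower: "l * (norm (v\<^sup>\<dagger> \<cdot> \<eta>))\<^sup>2 \<le> (norm (v \<cdot> \<xi>))\<^sup>2"
    if v: "v \<in> M" "pisom v" "f1 * v = v" "v * f1 = v" for v
  proof (cases "v = 0")
    case False
    then have vI: "v \<in> I" using v by (simp add: I_def)
    then have "l \<le> (norm (v \<cdot> \<xi>))\<^sup>2 / (norm (v\<^sup>\<dagger> \<cdot> \<eta>))\<^sup>2"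
      unfolding l_def by (intro cInf_lower bdd) (simp add: R_def)
    then show ?thesis using nz[OF vI] by (simp add: pos_le_divide_eq)
  qed simp
  \<comment> \<open>Since \<open>l\<close> is positive, some member of \<open>R\<close> comes within
    a factor \<open>2\<close> of the infimum; this is the origin of the \<open>2\<close> in the
    conclusion.\<close>
  have "Inf R < 2 * l" using l1 by (simp add: l_def)
  then obtain r where "r \<in> R" "r < 2 * l" by (rule cInf_lessD[OF Rne, THEN bexE])
  then obtain v0 where v0I: "v0 \<in> I" and "(norm (v0 \<cdot> \<xi>))\<^sup>2 / (norm (v0\<^sup>\<dagger> \<cdot> \<eta>))\<^sup>2 < 2 * l"
    by (auto simp: R_def)
  then have v0l: "(norm (v0 \<cdot> \<xi>))\<^sup>2 \<le> 2 * l * (norm (v0\<^sup>\<dagger> \<cdot> \<eta>))\<^sup>2"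
    using nz[OF v0I] by (simp add: pos_divide_less_eq)
  have v0: "v0 \<in> M" "pisom v0" "f1 * v0 = v0" "v0 * f1 = v0" "v0 \<noteq> 0" using v0I by (simp_all add: I_def)
  have dv0: "v0\<^sup>\<dagger> * f1 = v0\<^sup>\<dagger>" "f1 * v0\<^sup>\<dagger> = v0\<^sup>\<dagger>"
    using arg_cong[OF v0(3), of dag] arg_cong[OF v0(4), of dag] by (simp_all add: ff1)
  have pv0: "p * v0\<^sup>\<dagger> = v0\<^sup>\<dagger>" "v0\<^sup>\<dagger> * p = v0\<^sup>\<dagger>"
    by (rule absorb_left[OF dv0(2) pf1], rule absorb_right[OF dv0(1) f1p])
  have v0le: "norm (v0\<^sup>\<dagger>\<^sup>\<dagger> \<cdot> \<xi>) \<le> norm (v0\<^sup>\<dagger> \<cdot> sqrt (2 * l) *\<^sub>R \<eta>)"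
    by (rule power2_le_imp_le) (use v0l l1 in \<open>simp_all add: eapp.scaleR_right power_mult_distrib\<close>)
  obtain w2 where w2: "w2 \<in> M" "pisom w2" "w2 \<noteq> 0" "v0\<^sup>\<dagger> * v0\<^sup>\<dagger>\<^sup>\<dagger> * w2 = w2" "w2 * (v0\<^sup>\<dagger>\<^sup>\<dagger> * v0\<^sup>\<dagger>) = w2"
    and le2: "\<And>v. v \<in> M \<Longrightarrow> pisom v \<Longrightarrow> w2 * w2\<^sup>\<dagger> * v = v \<Longrightarrow> v * (w2\<^sup>\<dagger> * w2) = v \<Longrightarrow>
      norm (v\<^sup>\<dagger> \<cdot> \<xi>) \<le> norm (v \<cdot> sqrt (2 * l) *\<^sub>R \<eta>)"
    using v0 by (elim comparison_of_states[OF p(1) M_dag pisom_dag _ pv0 v0le, rotated -1]) auto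
  have "f1 * (v0\<^sup>\<dagger> * v0\<^sup>\<dagger>\<^sup>\<dagger>) = v0\<^sup>\<dagger> * v0\<^sup>\<dagger>\<^sup>\<dagger>" by (simp only: mult.assoc[symmetric] dv0(2))
  then have f1w2: "f1 * w2 = w2" by (rule absorb_left[OF w2(4)])
  have "(v0\<^sup>\<dagger>\<^sup>\<dagger> * v0\<^sup>\<dagger>) * f1 = v0\<^sup>\<dagger>\<^sup>\<dagger> * v0\<^sup>\<dagger>" by (simp only: mult.assoc dv0(1))
  then have w2f1: "w2 * f1 = w2" by (rule absorb_right[OF w2(5)])
  have f1dw2: "f1 * w2\<^sup>\<dagger> = w2\<^sup>\<dagger>" and dw2f1: "w2\<^sup>\<dagger> * f1 = w2\<^sup>\<dagger>"
    using arg_cong[OF w2f1, of dag] arg_cong[OF f1w2, of dag] by (simp_all add: ff1)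
  define f where "f = w2 * w2\<^sup>\<dagger>"
  have f: "proj f" "f \<in> M" using w2 by (simp_all add: f_def pisom_final)
  note ff = projD[OF f(1)]
  have fw2: "f * w2 = w2" using w2(2) by (simp add: f_def pisomD)
  have ff1: "f * f1 = f" by (simp add: f_def mult.assoc dw2f1)
  have fq: "f * q = f" by (rule absorb_right[OF ff1 f1q])
  have bound: "(norm (v\<^sup>\<dagger> \<cdot> \<xi>))\<^sup>2 \<le> 2 * (norm (v \<cdot> \<xi>))\<^sup>2"
    if v: "v \<in> M" "pisom v" "f * v = v" "v * f = v" for v
  proof -
    have vf: "v * (w2 * w2\<^sup>\<dagger>) = v" using v(4) by (simp only: f_def)
    have "(v * w2) * (v * w2)\<^sup>\<dagger> = v * (w2 * w2\<^sup>\<dagger>) * v\<^sup>\<dagger>" by (simp add: mult.assoc)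
    then have ww: "(v * w2) * (v * w2)\<^sup>\<dagger> = v * v\<^sup>\<dagger>" by (simp only: vf)
    then have pw': "pisom ((v * w2)\<^sup>\<dagger>)"
      by (intro pisomI) (simp only: dag_dag pisom_final[OF v(2)])
    then have pw: "pisom (v * w2)" using pisom_dag by fastforce
    have "norm (v\<^sup>\<dagger> \<cdot> \<xi>) = norm ((v * w2)\<^sup>\<dagger> \<cdot> \<xi>)"
      using norm_pisom_app[OF pw', of \<xi>] norm_pisom_app[OF pisom_dag[OF v(2)], of \<xi>]
      by (simp only: dag_dag ww)
    also have "\<dots> \<le> norm ((v * w2) \<cdot> sqrt (2 * l) *\<^sub>R \<eta>)"
    proof (rule le2[OF _ pw])
      show "v * w2 \<in> M" using v w2 by simp
      show "w2 * w2\<^sup>\<dagger> * (v * w2) = v * w2" by (simp only: f_def[symmetric] mult.assoc[symmetric] v(3))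
      show "v * w2 * (w2\<^sup>\<dagger> * w2) = v * w2" by (simp only: mult.assoc pisomD(2)[OF w2(2)])
    qed
    also have "\<dots> = sqrt (2 * l) * norm (v \<cdot> w2 \<cdot> \<eta>)" using l1 by (simp add: eapp.scaleR_right)
    finally have "(norm (v\<^sup>\<dagger> \<cdot> \<xi>))\<^sup>2 \<le> (sqrt (2 * l) * norm (v \<cdot> w2 \<cdot> \<eta>))\<^sup>2" by (intro power_mono) simp_all
    also have "\<dots> = 2 * (l * (norm (v \<cdot> w2 \<cdot> \<eta>))\<^sup>2)" using l1 by (simp add: power_mult_distrib)
    also have "l * (norm (v \<cdot> w2 \<cdot> \<eta>))\<^sup>2 \<le> (norm (v \<cdot> \<xi>))\<^sup>2"
    proof -
      \<comment> \<open>\<open>x\<^sup>\<dagger>\<close> sends \<open>\<eta>\<close> to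
        \<open>v\<^sup>\<dagger> * v\<close> applied to \<open>w2 \<cdot> \<eta>\<close>, and
        \<open>x\<close> has the initial projection of \<open>v\<close>; so the optimal bound for
        \<open>x\<close> is the estimate wanted for \<open>v\<close>.\<close>
      define x where "x = w2\<^sup>\<dagger> * (v\<^sup>\<dagger> * v)"
      have pv: "proj (v\<^sup>\<dagger> * v)" by (rule pisom_initial[OF v(2)])
      have xd: "x\<^sup>\<dagger> = v\<^sup>\<dagger> * v * w2" by (simp add: x_def)
      have "x\<^sup>\<dagger> * x = v\<^sup>\<dagger> * (v * (w2 * w2\<^sup>\<dagger>)) * (v\<^sup>\<dagger> * v)" unfolding xd by (simp only: x_def mult.assoc)
      then have xx: "x\<^sup>\<dagger> * x = v\<^sup>\<dagger> * v" by (simp only: vf projD(2)[OF pv])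
      have px: "pisom x" by (rule pisomI) (simp only: xx pv)
      have vf1: "v * f1 = v" by (rule absorb_right[OF v(4) ff1])
      have "l * (norm (x\<^sup>\<dagger> \<cdot> \<eta>))\<^sup>2 \<le> (norm (x \<cdot> \<xi>))\<^sup>2"
      proof (rule lower[OF _ px])
        show "x \<in> M" using v w2 by (simp add: x_def)
        show "f1 * x = x" by (simp only: x_def mult.assoc[symmetric] f1dw2)
        show "x * f1 = x" by (simp only: x_def mult.assoc vf1)
      qed
      moreover have "norm (x\<^sup>\<dagger> \<cdot> \<eta>) = norm (v \<cdot> w2 \<cdot> \<eta>)"
        using norm_pisom_app[OF v(2), of "w2 \<cdot> \<eta>"] by (simp add: xd)
      moreover have "norm (x \<cdot> \<xi>) = norm (v \<cdot> \<xi>)"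
        by (simp only: norm_pisom_app[OF px] norm_pisom_app[OF v(2)] xx)
      ultimately show ?thesis by simp
    qed
    finally show ?thesis by simp
  qed
  show ?thesis
  proof (rule that[of f "f \<cdot> \<xi>"])
    show "f \<noteq> 0" using w2(3) fw2 by auto
    show "f * p = f" by (rule absorb_right[OF ff1 f1p])
    show "x * f = 0" if "x \<in> M" "x \<cdot> f \<cdot> \<xi> = 0" for x
    proof -
      have "x * f * q = 0" using that f by (intro faithful) simp_all
      then show ?thesis by (simp add: mult.assoc fq)
    qed
    show "(norm (v\<^sup>\<dagger> \<cdot> f \<cdot> \<xi>))\<^sup>2 \<le> 2 * (norm (v \<cdot> f \<cdot> \<xi>))\<^sup>2"
      if v: "v \<in> M" "pisom v" "f * v = v" "v * f = v" for v
    proof -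
      have "v\<^sup>\<dagger> * f = v\<^sup>\<dagger>" using arg_cong[OF v(3), of dag] by (simp add: ff)
      then have "v\<^sup>\<dagger> \<cdot> f \<cdot> \<xi> = v\<^sup>\<dagger> \<cdot> \<xi>" "v \<cdot> f \<cdot> \<xi> = v \<cdot> \<xi>" using v(4) by (metis eapp_mult)+
      then show ?thesis using bound[OF v] by simp
    qed
  qed (use f in simp_all)
qed

text \<open>Halving the spectrum of \<open>x\<^sup>\<dagger> * x\<close> at a time extends the estimate from partial isometries to all
  elements.\<close>

lemma near_tracial_dyadic:
  assumes f: "f \<in> M"
    and tr: "\<And>v. v \<in> M \<Longrightarrow> pisom v \<Longrightarrow> f * v = v \<Longrightarrow> v * f = v \<Longrightarrow> (norm (v\<^sup>\<dagger> \<cdot> \<xi>))\<^sup>2 \<le> 2 * (norm (v \<cdot> \<xi>))\<^sup>2"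
  shows "x \<in> M \<Longrightarrow> f * x = x \<Longrightarrow> x * f = x \<Longrightarrow> 0 < t \<Longrightarrow> (norm x)\<^sup>2 \<le> t \<Longrightarrow>
    (norm (x\<^sup>\<dagger> \<cdot> \<xi>))\<^sup>2 \<le> 4 * (norm (x \<cdot> \<xi>))\<^sup>2 + t / 2 ^ n * (norm \<xi>)\<^sup>2"
proof (induction n arbitrary: x t)
  case 0
  have "(norm (x\<^sup>\<dagger> \<cdot> \<xi>))\<^sup>2 \<le> (norm x * norm \<xi>)\<^sup>2"
    using norm_eapp[of "x\<^sup>\<dagger>" \<xi>] by (intro power_mono) simp_all
  also have "\<dots> \<le> t * (norm \<xi>)\<^sup>2"
    using 0 by (simp add: power_mult_distrib mult_right_mono)
  finally show ?case by (simp add: add_increasing)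
next
  case (Suc n)
  obtain g k where g: "proj g" "g \<in> M" and k: "k \<in> M" "pisom (x * k)" "(x * k)\<^sup>\<dagger> * (x * k) = g"
    "k * k * (x\<^sup>\<dagger> * x) = g" "x * k * (x * k)\<^sup>\<dagger> * (x * g) = x * g" "g * (x\<^sup>\<dagger> * x) = (x\<^sup>\<dagger> * x) * g"
    and est: "\<And>\<xi>. t / 2 * (norm (g \<cdot> \<xi>))\<^sup>2 \<le> (norm (x \<cdot> g \<cdot> \<xi>))\<^sup>2"
    "\<And>\<xi>. (norm (x \<cdot> (\<xi> - g \<cdot> \<xi>)))\<^sup>2 \<le> t / 2 * (norm (\<xi> - g \<cdot> \<xi>))\<^sup>2"
    by (rule spectral_cut_M[OF Suc.prems(1), of "t / 2"]) (use Suc.prems(4) in simp, blast)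
  note gg = projD[OF g(1)]
  have gf: "g * f = g" unfolding k(4)[symmetric] by (simp only: mult.assoc Suc.prems(3))
  have fg: "f\<^sup>\<dagger> * g = g" using arg_cong[OF gf, of dag] by (simp add: gg)
  define v where "v = x * k"
  have v: "v \<in> M" "pisom v" using k Suc.prems by (simp_all add: v_def)
  have vv: "v\<^sup>\<dagger> * v = g" and vxg: "v * v\<^sup>\<dagger> * (x * g) = x * g" using k by (simp_all add: v_def)
  have vg: "v * g = v" using pisomD(2)[OF v(2)] by (simp only: vv)
  have fv: "f * v = v" by (simp only: v_def mult.assoc[symmetric] Suc.prems(2))
  have vf: "v * f = v" by (rule absorb_right[OF vg gf])
  have vg': "norm (v \<cdot> \<xi>) = norm (g \<cdot> \<xi>)" by (simp only: norm_pisom_app[OF v(2)] vv)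
  \<comment> \<open>On \<open>g\<close> the spectrum of \<open>x\<^sup>\<dagger> * x\<close> lies
    between \<open>t/2\<close> and \<open>t\<close>, so \<open>x\<close> is comparable with its
    phase \<open>v\<close> up to a factor \<open>2\<close>; the tracial estimate for
    \<open>v\<close> contributes the other \<open>2\<close> in \<open>4\<close>.\<close>
  have 1: "(norm (g \<cdot> x\<^sup>\<dagger> \<cdot> \<xi>))\<^sup>2 \<le> 4 * (norm (x \<cdot> g \<cdot> \<xi>))\<^sup>2"
  proof -
    have "g * x\<^sup>\<dagger> = g * x\<^sup>\<dagger> * (v * v\<^sup>\<dagger>)" using arg_cong[OF vxg, of dag] by (simp add: gg mult.assoc)
    then have "g \<cdot> x\<^sup>\<dagger> \<cdot> \<xi> = g \<cdot> x\<^sup>\<dagger> \<cdot> v \<cdot> v\<^sup>\<dagger> \<cdot> \<xi>" by (metis eapp_mult)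
    then have "norm (g \<cdot> x\<^sup>\<dagger> \<cdot> \<xi>) \<le> norm (x\<^sup>\<dagger> \<cdot> v \<cdot> v\<^sup>\<dagger> \<cdot> \<xi>)"
      using norm_proj_app[OF g(1)] by simp
    also have "\<dots> \<le> norm x * norm (v \<cdot> v\<^sup>\<dagger> \<cdot> \<xi>)" using norm_eapp[of "x\<^sup>\<dagger>"] by simp
    also have "\<dots> \<le> norm x * norm (v\<^sup>\<dagger> \<cdot> \<xi>)"
      by (intro mult_left_mono norm_pisom_app_le v) simp
    finally have "(norm (g \<cdot> x\<^sup>\<dagger> \<cdot> \<xi>))\<^sup>2 \<le> (norm x * norm (v\<^sup>\<dagger> \<cdot> \<xi>))\<^sup>2" by (intro power_mono) simp_all
    also have "\<dots> \<le> t * (norm (v\<^sup>\<dagger> \<cdot> \<xi>))\<^sup>2"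
      using Suc.prems by (simp add: power_mult_distrib mult_right_mono)
    also have "\<dots> \<le> t * (2 * (norm (g \<cdot> \<xi>))\<^sup>2)"
      using tr[OF v fv vf] Suc.prems by (intro mult_left_mono) (simp_all add: vg')
    also have "\<dots> \<le> 4 * (norm (x \<cdot> g \<cdot> \<xi>))\<^sup>2" using est(1)[of \<xi>] by simp
    finally show ?thesis .
  qed
  define y where "y = x * (1 - g)"
  have yd: "y\<^sup>\<dagger> = (1 - g) * x\<^sup>\<dagger>" by (simp add: y_def gg)
  have ny: "(norm y)\<^sup>2 \<le> t / 2"
  proof -
    have "norm (y \<cdot> \<zeta>) \<le> sqrt (t / 2) * norm \<zeta>" for \<zeta>
    proof (rule power2_le_imp_le)
      have "(norm (y \<cdot> \<zeta>))\<^sup>2 \<le> t / 2 * (norm (\<zeta> - g \<cdot> \<zeta>))\<^sup>2" using est(2)[of \<zeta>] by (simp add: y_def)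
      also have "\<dots> \<le> t / 2 * (norm \<zeta>)\<^sup>2"
        using norm_proj_app[OF proj_complement[OF g(1)], of \<zeta>] Suc.prems
        by (intro mult_left_mono power_mono) simp_all
      finally show "(norm (y \<cdot> \<zeta>))\<^sup>2 \<le> (sqrt (t / 2) * norm \<zeta>)\<^sup>2"
        using Suc.prems by (simp add: power_mult_distrib)
    qed (use Suc.prems in simp)
    then have "norm y \<le> sqrt (t / 2)" using Suc.prems by (intro norm_endo_bound) simp_all
    then have "(norm y)\<^sup>2 \<le> (sqrt (t / 2))\<^sup>2" by (intro power_mono) simp_all
    then show ?thesis using Suc.prems by simp
  qed
  have 2: "(norm (y\<^sup>\<dagger> \<cdot> \<xi>))\<^sup>2 \<le> 4 * (norm (y \<cdot> \<xi>))\<^sup>2 + t / 2 / 2 ^ n * (norm \<xi>)\<^sup>2"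
  proof (rule Suc.IH)
    show "y \<in> M" using Suc.prems g by (simp add: y_def)
    show "f * y = y" by (simp only: y_def mult.assoc[symmetric] Suc.prems(2))
    show "y * f = y" by (simp add: y_def mult.assoc left_diff_distrib gf) (simp add: right_diff_distrib Suc.prems(3))
  qed (use Suc.prems ny in simp_all)
  have 3: "(norm (x\<^sup>\<dagger> \<cdot> \<xi>))\<^sup>2 = (norm (g \<cdot> x\<^sup>\<dagger> \<cdot> \<xi>))\<^sup>2 + (norm (y\<^sup>\<dagger> \<cdot> \<xi>))\<^sup>2"
    using proj_pythagoras[OF g(1), of "x\<^sup>\<dagger> \<cdot> \<xi>"] unfolding yd by simp
  \<comment> \<open>The two parts of \<open>x \<cdot> \<xi>\<close> are orthogonal because
    \<open>g\<close> commutes with \<open>x\<^sup>\<dagger> * x\<close>.\<close>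
  have 4: "(norm (x \<cdot> \<xi>))\<^sup>2 = (norm (x \<cdot> g \<cdot> \<xi>))\<^sup>2 + (norm (y \<cdot> \<xi>))\<^sup>2"
  proof -
    have "inner (x \<cdot> g \<cdot> \<xi>) (y \<cdot> \<xi>) = inner \<xi> ((g * (x\<^sup>\<dagger> * x) * (1 - g)) \<cdot> \<xi>)"
      by (simp add: y_def inner_dag gg)
    also have "g * (x\<^sup>\<dagger> * x) * (1 - g) = 0"
      by (simp only: k(6)) (simp add: mult.assoc right_diff_distrib gg)
    finally have "inner (x \<cdot> g \<cdot> \<xi>) (y \<cdot> \<xi>) = 0" by simp
    moreover have "x \<cdot> \<xi> = x \<cdot> g \<cdot> \<xi> + y \<cdot> \<xi>" by (simp add: y_def eapp.diff_right)
    ultimately show ?thesis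
      by (simp add: power2_norm_eq_inner inner_add_left inner_add_right inner_commute)
  qed
  show ?case using 1 2 3 4 by simp
qed

lemma near_tracial_bound:
  assumes f: "f \<in> M"
    and tr: "\<And>v. v \<in> M \<Longrightarrow> pisom v \<Longrightarrow> f * v = v \<Longrightarrow> v * f = v \<Longrightarrow> (norm (v\<^sup>\<dagger> \<cdot> \<xi>))\<^sup>2 \<le> 2 * (norm (v \<cdot> \<xi>))\<^sup>2"
    and x: "x \<in> M" "f * x = x" "x * f = x"
  shows "(norm (x\<^sup>\<dagger> \<cdot> \<xi>))\<^sup>2 \<le> 4 * (norm (x \<cdot> \<xi>))\<^sup>2"
proof -
  define t where "t = (norm x)\<^sup>2 + 1"
  have t: "0 < t" "(norm x)\<^sup>2 \<le> t" by (simp_all add: t_def add_nonneg_pos)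
  have "(norm (x\<^sup>\<dagger> \<cdot> \<xi>))\<^sup>2 \<le> 4 * (norm (x \<cdot> \<xi>))\<^sup>2 + t / 2 ^ n * (norm \<xi>)\<^sup>2" for n
    by (rule near_tracial_dyadic[OF f tr x t])
  moreover have "(\<lambda>n. 4 * (norm (x \<cdot> \<xi>))\<^sup>2 + t / 2 ^ n * (norm \<xi>)\<^sup>2) \<longlonglongrightarrow> 4 * (norm (x \<cdot> \<xi>))\<^sup>2 + 0 * (norm \<xi>)\<^sup>2"
    by (intro tendsto_add tendsto_mult tendsto_const LIMSEQ_divide_realpow_zero) simp
  ultimately have "(norm (x\<^sup>\<dagger> \<cdot> \<xi>))\<^sup>2 \<le> 4 * (norm (x \<cdot> \<xi>))\<^sup>2 + 0 * (norm \<xi>)\<^sup>2"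
    by (intro LIMSEQ_le_const) auto
  then show ?thesis by simp
qed

section \<open>Vectors that are essential for finitely many finite projections\<close>

text \<open>On the central part \<open>c\<close>, the inequality
  \<open>c * p \<le> c * (\<Sum>y. y * y\<^sup>\<dagger>)\<close> in terms of vectors: finitely many
  contractions issuing from \<open>f\<close> cover \<open>p\<close> there. It stands in for a
  multiple of the trace of \<open>f\<close> bounding that of \<open>p\<close>.\<close>

definition dominated :: "'a endo \<Rightarrow> 'a endo \<Rightarrow> 'a endo \<Rightarrow> bool" where
  "dominated c p f \<longleftrightarrow> (\<exists>ys. (\<forall>y\<in>set ys. y \<in> M \<and> y * f = y \<and> norm y \<le> 1) \<and>
     (\<forall>\<zeta>. (norm (c \<cdot> p \<cdot> \<zeta>))\<^sup>2 \<le> (\<Sum>y\<leftarrow>ys. (norm (y\<^sup>\<dagger> \<cdot> c \<cdot> \<zeta>))\<^sup>2)))"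

text \<open>\<open>p\<close> contains only finitely many orthogonal copies of \<open>f\<close>, and what remains is subequivalent to \<open>f\<close>
  on some central projection that does not annihilate \<open>f\<close>.\<close>

lemma fin_dominated:
  assumes p: "fin p" and f: "f \<in> M" "proj f" "f \<noteq> 0"
  obtains c where "proj c" "c \<in> Z" "c * f \<noteq> 0" "dominated c p f"
proof -
  note pM = finD(1)[OF p] and pp = projD[OF finD(2)[OF p]] and ff = projD[OF f(2)]
  define Q where "Q e \<longleftrightarrow> proj e \<and> p * e = e \<and> (\<exists>v\<in>M. v\<^sup>\<dagger> * v = f \<and> v * v\<^sup>\<dagger> = e)" for e
  obtain V s where V: "V \<subseteq> M" "orth_family V" and s: "sum_of_family V s" "s \<in> M"
    and VQ: "\<And>e. e \<in> V \<Longrightarrow> Q e"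
    and max: "\<And>w. w \<in> M \<Longrightarrow> pisom w \<Longrightarrow> Q w \<Longrightarrow> w\<^sup>\<dagger> * s = 0 \<Longrightarrow> w * s\<^sup>\<dagger> = 0 \<Longrightarrow> w = 0"
    by (rule maximal_orth_family[of Q]) blast
  define v where "v e = (SOME v. v \<in> M \<and> v\<^sup>\<dagger> * v = f \<and> v * v\<^sup>\<dagger> = e)" for e
  have v: "v e \<in> M" "(v e)\<^sup>\<dagger> * v e = f" "v e * (v e)\<^sup>\<dagger> = e" if "e \<in> V" for e
  proof -
    have "\<exists>v. v \<in> M \<and> v\<^sup>\<dagger> * v = f \<and> v * v\<^sup>\<dagger> = e" using VQ[OF that] by (auto simp: Q_def)
    from someI_ex[OF this] show "v e \<in> M" "(v e)\<^sup>\<dagger> * v e = f" "v e * (v e)\<^sup>\<dagger> = e" by (simp_all add: v_def)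
  qed
  have ev: "e * v e = v e" and pv: "pisom (v e)" if "e \<in> V" for e
  proof -
    show "pisom (v e)" by (rule pisomI) (simp add: v(2)[OF that] f)
    from pisomD(1)[OF this] show "e * v e = v e" by (simp only: v(3)[OF that])
  qed
  have e: "proj e" "p * e = e" if "e \<in> V" for e using VQ[OF that] by (simp_all add: Q_def)
  have "finite V"
  proof (rule ccontr)
    assume "infinite V"
    then obtain u :: "nat \<Rightarrow> 'a endo" where u: "inj u" "range u \<subseteq> V"
      using infinite_countable_subset by blast
    have uV: "u i \<in> V" for i using u(2) by blast
    have "f = 0"
    proof (rule fin_no_infinite_copies[OF p f(2), of "\<lambda>i. v (u i)"])
      fix i j :: nat assume "i \<noteq> j"
      then have ne: "u i \<noteq> u j" using u(1) by (simp add: inj_eq)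
      have "(v (u i))\<^sup>\<dagger> * u i = (v (u i))\<^sup>\<dagger>"
        using arg_cong[OF ev[OF uV[of i]], of dag] projD[OF e(1)[OF uV]] by simp
      then have "(v (u i))\<^sup>\<dagger> * v (u j) = (v (u i))\<^sup>\<dagger> * u i * (u j * v (u j))" by (simp add: ev[OF uV])
      also have "\<dots> = (v (u i))\<^sup>\<dagger> * ((u i)\<^sup>\<dagger> * u j) * v (u j)"
        using projD(1)[OF e(1)[OF uV[of i]]] by (simp add: mult.assoc)
      finally show "(v (u i))\<^sup>\<dagger> * v (u j) = 0"
        by (simp add: orth_familyD(2)[OF V(2) uV uV ne])
    next
      show "p * v (u i) = v (u i)" for i by (rule absorb_left[OF ev[OF uV] e(2)[OF uV]])
    qed (simp_all add: v uV)
    then show False using f by simp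
  qed
  have ps: "p * s = s" using family_sum_eq_left[OF V(2) s(1), of p 1] e(2) by simp
  have sproj: "proj s" by (rule family_of_projections_sum[OF V(2) s(1) e(1)])
  note sd = projD(1)[OF sproj]
  have sp: "s * p = s" using arg_cong[OF ps, of dag] by (simp add: sd pp)
  have snorm: "(norm (s \<cdot> \<zeta>))\<^sup>2 = (\<Sum>e\<in>V. (norm ((v e)\<^sup>\<dagger> \<cdot> \<zeta>))\<^sup>2)" for \<zeta>
  proof -
    have "(norm (s \<cdot> \<zeta>))\<^sup>2 = (\<Sum>e\<in>V. (norm (e \<cdot> \<zeta>))\<^sup>2)"
      using family_sum_norm_sq[OF V(2) s(1)] has_sum_finite[OF \<open>finite V\<close>] has_sum_unique by blast
    also have "\<dots> = (\<Sum>e\<in>V. (norm ((v e)\<^sup>\<dagger> \<cdot> \<zeta>))\<^sup>2)"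
    proof (rule sum.cong[OF refl])
      fix e assume e: "e \<in> V"
      show "(norm (e \<cdot> \<zeta>))\<^sup>2 = (norm ((v e)\<^sup>\<dagger> \<cdot> \<zeta>))\<^sup>2"
        by (simp only: norm_pisom_app[OF pisom_dag[OF pv[OF e]]] dag_dag v(3)[OF e])
    qed
    finally show ?thesis .
  qed
  define p0 where "p0 = p - s"
  have p0: "proj p0" "p0 \<in> M" unfolding p0_def
    using sproj s(2) pM sp finD(2)[OF p] by (simp_all add: proj_diff)
  note pp0 = projD[OF p0(1)]
  have pp0': "p * p0 = p0" by (simp add: p0_def right_diff_distrib pp ps)
  have p0s: "p0 * s = 0" by (simp add: p0_def left_diff_distrib projD[OF sproj] ps)
  \<comment> \<open>The remainder \<open>p0\<close> receives a maximal partial isometry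
    \<open>z\<close> from inside \<open>f\<close>; its leftovers \<open>a\<close> in
    \<open>f\<close> and \<open>b\<close> in \<open>p0\<close> are compared next.\<close>
  define Q' where "Q' w \<longleftrightarrow> p0 * w = w \<and> w * f = w" for w
  obtain W z where W: "W \<subseteq> M" "orth_family W" and z: "sum_of_family W z" "z \<in> M"
    and WQ: "\<And>w. w \<in> W \<Longrightarrow> Q' w"
    and max': "\<And>w. w \<in> M \<Longrightarrow> pisom w \<Longrightarrow> Q' w \<Longrightarrow> w\<^sup>\<dagger> * z = 0 \<Longrightarrow> w * z\<^sup>\<dagger> = 0 \<Longrightarrow> w = 0"
    by (rule maximal_orth_family[of Q']) blast
  have pz: "pisom z" by (rule family_sum_pisom[OF W(2) z(1)])
  have p0z: "p0 * z = z" using family_sum_eq_left[OF W(2) z(1), of p0 1] WQ by (simp add: Q'_def)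
  have zf: "z * f = z" using family_sum_eq_right[OF W(2) z(1), of f 1] WQ by (simp add: Q'_def)
  have zp0: "z\<^sup>\<dagger> * p0 = z\<^sup>\<dagger>" using arg_cong[OF p0z, of dag] by (simp add: pp0)
  have fz: "f * z\<^sup>\<dagger> = z\<^sup>\<dagger>" using arg_cong[OF zf, of dag] by (simp add: ff)
  define a where "a = f - z\<^sup>\<dagger> * z"
  define b where "b = p0 - z * z\<^sup>\<dagger>"
  have a: "proj a" "a \<in> M" unfolding a_def
    using f z(2) pz by (auto intro!: proj_diff pisom_initial simp: mult.assoc zf)
  have b: "proj b" "b \<in> M" unfolding b_def
    using p0 z(2) pz by (auto intro!: proj_diff pisom_final simp: mult.assoc zp0)
  have fa: "f * a = a" by (simp add: a_def right_diff_distrib ff mult.assoc[symmetric] fz)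
  have bp0: "b * p0 = b" by (simp add: b_def left_diff_distrib pp0 mult.assoc zp0)
  have bz: "b * z = 0" by (simp add: b_def left_diff_distrib p0z pisomD[OF pz])
  have za: "z * a = 0" by (simp add: a_def right_diff_distrib zf pisomD[OF pz])
  show ?thesis
  proof (cases rule: link_or_disjoint[OF a(2) b(2)])
    case (1 v)
    have av: "a * v = v" and vb: "v * b = v" using 1 projD(2) a(1) b(1) by blast+
    have fv: "f * v = v" and vp0: "v * p0 = v"
      by (rule absorb_left[OF av fa], rule absorb_right[OF vb bp0])
    have "v\<^sup>\<dagger> * f = v\<^sup>\<dagger>" using arg_cong[OF fv, of dag] by (simp add: ff)
    moreover have "p0 * v\<^sup>\<dagger> = v\<^sup>\<dagger>" using arg_cong[OF vp0, of dag] by (simp add: pp0)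
    ultimately have Qv: "Q' (v\<^sup>\<dagger>)" by (simp add: Q'_def)
    have "v * z = v * (b * z)" by (simp only: vb mult.assoc[symmetric])
    then have "v\<^sup>\<dagger>\<^sup>\<dagger> * z = 0" by (simp only: bz mult_zero_right dag_dag)
    moreover have "z * v = z * a * v" by (simp only: av mult.assoc)
    then have "(z * v)\<^sup>\<dagger> = 0" by (simp only: za mult_zero_left dag_zero)
    then have "v\<^sup>\<dagger> * z\<^sup>\<dagger> = 0" by simp
    ultimately have "v\<^sup>\<dagger> = 0" by (rule max'[OF M_dag[OF 1(1)] pisom_dag[OF 1(2)] Qv])
    with 1 show ?thesis by simp
  next
    case (2 c')
    have cZ: "c' * m = m * c'" if "m \<in> M" for m by (rule Z_commute[OF 2(2) that])
    \<comment> \<open>\<open>c'\<close> carries \<open>b\<close> and is disjoint from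
      \<open>a\<close>; hence on \<open>c\<close> the remainder \<open>p0\<close> is entirely the
      range of \<open>z\<close>.\<close>
    define c where "c = 1 - c'"
    have c: "proj c" "c \<in> Z" using 2 by (simp_all add: c_def proj_complement)
    have cb: "c * b = 0" using 2(3) by (simp add: c_def left_diff_distrib)
    \<comment> \<open>Otherwise \<open>z\<close> would start on all of \<open>f\<close>, and its
      range would be one more copy of \<open>f\<close> in \<open>p\<close>, orthogonal to
      \<open>s\<close>.\<close>
    have "c * f \<noteq> 0"
    proof
      assume "c * f = 0"
      then have cf: "c' * f = f" by (simp add: c_def left_diff_distrib)
      have "f * c' = z\<^sup>\<dagger> * z * c'" using 2(4) by (simp add: a_def left_diff_distrib)
      then have "f = z\<^sup>\<dagger> * z * c'" using cZ[OF f(1)] cf by simp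
      also have "\<dots> = z\<^sup>\<dagger> * (z * f) * c'" by (simp only: zf)
      also have "\<dots> = z\<^sup>\<dagger> * z * (f * c')" by (simp only: mult.assoc)
      also have "\<dots> = z\<^sup>\<dagger> * z" using cZ[OF f(1)] cf by (simp add: mult.assoc zf)
      finally have zz: "z\<^sup>\<dagger> * z = f" by simp
      have "z * z\<^sup>\<dagger> = 0"
      proof (rule max)
        show "z * z\<^sup>\<dagger> \<in> M" "pisom (z * z\<^sup>\<dagger>)" using z(2) pz by (simp_all add: proj_pisom pisom_final)
        have "p * z = z" by (rule absorb_left[OF p0z pp0'])
        then show "Q (z * z\<^sup>\<dagger>)" unfolding Q_def
          using pz z(2) zz by (auto simp: pisom_final mult.assoc[symmetric])
        have "z\<^sup>\<dagger> * s = z\<^sup>\<dagger> * (p0 * s)" by (simp only: zp0 mult.assoc[symmetric])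
        then have "z\<^sup>\<dagger> * s = 0" by (simp only: p0s mult_zero_right)
        then show "(z * z\<^sup>\<dagger>)\<^sup>\<dagger> * s = 0" "z * z\<^sup>\<dagger> * s\<^sup>\<dagger> = 0" by (simp_all add: mult.assoc sd)
      qed
      then have "z = 0" using pisomD(1)[OF pz] by simp
      then show False using zz f(3) by simp
    qed
    moreover have "dominated c p f"
    proof -
      obtain es where es: "distinct es" "set es = V" using finite_distinct_list[OF \<open>finite V\<close>] by blast
      let ?ys = "map v es @ [z]"
      have "v e * f = v e" "norm (v e) \<le> 1" if "e \<in> V" for e
        using pisomD(2)[OF pv[OF that]] norm_pisom_le[OF pv[OF that]] v(2)[OF that] by simp_all
      then have ys: "y \<in> M \<and> y * f = y \<and> norm y \<le> 1" if "y \<in> set ?ys" for y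
        using that v(1) z(2) zf norm_pisom_le[OF pz] by (auto simp: es)
      have "(norm (c \<cdot> p \<cdot> \<zeta>))\<^sup>2 \<le> (\<Sum>y\<leftarrow>?ys. (norm (y\<^sup>\<dagger> \<cdot> c \<cdot> \<zeta>))\<^sup>2)" for \<zeta>
      proof -
        define \<zeta>' where "\<zeta>' = c \<cdot> \<zeta>"
        have cm: "c \<cdot> m \<cdot> \<zeta> = m \<cdot> \<zeta>'" if "m \<in> M" for m
          unfolding \<zeta>'_def by (metis Z_commute[OF c(2) that] eapp_mult)
        have "s \<cdot> p \<cdot> \<zeta>' = s \<cdot> \<zeta>'" by (metis sp eapp_mult)
        then have "(norm (p \<cdot> \<zeta>'))\<^sup>2 = (norm (s \<cdot> \<zeta>'))\<^sup>2 + (norm (p0 \<cdot> \<zeta>'))\<^sup>2"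
          using proj_pythagoras[OF sproj, of "p \<cdot> \<zeta>'"] by (simp add: p0_def)
        moreover have "p0 \<cdot> \<zeta>' = (z * z\<^sup>\<dagger>) \<cdot> \<zeta>'"
        proof -
          have "c * p0 = c * (z * z\<^sup>\<dagger>)" using cb by (simp add: b_def right_diff_distrib)
          then have "c \<cdot> p0 \<cdot> \<zeta> = c \<cdot> (z * z\<^sup>\<dagger>) \<cdot> \<zeta>" by (metis eapp_mult)
          then show ?thesis using cm[OF p0(2)] cm[of "z * z\<^sup>\<dagger>"] z(2) by simp
        qed
        then have "norm (p0 \<cdot> \<zeta>') = norm (z\<^sup>\<dagger> \<cdot> \<zeta>')"
          by (simp only: norm_pisom_app[OF pisom_dag[OF pz]] dag_dag)
        ultimately have "(norm (p \<cdot> \<zeta>'))\<^sup>2 = (\<Sum>e\<in>V. (norm ((v e)\<^sup>\<dagger> \<cdot> \<zeta>'))\<^sup>2) + (norm (z\<^sup>\<dagger> \<cdot> \<zeta>'))\<^sup>2"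
          by (simp add: snorm)
        also have "\<dots> = (\<Sum>y\<leftarrow>?ys. (norm (y\<^sup>\<dagger> \<cdot> \<zeta>'))\<^sup>2)"
          using es by (simp add: o_def sum_list_distinct_conv_sum_set)
        finally show ?thesis using cm[OF pM] by (simp add: \<zeta>'_def)
      qed
      with ys show ?thesis unfolding dominated_def by blast
    qed
    ultimately show ?thesis using that[OF c] by blast
  qed
qed

lemma dominated_central_mult:
  assumes "dominated c p f" "d \<in> Z" "c \<in> Z" "p \<in> M"
  shows "dominated (d * c) p f"
proof -
  obtain ys where ys: "\<forall>y\<in>set ys. y \<in> M \<and> y * f = y \<and> norm y \<le> 1"
    "\<And>\<zeta>. (norm (c \<cdot> p \<cdot> \<zeta>))\<^sup>2 \<le> (\<Sum>y\<leftarrow>ys. (norm (y\<^sup>\<dagger> \<cdot> c \<cdot> \<zeta>))\<^sup>2)"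
    using assms(1) unfolding dominated_def by blast
  have "d \<cdot> c \<cdot> p \<cdot> \<zeta> = c \<cdot> p \<cdot> d \<cdot> \<zeta>" "d \<cdot> c \<cdot> \<zeta> = c \<cdot> d \<cdot> \<zeta>" for \<zeta>
  proof -
    have "d * (c * p) = c * p * d" "d * c = c * d"
      using assms by (auto intro!: Z_commute[of d] simp: Z_mem)
    then show "d \<cdot> c \<cdot> p \<cdot> \<zeta> = c \<cdot> p \<cdot> d \<cdot> \<zeta>" "d \<cdot> c \<cdot> \<zeta> = c \<cdot> d \<cdot> \<zeta>" by (metis eapp_mult)+
  qed
  then have "(norm ((d * c) \<cdot> p \<cdot> \<zeta>))\<^sup>2 \<le> (\<Sum>y\<leftarrow>ys. (norm (y\<^sup>\<dagger> \<cdot> (d * c) \<cdot> \<zeta>))\<^sup>2)" for \<zeta>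
    using ys(2)[of "d \<cdot> \<zeta>"] by simp
  with ys(1) show ?thesis unfolding dominated_def by blast
qed

text \<open>Each step treats \<open>c * f\<close> in place of \<open>f\<close>, so the new central
  projection stays nonzero on \<open>c * f\<close>, and domination of the earlier projections
  survives the multiplication (\<open>dominated_central_mult\<close>).\<close>

lemma finite_set_dominated:
  assumes "finite P" "\<And>p. p \<in> P \<Longrightarrow> fin p" and f: "f \<in> M" "proj f" "f \<noteq> 0"
  shows "\<exists>c. proj c \<and> c \<in> Z \<and> c * f \<noteq> 0 \<and> (\<forall>p\<in>P. dominated c p f)"
  using assms(1,2)
  proof (induction P)
    case empty
    then show ?case using f by (intro exI[of _ 1]) simp
  next
    case (insert p P)
    then obtain c where c: "proj c" "c \<in> Z" "c * f \<noteq> 0" "\<And>p. p \<in> P \<Longrightarrow> dominated c p f" by blast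
    have cf: "c * f \<in> M" "proj (c * f)" using c f by (simp_all add: Z_mem proj_central_mult)
    have p: "fin p" using insert.prems by simp
    obtain d where d: "proj d" "d \<in> Z" "d * (c * f) \<noteq> 0" "dominated d p (c * f)"
      by (rule fin_dominated[OF p cf c(3)])
    have "y * f = y" if "y * (c * f) = y" for y
      by (rule absorb_right[OF that]) (simp add: mult.assoc projD[OF f(2)])
    then have "dominated d p f" using d(4) unfolding dominated_def by blast
    then have "dominated (c * d) p f" using c d finD(1)[OF p] by (intro dominated_central_mult)
    moreover have cd: "c * d = d * c" using c d by (intro Z_commute) (simp_all add: Z_mem)
    ultimately have "dominated (d * c) p f" by simp
    moreover have "dominated (d * c) p' f" if "p' \<in> P" for p'
      using c d insert.prems that finD(1) by (intro dominated_central_mult) auto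
    moreover have "proj (d * c)" using c d by (intro proj_central_mult) (simp_all add: Z_mem)
    ultimately show ?case using c d by (intro exI[of _ "d * c"]) (simp add: mult.assoc)
qed

section \<open>Infinitely many orthogonal copies of one projection\<close>

lemma infinite_copies:
  assumes inf: "\<And>c. proj c \<Longrightarrow> c \<in> Z \<Longrightarrow> c \<noteq> 0 \<Longrightarrow> \<not> fin (c * q)"
    and q: "q \<in> M" "proj q" and g: "g \<in> M" "g \<noteq> 0" "proj g"
  obtains r u where "r \<in> M" "proj r" "r \<noteq> 0" "r * g = r" "\<And>i::nat. u i \<in> M" "\<And>i. (u i)\<^sup>\<dagger> * u i = r"
    "\<And>i j. i \<noteq> j \<Longrightarrow> (u i)\<^sup>\<dagger> * u j = 0" "\<And>i. q * u i = u i"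
proof -
  \<comment> \<open>Cutting \<open>q\<close> down by the central support of \<open>g\<close> ties
    the two together: any central projection that carries \<open>g\<close> then carries everything
    under \<open>c * q\<close>.\<close>
  obtain c where c: "proj c" "c \<in> Z" "c * g = g"
    and csupp: "\<And>x. (\<And>m. m \<in> M \<Longrightarrow> x * m * g = 0) \<Longrightarrow> x * c = 0"
    by (rule central_support[OF g(1)]) blast
  define d where "d = c * q"
  have d: "d \<in> M" "proj d" using c q by (simp_all add: d_def Z_mem proj_central_mult)
  note dd = projD[OF d(2)] and qq = projD[OF q(2)] and gg = projD[OF g(3)]
  have "c \<noteq> 0" using c g by auto
  then have "\<not> fin d" using inf c by (simp add: d_def)
  then obtain w where w: "w \<in> M" "w\<^sup>\<dagger> * w = d" "w * w\<^sup>\<dagger> * d = w * w\<^sup>\<dagger>" "w * w\<^sup>\<dagger> \<noteq> d"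
    using d by (auto simp: fin_def)
  have pw: "pisom w" by (rule pisomI) (simp add: w d)
  \<comment> \<open>\<open>k\<close> is the defect of \<open>w\<close>, with no direct relation to
    \<open>g\<close>; the link \<open>v\<close> moves a piece of \<open>g\<close> into it, and the
    powers of \<open>w\<close> spread this piece.\<close>
  define k where "k = d - w * w\<^sup>\<dagger>"
  have k: "proj k" "k \<in> M" "k \<noteq> 0"
    using d w pw by (auto simp: k_def intro!: proj_diff pisom_final)
  note kk = projD[OF k(1)]
  have "w\<^sup>\<dagger> * (w * w\<^sup>\<dagger>) * d = w\<^sup>\<dagger> * (w * w\<^sup>\<dagger>)" using w(3) by (simp add: mult.assoc)
  then have wd: "w\<^sup>\<dagger> * d = w\<^sup>\<dagger>" by (simp only: pisom_dagD(2)[OF pw])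
  have dw: "d * w = w" using arg_cong[OF wd, of dag] by (simp add: dd)
  have kw: "k * w = 0" by (simp add: k_def left_diff_distrib dw pisomD[OF pw])
  have dk: "d * k = k" by (simp add: k_def right_diff_distrib dd mult.assoc[symmetric] dw)
  have qd: "q * d = d"
  proof -
    have "q * d = (q * c) * q" by (simp only: d_def mult.assoc)
    also have "\<dots> = c * (q * q)" by (simp only: Z_commute[OF c(2) q(1), symmetric] mult.assoc)
    finally show ?thesis by (simp only: qq d_def)
  qed
  show ?thesis
  proof (cases rule: link_or_disjoint[OF k(2) g(1)])
    case (1 v)
    have kv: "k * v = v" and vg: "v * g = v" using 1 kk gg by blast+
    have dv: "d * v = v" by (rule absorb_left[OF kv dk])
    have vw: "v\<^sup>\<dagger> * w = 0"
    proof -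
      have "v\<^sup>\<dagger> * k = v\<^sup>\<dagger>" using arg_cong[OF kv, of dag] by (simp add: kk)
      then have "v\<^sup>\<dagger> * w = v\<^sup>\<dagger> * (k * w)" by (simp only: mult.assoc[symmetric])
      then show ?thesis by (simp only: kw mult_zero_right)
    qed
    have dwv: "d * (w ^ i * v) = w ^ i * v" for i
      by (cases i) (simp_all add: dv mult.assoc[symmetric] dw)
    have iso: "(w ^ i)\<^sup>\<dagger> * (w ^ (i + j) * v) = w ^ j * v" for i j
    proof (induction i)
      case (Suc i)
      have "(w ^ Suc i)\<^sup>\<dagger> * (w ^ (Suc i + j) * v) = (w ^ i)\<^sup>\<dagger> * ((w\<^sup>\<dagger> * w) * (w ^ (i + j) * v))"
        by (simp add: mult.assoc)
      then show ?case by (simp only: w(2) dwv Suc)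
    qed simp
    define u where "u i = w ^ i * v" for i
    have uu: "(u i)\<^sup>\<dagger> * u (i + j) = v\<^sup>\<dagger> * (w ^ j * v)" for i j
      unfolding u_def dag_mult using iso[of i j] by (simp only: mult.assoc)
    have 0: "(u i)\<^sup>\<dagger> * u j = 0" if "i < j" for i j
    proof -
      from that obtain m where "j = i + Suc m" using less_imp_Suc_add[of i j] by auto
      then have "(u i)\<^sup>\<dagger> * u j = (v\<^sup>\<dagger> * w) * (w ^ m * v)" using uu[of i "Suc m"] by (simp add: mult.assoc)
      then show ?thesis by (simp only: vw mult_zero_left)
    qed
    show ?thesis
    proof (rule that[of "v\<^sup>\<dagger> * v" u])
      show "v\<^sup>\<dagger> * v \<in> M" "proj (v\<^sup>\<dagger> * v)" "v\<^sup>\<dagger> * v * g = v\<^sup>\<dagger> * v"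
        using 1 by (simp_all add: pisom_initial mult.assoc vg)
      show "v\<^sup>\<dagger> * v \<noteq> 0" using dag_mult_self_eq_zero 1(3) by blast
      show "u i \<in> M" for i using w 1 by (simp add: u_def)
      show "(u i)\<^sup>\<dagger> * u i = v\<^sup>\<dagger> * v" for i using uu[of i 0] by simp
      show "(u i)\<^sup>\<dagger> * u j = 0" if "i \<noteq> j" for i j
      proof (cases "i < j")
        case False
        then have ji: "(u j)\<^sup>\<dagger> * u i = 0" using that by (intro 0) simp
        show ?thesis using arg_cong[OF ji, of dag] by simp
      qed (rule 0)
      show "q * u i = u i" for i unfolding u_def by (rule absorb_left[OF dwv qd])
    qed
  next
    case (2 c')
    have "(1 - c') * c = 0"
    proof (rule csupp)
      fix m assume "m \<in> M"
      then have "c' * m * g = m * (c' * g)" using Z_commute[OF 2(2)] by (simp add: mult.assoc[symmetric])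
      then show "(1 - c') * m * g = 0" by (simp add: left_diff_distrib 2(3))
    qed
    then have c'c: "c' * c = c" by (simp add: left_diff_distrib)
    have "c * d = d" unfolding d_def by (simp add: mult.assoc[symmetric] projD[OF c(1)])
    then have "c * k = k" by (rule absorb_left[OF dk])
    then have "c' * k = k" by (rule absorb_left[OF _ c'c])
    then have "k = 0" using 2(4) Z_commute[OF 2(2) k(2)] by simp
    with k show ?thesis by simp
  qed
qed

lemma sum_list_sum_swap:
  "(\<Sum>i\<in>A. \<Sum>y\<leftarrow>ys. g i y) = (\<Sum>y\<leftarrow>ys. \<Sum>i\<in>A. g i y :: real)"
  by (induction ys) (simp_all add: sum.distrib)

text \<open>The sums bounded here are, up to a constant, traces of \<open>b\<^sup>\<dagger> * p * b\<close>: the \<open>\<xi> i\<close> are copies of a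
  nearly tracial vector of norm one.\<close>

lemma essential_vectors:
  assumes inf: "\<And>c. proj c \<Longrightarrow> c \<in> Z \<Longrightarrow> c \<noteq> 0 \<Longrightarrow> \<not> fin c"
    and e: "proj e" "e \<in> Z" "e \<noteq> 0" and P: "finite P" "\<And>p. p \<in> P \<Longrightarrow> fin p"
  obtains \<xi> B where "\<And>i::nat. norm (\<xi> i) = 1" "\<And>i. e \<cdot> \<xi> i = \<xi> i" "0 \<le> B"
    "\<And>p b N. p \<in> P \<Longrightarrow> b \<in> M \<Longrightarrow> (\<Sum>i<N. (norm (p \<cdot> b \<cdot> \<xi> i))\<^sup>2) \<le> B * (norm b)\<^sup>2"
proof (cases "\<forall>p\<in>P. e * p = 0")
  \<comment> \<open>If no member of \<open>P\<close> meets \<open>e\<close>, every unit vector under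
    \<open>e\<close> serves, repeated and with bound \<open>0\<close>.\<close>
  case True
  obtain \<zeta> where \<zeta>: "e \<cdot> \<zeta> \<noteq> 0" using e(3) by (metis endo_eqI eapp.zero_left)
  define \<xi> where "\<xi> = (1 / norm (e \<cdot> \<zeta>)) *\<^sub>R (e \<cdot> \<zeta>)"
  have \<xi>: "norm \<xi> = 1" "e \<cdot> \<xi> = \<xi>" using \<zeta> e by (simp_all add: \<xi>_def eapp.scaleR_right)
  have "p \<cdot> b \<cdot> \<xi> = 0" if "p \<in> P" "b \<in> M" for p b
  proof -
    have "p * b * e = e * (p * b)"
      by (rule Z_commute[OF e(2), symmetric]) (use that P finD(1) in blast)
    also have "\<dots> = 0" using True that by (simp add: mult.assoc[symmetric])
    finally have "(p * b * e) \<cdot> \<xi> = 0" by simp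
    then show ?thesis by (simp add: \<xi>)
  qed
  then show ?thesis using that[of "\<lambda>_. \<xi>" 0] \<xi> by simp
next
  case False
  then obtain p0 where p0: "p0 \<in> P" "e * p0 \<noteq> 0" by blast
  have fp0: "fin p0" by (rule P(2)[OF p0(1)])
  note pp0 = projD[OF finD(2)[OF fp0]]
  have ep0: "fin (e * p0)"
  proof (rule fin_sub[OF fp0])
    show "e * p0 \<in> M" "proj (e * p0)"
      using e finD[OF fp0] by (simp_all add: Z_mem proj_central_mult)
    show "e * p0 * p0 = e * p0" by (simp add: mult.assoc pp0)
  qed
  obtain f \<xi> where f: "f \<in> M" "proj f" "f \<noteq> 0" "f * (e * p0) = f" and \<xi>: "f \<cdot> \<xi> = \<xi>"
    and faithful: "\<And>x. x \<in> M \<Longrightarrow> x \<cdot> \<xi> = 0 \<Longrightarrow> x * f = 0"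
    and tr: "\<And>v. v \<in> M \<Longrightarrow> pisom v \<Longrightarrow> f * v = v \<Longrightarrow> v * f = v \<Longrightarrow> (norm (v\<^sup>\<dagger> \<cdot> \<xi>))\<^sup>2 \<le> 2 * (norm (v \<cdot> \<xi>))\<^sup>2"
    by (rule near_tracial_vector[OF ep0 p0(2)]) blast
  have ef: "e * f = f"
  proof -
    have "f * e = f"
    proof (rule absorb_right[OF f(4)])
      have "e * p0 * e = e * (e * p0)" using Z_commute[OF e(2), of "e * p0"] finD(1)[OF ep0] by simp
      then show "e * p0 * e = e * p0" by (simp only: mult.assoc[symmetric] projD[OF e(1)])
    qed
    then show ?thesis using Z_commute[OF e(2) f(1)] by simp
  qed
  \<comment> \<open>Applied with the unit projection for \<open>q\<close>: since no nonzero central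
    projection is finite, some \<open>r\<close> under \<open>f\<close> has infinitely many
    orthogonal copies in \<open>M\<close>.\<close>
  obtain r u where r: "r \<in> M" "proj r" "r \<noteq> 0" "r * f = r"
    and u: "\<And>i::nat. u i \<in> M" "\<And>i. (u i)\<^sup>\<dagger> * u i = r" "\<And>i j. i \<noteq> j \<Longrightarrow> (u i)\<^sup>\<dagger> * u j = 0"
    by (rule infinite_copies[OF _ M_one proj_1 f(1,3,2)]) (use inf in \<open>simp, blast\<close>)
  obtain c where c: "proj c" "c \<in> Z" "c * r \<noteq> 0" and dom: "\<And>p. p \<in> P \<Longrightarrow> dominated c p r"
    using finite_set_dominated[OF P r(1-3)] by blast
  note cc = projD[OF c(1)] and rr = projD[OF r(2)] and ff = projD[OF f(2)]
  have cM: "c \<in> M" by (rule Z_mem[OF c(2)])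
  have cr: "proj (c * r)" using c r by (intro proj_central_mult)
  define w where "w i = c * u i" for i
  have wu: "w i = u i * c" for i unfolding w_def by (rule Z_commute[OF c(2) u(1)])
  have wM: "w i \<in> M" for i using cM u(1) by (simp add: w_def)
  have wd: "(w i)\<^sup>\<dagger> = c * (u i)\<^sup>\<dagger>" for i by (simp add: wu cc)
  have ww: "(w i)\<^sup>\<dagger> * w j = c * ((u i)\<^sup>\<dagger> * u j) * c" for i j
    unfolding wd by (simp only: wu mult.assoc)
  have wi: "(w i)\<^sup>\<dagger> * w i = c * r" for i
  proof -
    have "(w i)\<^sup>\<dagger> * w i = c * (c * r)" unfolding ww u(2)
      by (simp only: mult.assoc Z_commute[OF c(2) r(1), symmetric])
    then show ?thesis by (simp only: mult.assoc[symmetric] cc)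
  qed
  have pw: "pisom (w i)" for i by (rule pisomI) (simp only: wi cr)
  have worth: "(w i)\<^sup>\<dagger> * w j = 0" if "i \<noteq> j" for i j by (simp add: ww u(3)[OF that])
  note bessel = orthogonal_ranges_bessel[of w, OF pw worth]
  have crf: "c * r * f = c * r" by (simp only: mult.assoc r(4))
  have wcr: "w i * (c * r) = w i" for i using pisomD(2)[OF pw[of i]] by (simp only: wi)
  have wf: "w i * f = w i" for i by (rule absorb_right[OF wcr crf])
  have fwd: "f * (w i)\<^sup>\<dagger> = (w i)\<^sup>\<dagger>" for i using arg_cong[OF wf[of i], of dag] by (simp add: ff)
  define \<kappa> where "\<kappa> = norm ((c * r) \<cdot> \<xi>)"
  have "(c * r) \<cdot> \<xi> \<noteq> 0"
    using faithful[of "c * r"] c(3) cM r(1) by (simp only: crf) blast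
  then have \<kappa>: "\<kappa> > 0" by (simp add: \<kappa>_def del: eapp_mult)
  have nw: "norm (w i \<cdot> \<xi>) = \<kappa>" for i by (simp only: norm_pisom_app[OF pw] wi \<kappa>_def)
  define \<xi>' where "\<xi>' i = (1 / \<kappa>) *\<^sub>R (w i \<cdot> \<xi>)" for i
  have bound: "\<exists>B\<ge>0. \<forall>b\<in>M. \<forall>N. (\<Sum>i<N. (norm (p \<cdot> b \<cdot> \<xi>' i))\<^sup>2) \<le> B * (norm b)\<^sup>2" if p: "p \<in> P" for p
  proof -
    have pM: "p \<in> M" using finD(1) P(2)[OF p] by blast
    obtain ys where ys: "\<And>y. y \<in> set ys \<Longrightarrow> y \<in> M \<and> y * r = y \<and> norm y \<le> 1"
      and dp: "\<And>\<zeta>. (norm (c \<cdot> p \<cdot> \<zeta>))\<^sup>2 \<le> (\<Sum>y\<leftarrow>ys. (norm (y\<^sup>\<dagger> \<cdot> c \<cdot> \<zeta>))\<^sup>2)"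
      using dom[OF p] unfolding dominated_def by blast
    \<comment> \<open>The key exchange: near-traciality at \<open>\<xi>\<close> moves
      \<open>w i\<close> from the right to the left at the cost of a factor \<open>4\<close>, where
      Bessel's inequality for the orthogonal ranges bounds the sum independently of
      \<open>N\<close>.\<close>
    have trb: "(\<Sum>i<N. (norm (y\<^sup>\<dagger> \<cdot> c \<cdot> b \<cdot> w i \<cdot> \<xi>))\<^sup>2) \<le> 4 * ((norm b)\<^sup>2 * (norm \<xi>)\<^sup>2)"
      if y: "y \<in> set ys" and b: "b \<in> M" for y b N
    proof -
      have yM: "y \<in> M" and yr: "y * r = y" and y1: "norm y \<le> 1" using ys[OF y] by simp_all
      define x where "x i = (w i)\<^sup>\<dagger> * (b\<^sup>\<dagger> * c * y)" for i
      have "(norm (y\<^sup>\<dagger> \<cdot> c \<cdot> b \<cdot> w i \<cdot> \<xi>))\<^sup>2 \<le> 4 * (norm (x i \<cdot> \<xi>))\<^sup>2" for i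
      proof -
        have "(x i)\<^sup>\<dagger> = y\<^sup>\<dagger> * (c * b) * w i" by (simp add: x_def cc mult.assoc)
        then have "(x i)\<^sup>\<dagger> \<cdot> \<xi> = y\<^sup>\<dagger> \<cdot> c \<cdot> b \<cdot> w i \<cdot> \<xi>" by simp
        moreover have "(norm ((x i)\<^sup>\<dagger> \<cdot> \<xi>))\<^sup>2 \<le> 4 * (norm (x i \<cdot> \<xi>))\<^sup>2"
        proof (rule near_tracial_bound[OF f(1) tr])
          show "x i \<in> M" using wM b cM yM by (simp add: x_def)
          show "f * x i = x i" by (simp only: x_def mult.assoc[symmetric] fwd)
          have "y * f = y" by (rule absorb_right[OF yr r(4)])
          then show "x i * f = x i" by (simp only: x_def mult.assoc)
        qed
        ultimately show ?thesis by simp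
      qed
      then have "(\<Sum>i<N. (norm (y\<^sup>\<dagger> \<cdot> c \<cdot> b \<cdot> w i \<cdot> \<xi>))\<^sup>2) \<le> (\<Sum>i<N. 4 * (norm (x i \<cdot> \<xi>))\<^sup>2)"
        by (intro sum_mono)
      also have "\<dots> = 4 * (\<Sum>i<N. (norm ((w i)\<^sup>\<dagger> \<cdot> b\<^sup>\<dagger> \<cdot> c \<cdot> y \<cdot> \<xi>))\<^sup>2)"
        by (simp add: x_def sum_distrib_left)
      also have "\<dots> \<le> 4 * (norm (b\<^sup>\<dagger> \<cdot> c \<cdot> y \<cdot> \<xi>))\<^sup>2" using bessel by simp
      also have "norm (b\<^sup>\<dagger> \<cdot> c \<cdot> y \<cdot> \<xi>) \<le> norm b * norm \<xi>"
      proof -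
        have "norm (c \<cdot> y \<cdot> \<xi>) \<le> norm (y \<cdot> \<xi>)" by (rule norm_proj_app[OF c(1)])
        also have "\<dots> \<le> norm y * norm \<xi>" by (rule norm_eapp)
        also have "\<dots> \<le> norm \<xi>" using y1 by (simp add: mult_left_le_one_le)
        finally have "norm (b\<^sup>\<dagger>) * norm (c \<cdot> y \<cdot> \<xi>) \<le> norm b * norm \<xi>" by (simp add: mult_left_mono)
        then show ?thesis using norm_eapp[of "b\<^sup>\<dagger>" "c \<cdot> y \<cdot> \<xi>"] by linarith
      qed
      then have "4 * (norm (b\<^sup>\<dagger> \<cdot> c \<cdot> y \<cdot> \<xi>))\<^sup>2 \<le> 4 * ((norm b)\<^sup>2 * (norm \<xi>)\<^sup>2)"
        by (simp add: power_mono flip: power_mult_distrib)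
      finally show ?thesis by simp
    qed
    \<comment> \<open>One trace estimate for each \<open>y\<close> in the cover of \<open>p\<close>;
      dividing by \<open>\<kappa>\<^sup>2\<close> accounts for the normalization of the
      vectors.\<close>
    define B where "B = real (length ys) * (4 * (norm \<xi>)\<^sup>2) / \<kappa>\<^sup>2"
    have "(\<Sum>i<N. (norm (p \<cdot> b \<cdot> \<xi>' i))\<^sup>2) \<le> B * (norm b)\<^sup>2" if b: "b \<in> M" for b N
    proof -
      have cp: "p \<cdot> b \<cdot> w i \<cdot> \<xi> = c \<cdot> p \<cdot> b \<cdot> w i \<cdot> \<xi>" for i
      proof -
        have "c * w i = w i" by (simp only: w_def mult.assoc[symmetric] cc)
        then have "p * b * w i = p * b * c * w i" by (simp only: mult.assoc)
        also have "\<dots> = c * (p * b) * w i" using Z_commute[OF c(2), of "p * b"] pM b by simp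
        finally have "(p * b * w i) \<cdot> \<xi> = (c * (p * b) * w i) \<cdot> \<xi>" by (rule arg_cong)
        then show ?thesis by simp
      qed
      have "(\<Sum>i<N. (norm (p \<cdot> b \<cdot> w i \<cdot> \<xi>))\<^sup>2) \<le> (\<Sum>i<N. \<Sum>y\<leftarrow>ys. (norm (y\<^sup>\<dagger> \<cdot> c \<cdot> b \<cdot> w i \<cdot> \<xi>))\<^sup>2)"
        by (rule sum_mono, subst cp, rule dp)
      also have "\<dots> = (\<Sum>y\<leftarrow>ys. \<Sum>i<N. (norm (y\<^sup>\<dagger> \<cdot> c \<cdot> b \<cdot> w i \<cdot> \<xi>))\<^sup>2)"
        by (rule sum_list_sum_swap)
      also have "\<dots> \<le> (\<Sum>y\<leftarrow>ys. 4 * ((norm b)\<^sup>2 * (norm \<xi>)\<^sup>2))"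
        by (rule sum_list_mono) (rule trb[OF _ b])
      also have "\<dots> = B * \<kappa>\<^sup>2 * (norm b)\<^sup>2" using \<kappa> by (simp add: sum_list_triv B_def)
      finally have 1: "(\<Sum>i<N. (norm (p \<cdot> b \<cdot> w i \<cdot> \<xi>))\<^sup>2) \<le> B * \<kappa>\<^sup>2 * (norm b)\<^sup>2" .
      have "(norm (p \<cdot> b \<cdot> \<xi>' i))\<^sup>2 = (1 / \<kappa>\<^sup>2) * (norm (p \<cdot> b \<cdot> w i \<cdot> \<xi>))\<^sup>2" for i
        using \<kappa> by (simp add: \<xi>'_def eapp.scaleR_right power_divide)
      then have "(\<Sum>i<N. (norm (p \<cdot> b \<cdot> \<xi>' i))\<^sup>2) = (1 / \<kappa>\<^sup>2) * (\<Sum>i<N. (norm (p \<cdot> b \<cdot> w i \<cdot> \<xi>))\<^sup>2)"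
        by (simp only: sum_distrib_left)
      also have "\<dots> \<le> (1 / \<kappa>\<^sup>2) * (B * \<kappa>\<^sup>2 * (norm b)\<^sup>2)" by (rule mult_left_mono[OF 1]) simp
      finally show ?thesis using \<kappa> by simp
    qed
    moreover have "0 \<le> B" by (simp add: B_def)
    ultimately show ?thesis by blast
  qed
  then obtain B where B: "\<And>p. p \<in> P \<Longrightarrow> 0 \<le> B p"
    "\<And>p b N. p \<in> P \<Longrightarrow> b \<in> M \<Longrightarrow> (\<Sum>i<N. (norm (p \<cdot> b \<cdot> \<xi>' i))\<^sup>2) \<le> B p * (norm b)\<^sup>2" by metis
  show ?thesis
  proof (rule that[of \<xi>' "sum B P"])
    show "norm (\<xi>' i) = 1" for i using \<kappa> nw by (simp add: \<xi>'_def)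
    show "e \<cdot> \<xi>' i = \<xi>' i" for i
    proof -
      have "e * w i = w i * f * e" using Z_commute[OF e(2) wM] wf by simp
      also have "\<dots> = w i * (e * f)" using Z_commute[OF e(2) f(1)] by (simp add: mult.assoc)
      finally have "e * w i = w i" by (simp only: ef wf)
      then have "e \<cdot> w i \<cdot> \<xi> = w i \<cdot> \<xi>" by (metis eapp_mult)
      then show ?thesis by (simp add: \<xi>'_def eapp.scaleR_right)
    qed
    show "0 \<le> sum B P" by (rule sum_nonneg) (rule B)
    fix p b N assume p: "p \<in> P" and b: "b \<in> M"
    have "B p \<le> sum B P" using p P(1) B(1) by (intro member_le_sum) auto
    then have "B p * (norm b)\<^sup>2 \<le> sum B P * (norm b)\<^sup>2" by (intro mult_right_mono) simp_all
    then show "(\<Sum>i<N. (norm (p \<cdot> b \<cdot> \<xi>' i))\<^sup>2) \<le> sum B P * (norm b)\<^sup>2"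
      using B(2)[OF p b, of N] by linarith
  qed
qed

section \<open>Unitaries moving finitely many vectors into an infinite projection\<close>

definition unitary :: "'a endo \<Rightarrow> bool" where
  "unitary u \<longleftrightarrow> u \<in> M \<and> u\<^sup>\<dagger> * u = 1 \<and> u * u\<^sup>\<dagger> = 1"

lemma unitary_mult: "unitary u \<Longrightarrow> unitary w \<Longrightarrow> unitary (u * w)"
  unfolding unitary_def by (simp add: mult.assoc) (simp add: mult.assoc[symmetric])

lemma unitary_dag: "unitary u \<Longrightarrow> unitary (u\<^sup>\<dagger>)"
  by (simp add: unitary_def)

lemma norm_unitary_app: "unitary u \<Longrightarrow> norm (u \<cdot> \<xi>) = norm \<xi>"
  using norm_eapp_sq[of u \<xi>] by (simp add: unitary_def power2_norm_eq_inner[symmetric])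

text \<open>\<open>v * v = 0\<close> makes initial and final projection orthogonal. The unitary
  exchanges them and fixes the rest; it is a self-adjoint involution, so one product gives both
  unitarity equations.\<close>

lemma swap_unitary:
  assumes v: "v \<in> M" "pisom v" "v * v = 0"
  shows "unitary (v + v\<^sup>\<dagger> + (1 - v\<^sup>\<dagger> * v - v * v\<^sup>\<dagger>))"
proof -
  have dvdv: "v\<^sup>\<dagger> * v\<^sup>\<dagger> = 0" using arg_cong[OF v(3), of dag] by simp
  have v1: "v * (v\<^sup>\<dagger> * v) = v" "v\<^sup>\<dagger> * (v * v\<^sup>\<dagger>) = v\<^sup>\<dagger>"
    by (rule pisomD(2)[OF v(2)], rule pisom_dagD(2)[OF v(2)])
  have v0: "v * (v * x) = 0" "v\<^sup>\<dagger> * (v\<^sup>\<dagger> * x) = 0" for x by (simp_all add: mult.assoc[symmetric] v(3) dvdv)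
  define u where "u = v + v\<^sup>\<dagger> + (1 - v\<^sup>\<dagger> * v - v * v\<^sup>\<dagger>)"
  have "u * u = 1"
    by (simp add: u_def distrib_left distrib_right left_diff_distrib right_diff_distrib mult.assoc v0 v1 v(3) dvdv)
  moreover have "u\<^sup>\<dagger> = u" by (simp add: u_def algebra_simps)
  moreover have "u \<in> M" using v by (simp add: u_def)
  ultimately show ?thesis unfolding u_def[symmetric] by (simp add: unitary_def)
qed

definition copied_in :: "'a endo \<Rightarrow> 'a endo \<Rightarrow> bool" where
  "copied_in q e \<longleftrightarrow> proj e \<and> q * e = 0 \<and> (\<exists>u :: nat \<Rightarrow> 'a endo. (\<forall>i. u i \<in> M \<and> (u i)\<^sup>\<dagger> * u i = e \<and> q * u i = u i) \<and>
     (\<forall>i j. i \<noteq> j \<longrightarrow> (u i)\<^sup>\<dagger> * u j = 0))"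

text \<open>Exchanging \<open>e\<close> with a copy of it inside \<open>q\<close> on which the given vectors are small removes, up to
  \<open>\<epsilon>\<close>, exactly the \<open>e\<close>-component outside \<open>q\<close>.\<close>

lemma remove_component:
  assumes q: "proj q" "q \<in> M" and e: "copied_in q e" and S: "finite S" and \<epsilon>: "0 < \<epsilon>"
  obtains u where "unitary u" "\<And>\<xi>. \<xi> \<in> S \<Longrightarrow> norm ((1 - q) \<cdot> u \<cdot> \<xi> - ((1 - q) \<cdot> \<xi> - e \<cdot> \<xi>)) < \<epsilon>"
proof -
  have pe: "proj e" and qe: "q * e = 0" using e by (simp_all add: copied_in_def)
  obtain v :: "nat \<Rightarrow> 'a endo" where v: "\<And>i. v i \<in> M" "\<And>i. (v i)\<^sup>\<dagger> * v i = e" "\<And>i. q * v i = v i"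
    and orth: "\<And>i j. i \<noteq> j \<Longrightarrow> (v i)\<^sup>\<dagger> * v j = 0"
    using e unfolding copied_in_def by blast
  have pv: "pisom (v i)" for i by (rule pisomI) (simp only: v pe)
  have "\<forall>\<^sub>F i in sequentially. \<forall>\<xi>\<in>S. norm ((v i)\<^sup>\<dagger> \<cdot> \<xi>) < \<epsilon>"
    using S by (rule eventually_ball_finite)
      (intro ballI order_tendstoD(2)[OF orthogonal_ranges_tendsto_zero[of v, OF pv orth] \<epsilon>])
  then obtain i where i: "\<And>\<xi>. \<xi> \<in> S \<Longrightarrow> norm ((v i)\<^sup>\<dagger> \<cdot> \<xi>) < \<epsilon>"
    by (auto simp: eventually_sequentially)
  have eq: "e * q = 0" using arg_cong[OF qe, of dag] projD[OF pe] projD[OF q(1)] by simp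
  have ve: "v i * e = v i" using pisomD(2)[OF pv[of i]] by (simp only: v)
  have edv: "e * (v i)\<^sup>\<dagger> = (v i)\<^sup>\<dagger>" using arg_cong[OF ve, of dag] projD[OF pe] by simp
  have vv: "v i * v i = 0"
  proof -
    have "v i * v i = v i * (e * q) * v i" by (simp only: mult.assoc[symmetric] ve) (simp only: mult.assoc v(3))
    then show ?thesis by (simp add: eq)
  qed
  define u where "u = v i + (v i)\<^sup>\<dagger> + (1 - e - v i * (v i)\<^sup>\<dagger>)"
  have u: "unitary u" using swap_unitary[OF v(1) pv vv] by (simp only: u_def v(2))
  have qdv: "q * (v i)\<^sup>\<dagger> = 0"
  proof -
    have "q * (v i)\<^sup>\<dagger> = q * e * (v i)\<^sup>\<dagger>" by (simp only: mult.assoc edv)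
    then show ?thesis by (simp add: qe)
  qed
  have "(1 - q) * u = (v i)\<^sup>\<dagger> + ((1 - q) - e)"
    by (simp add: u_def left_diff_distrib right_diff_distrib distrib_left v(3) qdv qe mult.assoc[symmetric])
  then have "(1 - q) \<cdot> u \<cdot> \<xi> = (v i)\<^sup>\<dagger> \<cdot> \<xi> + ((1 - q) \<cdot> \<xi> - e \<cdot> \<xi>)" for \<xi>
    by (metis eapp_mult eapp.add_left eapp.diff_left)
  then show ?thesis using that[OF u] i by simp
qed

text \<open>Each copy is chosen for the vectors already moved by \<open>u\<close>, so exchanges can
  follow one another. The earlier error \<open>d\<close> reappears only as
  \<open>d - e \<cdot> d\<close>, which is no longer than \<open>d\<close>, and the errors add
  up.\<close>

lemma remove_components:
  assumes q: "proj q" "q \<in> M" and F: "finite F" "\<And>e. e \<in> F \<Longrightarrow> copied_in q e"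
    "\<And>e e'. e \<in> F \<Longrightarrow> e' \<in> F \<Longrightarrow> e \<noteq> e' \<Longrightarrow> e * e' = 0" and S: "finite S" and \<epsilon>: "0 < \<epsilon>"
  shows "\<exists>u. unitary u \<and> (\<forall>\<xi>\<in>S. norm ((1 - q) \<cdot> u \<cdot> \<xi> - ((1 - q) \<cdot> \<xi> - (\<Sum>e\<in>F. e \<cdot> \<xi>))) < \<epsilon>)"
  using F \<epsilon>
proof (induction F arbitrary: \<epsilon>)
  case empty
  then show ?case by (intro exI[of _ 1]) (simp add: unitary_def)
next
  case (insert e F)
  have e: "copied_in q e" using insert.prems(1) by simp
  have pe: "proj e" and qe: "q * e = 0" using e by (simp_all add: copied_in_def)
  have e2: "0 < \<epsilon> / 2" using insert.prems by simp
  obtain u where u: "unitary u"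
    "\<And>\<xi>. \<xi> \<in> S \<Longrightarrow> norm ((1 - q) \<cdot> u \<cdot> \<xi> - ((1 - q) \<cdot> \<xi> - (\<Sum>e\<in>F. e \<cdot> \<xi>))) < \<epsilon> / 2"
    using insert.IH[OF _ _ e2] insert.prems by auto
  obtain w where w: "unitary w"
    "\<And>\<zeta>. \<zeta> \<in> eapp u ` S \<Longrightarrow> norm ((1 - q) \<cdot> w \<cdot> \<zeta> - ((1 - q) \<cdot> \<zeta> - e \<cdot> \<zeta>)) < \<epsilon> / 2"
    by (rule remove_component[OF q e finite_imageI[OF S] e2]) blast
  have "norm ((1 - q) \<cdot> (w * u) \<cdot> \<xi> - ((1 - q) \<cdot> \<xi> - (\<Sum>e\<in>insert e F. e \<cdot> \<xi>))) < \<epsilon>"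
    if \<xi>: "\<xi> \<in> S" for \<xi>
  proof -
    define d where "d = (1 - q) \<cdot> u \<cdot> \<xi> - ((1 - q) \<cdot> \<xi> - (\<Sum>e\<in>F. e \<cdot> \<xi>))"
    have "e * q = 0" using arg_cong[OF qe, of dag] projD[OF pe] projD[OF q(1)] by simp
    then have "e \<cdot> q \<cdot> \<zeta> = 0" for \<zeta> by (metis eapp_mult eapp.zero_left)
    moreover have "e \<cdot> (\<Sum>e\<in>F. e \<cdot> \<xi>) = 0"
    proof -
      have "e \<cdot> e' \<cdot> \<xi> = 0" if "e' \<in> F" for e'
      proof -
        have "e * e' = 0" using insert.hyps(2) insert.prems(2)[of e e'] that by auto
        then show ?thesis by (metis eapp_mult eapp.zero_left)
      qed
      then show ?thesis by (simp add: eapp.sum_right)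
    qed
    ultimately have ed: "e \<cdot> d = e \<cdot> u \<cdot> \<xi> - e \<cdot> \<xi>"
      by (simp add: d_def eapp.diff_right)
    have "(1 - q) \<cdot> (w * u) \<cdot> \<xi> - ((1 - q) \<cdot> \<xi> - (\<Sum>e\<in>insert e F. e \<cdot> \<xi>))
      = ((1 - q) \<cdot> w \<cdot> u \<cdot> \<xi> - ((1 - q) \<cdot> u \<cdot> \<xi> - e \<cdot> u \<cdot> \<xi>)) + (d - e \<cdot> d)"
      unfolding ed using insert.hyps by (simp add: d_def algebra_simps)
    also have "norm \<dots> \<le> norm ((1 - q) \<cdot> w \<cdot> u \<cdot> \<xi> - ((1 - q) \<cdot> u \<cdot> \<xi> - e \<cdot> u \<cdot> \<xi>)) + norm (d - e \<cdot> d)"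
      by (rule norm_triangle_ineq)
    also have "norm (d - e \<cdot> d) \<le> norm d"
      using norm_proj_app[OF proj_complement[OF pe], of d] by simp
    also have "norm d < \<epsilon> / 2" using u(2)[OF \<xi>] by (simp only: d_def)
    also have "norm ((1 - q) \<cdot> w \<cdot> u \<cdot> \<xi> - ((1 - q) \<cdot> u \<cdot> \<xi> - e \<cdot> u \<cdot> \<xi>)) < \<epsilon> / 2"
      using w(2) \<xi> by blast
    finally show ?thesis by simp
  qed
  then show ?case using unitary_mult[OF w(1) u(1)] by blast
qed

lemma move_vectors_into:
  assumes q: "proj q" "q \<in> M" and inf: "\<And>c. proj c \<Longrightarrow> c \<in> Z \<Longrightarrow> c \<noteq> 0 \<Longrightarrow> \<not> fin (c * q)"
    and S: "finite S" and \<epsilon>: "0 < \<epsilon>"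
  obtains u where "unitary u" "\<And>\<xi>. \<xi> \<in> S \<Longrightarrow> norm ((1 - q) \<cdot> u \<cdot> \<xi>) < \<epsilon>"
proof -
  note qq = projD[OF q(1)]
  obtain V s where V: "V \<subseteq> M" "orth_family V" and s: "sum_of_family V s" "s \<in> M"
    and VQ: "\<And>e. e \<in> V \<Longrightarrow> copied_in q e"
    and max: "\<And>w. w \<in> M \<Longrightarrow> pisom w \<Longrightarrow> copied_in q w \<Longrightarrow> w\<^sup>\<dagger> * s = 0 \<Longrightarrow> w * s\<^sup>\<dagger> = 0 \<Longrightarrow> w = 0"
    by (rule maximal_orth_family[of "copied_in q"]) blast
  have pe: "proj e" if "e \<in> V" for e using VQ[OF that] by (simp add: copied_in_def)
  have ps: "proj s" by (rule family_of_projections_sum[OF V(2) s(1) pe])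
  note ss = projD[OF ps]
  have "q * s = 0 * s"
    by (rule family_sum_eq_left[OF V(2) s(1)]) (use VQ in \<open>simp add: copied_in_def\<close>)
  then have qs: "q * s = 0" by simp
  have sq: "s * q = 0" using arg_cong[OF qs, of dag] qq ss by simp
  define g where "g = (1 - q) - s"
  have g: "proj g" "g \<in> M" unfolding g_def
    using q s ps by (auto intro!: proj_diff proj_complement simp: right_diff_distrib sq)
  note gg = projD[OF g(1)]
  have qg: "q * g = 0" by (simp add: g_def right_diff_distrib qq qs)
  have gs: "g * s = 0" by (simp add: g_def left_diff_distrib qs ss)
  have "g = 0"
  proof (rule ccontr)
    assume "g \<noteq> 0"
    have "\<exists>r\<in>M. r \<noteq> 0 \<and> r * g = r \<and> copied_in q r"
    proof (rule infinite_copies[OF inf q(2,1) g(2) \<open>g \<noteq> 0\<close> g(1)])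
      fix r and u :: "nat \<Rightarrow> 'a endo"
      assume r: "r \<in> M" "proj r" "r \<noteq> 0" "r * g = r" and u: "\<And>i. u i \<in> M" "\<And>i. (u i)\<^sup>\<dagger> * u i = r"
        "\<And>i j. i \<noteq> j \<Longrightarrow> (u i)\<^sup>\<dagger> * u j = 0" "\<And>i. q * u i = u i"
      have gr: "g * r = r" using arg_cong[OF r(4), of dag] gg projD[OF r(2)] by simp
      have "q * r = q * g * r" by (simp only: mult.assoc gr)
      then have qr: "q * r = 0" by (simp only: qg mult_zero_left)
      have "copied_in q r" unfolding copied_in_def
        by (intro conjI exI[of _ u] allI impI r(2) qr u)
      with r show ?thesis by blast
    qed
    then obtain r where r: "r \<in> M" "r \<noteq> 0" "r * g = r" "copied_in q r" by blast
    then have pr: "proj r" by (simp add: copied_in_def)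
    have "r * s = r * (g * s)" by (simp only: mult.assoc[symmetric] r(3))
    then have "r\<^sup>\<dagger> * s = 0" "r * s\<^sup>\<dagger> = 0" using projD[OF pr] ss by (simp_all add: gs)
    then have "r = 0" by (rule max[OF r(1) proj_pisom[OF pr] r(4)])
    with r(2) show False ..
  qed
  then have sq': "s = 1 - q" by (simp add: g_def)
  \<comment> \<open>The family may be uncountable; strong convergence of its sum to
    \<open>1 - q\<close> leaves a finite \<open>F\<close> that is accurate to
    \<open>\<epsilon> / 2\<close> on all of \<open>S\<close>.\<close>
  have "\<forall>\<^sub>F F in finite_subsets_at_top V. \<forall>\<xi>\<in>S. dist (\<Sum>e\<in>F. e \<cdot> \<xi>) (s \<cdot> \<xi>) < \<epsilon> / 2"
    using S
  proof (rule eventually_ball_finite, intro ballI)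
    fix \<xi>
    have "((\<lambda>F. \<Sum>e\<in>F. e \<cdot> \<xi>) \<longlongrightarrow> s \<cdot> \<xi>) (finite_subsets_at_top V)"
      using family_app[OF V(2) s(1), of \<xi>] by (simp add: has_sum_def)
    then show "\<forall>\<^sub>F F in finite_subsets_at_top V. dist (\<Sum>e\<in>F. e \<cdot> \<xi>) (s \<cdot> \<xi>) < \<epsilon> / 2"
      using \<epsilon> by (intro tendstoD) simp_all
  qed
  from this[unfolded eventually_finite_subsets_at_top] obtain F where F: "finite F" "F \<subseteq> V"
    and all: "\<forall>Y. finite Y \<and> F \<subseteq> Y \<and> Y \<subseteq> V \<longrightarrow> (\<forall>\<xi>\<in>S. dist (\<Sum>e\<in>Y. e \<cdot> \<xi>) (s \<cdot> \<xi>) < \<epsilon> / 2)"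
    by (elim exE conjE)
  have F3: "dist (\<Sum>e\<in>F. e \<cdot> \<xi>) (s \<cdot> \<xi>) < \<epsilon> / 2" if "\<xi> \<in> S" for \<xi>
    using all[rule_format, of F \<xi>] F that by simp
  have "\<exists>u. unitary u \<and> (\<forall>\<xi>\<in>S. norm ((1 - q) \<cdot> u \<cdot> \<xi> - ((1 - q) \<cdot> \<xi> - (\<Sum>e\<in>F. e \<cdot> \<xi>))) < \<epsilon> / 2)"
  proof (rule remove_components[OF q F(1) _ _ S])
    show "e * e' = 0" if "e \<in> F" "e' \<in> F" "e \<noteq> e'" for e e'
      using orth_familyD(2)[OF V(2), of e e'] that F(2) projD(1)[OF pe[of e]] by auto
  qed (use F(2) VQ \<epsilon> in auto)
  then obtain u where u: "unitary u"
    "\<And>\<xi>. \<xi> \<in> S \<Longrightarrow> norm ((1 - q) \<cdot> u \<cdot> \<xi> - ((1 - q) \<cdot> \<xi> - (\<Sum>e\<in>F. e \<cdot> \<xi>))) < \<epsilon> / 2" by blast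
  have "norm ((1 - q) \<cdot> u \<cdot> \<xi>) < \<epsilon>" if "\<xi> \<in> S" for \<xi>
    using norm_triangle_sub[of "(1 - q) \<cdot> u \<cdot> \<xi>" "(1 - q) \<cdot> \<xi> - (\<Sum>e\<in>F. e \<cdot> \<xi>)"] u(2)[OF that] F3[OF that]
    by (simp add: sq' dist_norm norm_minus_commute)
  with u(1) show ?thesis by (rule that)
qed

section \<open>The counting argument against left inverses modulo finite projections\<close>

lemma no_left_inverse_mod_finite:
  assumes inf: "\<And>c. proj c \<Longrightarrow> c \<in> Z \<Longrightarrow> c \<noteq> 0 \<Longrightarrow> \<not> fin c"
    and e: "proj e" "e \<in> Z" "e \<noteq> 0" and xy: "x \<in> M" "y \<in> M"
    and J: "finite J" "\<And>j. j \<in> J \<Longrightarrow> a j \<in> M \<and> fin (p j) \<and> b j \<in> M"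
    and near: "norm (e * (1 - y * x - (\<Sum>j\<in>J. a j * p j * b j))) \<le> 1 / 2"
    and small: "\<And>S \<epsilon>. finite S \<Longrightarrow> 0 < \<epsilon> \<Longrightarrow> \<exists>u. unitary u \<and> (\<forall>\<xi>\<in>S. norm (x \<cdot> u \<cdot> \<xi>) < \<epsilon>)"
  shows False
proof -
  define k where "k = (\<Sum>j\<in>J. a j * p j * b j)"
  obtain \<xi> B where \<xi>: "\<And>i::nat. norm (\<xi> i) = 1" "\<And>i. e \<cdot> \<xi> i = \<xi> i" and B0: "0 \<le> B"
    and B: "\<And>q b N. q \<in> p ` J \<Longrightarrow> b \<in> M \<Longrightarrow> (\<Sum>i<N. (norm (q \<cdot> b \<cdot> \<xi> i))\<^sup>2) \<le> B * (norm b)\<^sup>2"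
    by (rule essential_vectors[OF inf e, of "p ` J"]) (use J in auto)
  \<comment> \<open>The bound must not depend on \<open>u\<close>: the unitary is absorbed into the
    coefficient, since \<open>b j * u\<close> has norm at most that of \<open>b j\<close>. The
    factors \<open>2\<close> come from
    \<open>(s + t)\<^sup>2 \<le> 2 * s\<^sup>2 + 2 * t\<^sup>2\<close>.\<close>
  have "\<exists>C. \<forall>u N. unitary u \<longrightarrow> (\<Sum>i<N. (norm ((\<Sum>j\<in>J. a j * p j * b j) \<cdot> u \<cdot> \<xi> i))\<^sup>2) \<le> C"
    using J B
  proof (induction J)
    case (insert j J)
    let ?k = "\<Sum>j\<in>J. a j * p j * b j"
    have "\<exists>C. \<forall>u N. unitary u \<longrightarrow> (\<Sum>i<N. (norm (?k \<cdot> u \<cdot> \<xi> i))\<^sup>2) \<le> C"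
      by (rule insert.IH) (use insert.prems in auto)
    then obtain C where C: "\<And>u N. unitary u \<Longrightarrow> (\<Sum>i<N. (norm (?k \<cdot> u \<cdot> \<xi> i))\<^sup>2) \<le> C" by blast
    let ?D = "(norm (a j))\<^sup>2 * (B * (norm (b j))\<^sup>2)"
    have "(\<Sum>i<N. (norm ((\<Sum>j\<in>insert j J. a j * p j * b j) \<cdot> u \<cdot> \<xi> i))\<^sup>2) \<le> 2 * ?D + 2 * C"
      if u: "unitary u" for u N
    proof -
      have bu: "b j * u \<in> M" using insert.prems(1) u by (auto simp: unitary_def)
      have nbu: "norm (b j * u) \<le> norm (b j)"
      proof -
        have "norm u \<le> 1" by (rule norm_endo_bound) (simp_all add: norm_unitary_app[OF u])
        then show ?thesis using norm_mult_ineq[of "b j" u] mult_left_le[of "norm u" "norm (b j)"] by simp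
      qed
      have "(norm ((\<Sum>j\<in>insert j J. a j * p j * b j) \<cdot> u \<cdot> \<xi> i))\<^sup>2
        \<le> 2 * ((norm (a j))\<^sup>2 * (norm (p j \<cdot> (b j * u) \<cdot> \<xi> i))\<^sup>2) + 2 * (norm (?k \<cdot> u \<cdot> \<xi> i))\<^sup>2" for i
      proof -
        have "norm ((\<Sum>j\<in>insert j J. a j * p j * b j) \<cdot> u \<cdot> \<xi> i)
          \<le> norm (a j \<cdot> p j \<cdot> b j \<cdot> u \<cdot> \<xi> i) + norm (?k \<cdot> u \<cdot> \<xi> i)"
          using insert.hyps by (simp add: norm_triangle_ineq)
        also have "\<dots> \<le> norm (a j) * norm (p j \<cdot> (b j * u) \<cdot> \<xi> i) + norm (?k \<cdot> u \<cdot> \<xi> i)"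
          by (simp add: norm_eapp)
        finally have "(norm ((\<Sum>j\<in>insert j J. a j * p j * b j) \<cdot> u \<cdot> \<xi> i))\<^sup>2
          \<le> (norm (a j) * norm (p j \<cdot> (b j * u) \<cdot> \<xi> i) + norm (?k \<cdot> u \<cdot> \<xi> i))\<^sup>2" by (rule power_mono) simp
        also have "\<dots> \<le> 2 * (norm (a j) * norm (p j \<cdot> (b j * u) \<cdot> \<xi> i))\<^sup>2 + 2 * (norm (?k \<cdot> u \<cdot> \<xi> i))\<^sup>2"
          using sum_squares_bound[of "norm (a j) * norm (p j \<cdot> (b j * u) \<cdot> \<xi> i)" "norm (?k \<cdot> u \<cdot> \<xi> i)"]
          by (simp only: power2_sum)
        finally show ?thesis by (simp add: power_mult_distrib)
      qed
      then have "(\<Sum>i<N. (norm ((\<Sum>j\<in>insert j J. a j * p j * b j) \<cdot> u \<cdot> \<xi> i))\<^sup>2)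
        \<le> (\<Sum>i<N. 2 * ((norm (a j))\<^sup>2 * (norm (p j \<cdot> (b j * u) \<cdot> \<xi> i))\<^sup>2) + 2 * (norm (?k \<cdot> u \<cdot> \<xi> i))\<^sup>2)"
        by (rule sum_mono)
      also have "\<dots> = 2 * ((norm (a j))\<^sup>2 * (\<Sum>i<N. (norm (p j \<cdot> (b j * u) \<cdot> \<xi> i))\<^sup>2)) + 2 * (\<Sum>i<N. (norm (?k \<cdot> u \<cdot> \<xi> i))\<^sup>2)"
        by (simp only: sum.distrib sum_distrib_left)
      also have "\<dots> \<le> 2 * ?D + 2 * C"
      proof (intro add_mono mult_left_mono)
        have "(\<Sum>i<N. (norm (p j \<cdot> (b j * u) \<cdot> \<xi> i))\<^sup>2) \<le> B * (norm (b j * u))\<^sup>2"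
          by (rule insert.prems(2)[OF _ bu]) simp
        also have "\<dots> \<le> B * (norm (b j))\<^sup>2" using nbu B0 by (intro mult_left_mono power_mono) simp_all
        finally show "(\<Sum>i<N. (norm (p j \<cdot> (b j * u) \<cdot> \<xi> i))\<^sup>2) \<le> B * (norm (b j))\<^sup>2" .
      qed (simp_all add: C[OF u])
      finally show ?thesis .
    qed
    then show ?case by blast
  qed (auto intro: exI[of _ 0])
  then obtain C where C: "\<And>u N. unitary u \<Longrightarrow> (\<Sum>i<N. (norm (k \<cdot> u \<cdot> \<xi> i))\<^sup>2) \<le> C"
    unfolding k_def by blast
  \<comment> \<open>\<open>16\<close> is the inverse square of \<open>1 / 4\<close>, the lower bound
    to be shown for every \<open>norm (k \<cdot> u \<cdot> \<xi> i)\<close>.\<close>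
  obtain N :: nat where N: "16 * C < real N" using reals_Archimedean2 by blast
  \<comment> \<open>Makes \<open>norm y * \<epsilon>\<close> at most \<open>1 / 4\<close>; the added
    \<open>1\<close> covers \<open>y = 0\<close>.\<close>
  define \<epsilon> where "\<epsilon> = 1 / (4 * (norm y + 1))"
  have y1: "0 < norm y + 1" by (simp add: add_nonneg_pos)
  then have \<epsilon>: "0 < \<epsilon>" by (simp add: \<epsilon>_def)
  have "norm y * \<epsilon> \<le> (norm y + 1) * \<epsilon>" using \<epsilon> by (intro mult_right_mono) simp_all
  also have "\<dots> = 1 / 4" using y1 by (simp add: \<epsilon>_def)
  finally have y\<epsilon>: "norm y * \<epsilon> \<le> 1 / 4" .
  obtain u where u: "unitary u" "\<And>i. i < N \<Longrightarrow> norm (x \<cdot> u \<cdot> \<xi> i) < \<epsilon>"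
    using small[OF finite_imageI[OF finite_lessThan] \<epsilon>, of \<xi> N] by blast
  have "1 / 4 \<le> norm (k \<cdot> u \<cdot> \<xi> i)" if i: "i < N" for i
  proof -
    define \<zeta> where "\<zeta> = u \<cdot> \<xi> i"
    have \<zeta>: "norm \<zeta> = 1" using norm_unitary_app[OF u(1)] \<xi>(1) by (simp add: \<zeta>_def)
    have "e * u = u * e" by (rule Z_commute[OF e(2)]) (use u in \<open>simp add: unitary_def\<close>)
    then have e\<zeta>: "e \<cdot> \<zeta> = \<zeta>" unfolding \<zeta>_def using \<xi>(2) by (metis eapp_mult)
    \<comment> \<open>A unit vector under \<open>e\<close> splits into three parts; the first is at
      most \<open>1 / 2\<close>, the second at most \<open>1 / 4\<close>, so at least
      \<open>1 / 4\<close> is left for \<open>k\<close>.\<close>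
    have "\<zeta> = (e * (1 - y * x - k)) \<cdot> \<zeta> + (e \<cdot> y \<cdot> x \<cdot> \<zeta> + e \<cdot> k \<cdot> \<zeta>)"
      by (simp add: eapp.diff_right e\<zeta>)
    then have "norm \<zeta> \<le> norm ((e * (1 - y * x - k)) \<cdot> \<zeta>) + (norm (e \<cdot> y \<cdot> x \<cdot> \<zeta>) + norm (e \<cdot> k \<cdot> \<zeta>))"
      by (metis norm_triangle_ineq norm_triangle_le add_left_mono)
    moreover have "norm ((e * (1 - y * x - k)) \<cdot> \<zeta>) \<le> 1 / 2"
      using norm_eapp[of "e * (1 - y * x - k)" \<zeta>] near by (simp only: \<zeta> k_def)
    moreover have "norm (e \<cdot> k \<cdot> \<zeta>) \<le> norm (k \<cdot> \<zeta>)" by (rule norm_proj_app[OF e(1)])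
    moreover have "norm (e \<cdot> y \<cdot> x \<cdot> \<zeta>) \<le> 1 / 4"
    proof -
      have "norm (e \<cdot> y \<cdot> x \<cdot> \<zeta>) \<le> norm (y \<cdot> x \<cdot> \<zeta>)" by (rule norm_proj_app[OF e(1)])
      also have "\<dots> \<le> norm y * norm (x \<cdot> \<zeta>)" by (rule norm_eapp)
      also have "\<dots> \<le> norm y * \<epsilon>" using u(2)[OF i] by (intro mult_left_mono) (simp_all add: \<zeta>_def)
      finally show ?thesis using y\<epsilon> by simp
    qed
    ultimately show ?thesis using \<zeta> by (simp add: \<zeta>_def)
  qed
  then have "(\<Sum>i<N. (1 / 4)\<^sup>2) \<le> (\<Sum>i<N. (norm (k \<cdot> u \<cdot> \<xi> i))\<^sup>2)"
    by (intro sum_mono power_mono) simp_all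
  then have "real N / 16 \<le> C" using C[OF u(1), of N] by (simp add: power2_eq_square)
  with N show False by simp
qed

end

section \<open>Ideals of operator algebras\<close>

text \<open>Zorn's lemma on the ideals that omit the unit; this form of properness passes to unions
  of chains.\<close>

lemma exists_maximalideal:
  assumes R: "ring R" and I: "ideal I R" "\<one>\<^bsub>R\<^esub> \<notin> I"
  obtains J where "maximalideal J R" "I \<subseteq> J"
proof -
  interpret ring R by (rule R)
  define \<F> where "\<F> = {J. ideal J R \<and> I \<subseteq> J \<and> \<one>\<^bsub>R\<^esub> \<notin> J}"
  have "\<exists>J\<in>\<F>. \<forall>X\<in>\<F>. J \<subseteq> X \<longrightarrow> X = J"
  proof (rule subset_Zorn_nonempty)
    show "\<F> \<noteq> {}" using I by (auto simp: \<F>_def)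
    fix C assume C: "C \<noteq> {}" "subset.chain \<F> C"
    then have "subset.chain {J. ideal J R} C" by (auto simp: subset_chain_def \<F>_def)
    then have "ideal (\<Union>C) R" using chain_Union_is_ideal[of C] C(1) by simp
    then show "\<Union>C \<in> \<F>" using C by (auto simp: subset_chain_def \<F>_def)
  qed
  then obtain J where J: "J \<in> \<F>" and max: "\<forall>X\<in>\<F>. J \<subseteq> X \<longrightarrow> X = J" ..
  have iJ: "ideal J R" "I \<subseteq> J" "\<one>\<^bsub>R\<^esub> \<notin> J" using J by (simp_all add: \<F>_def)
  have "maximalideal J R"
  proof (rule maximalidealI[OF iJ(1)])
    show "carrier R \<noteq> J" using iJ(3) by auto
    fix X assume X: "ideal X R" "J \<subseteq> X" "X \<subseteq> carrier R"
    show "X = J \<or> X = carrier R"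
    proof (cases "\<one>\<^bsub>R\<^esub> \<in> X")
      case True
      then show ?thesis using ideal.one_imp_carrier[OF X(1)] by simp
    next
      case False
      then have "X \<in> \<F>" using X iJ(2) by (auto simp: \<F>_def)
      then show ?thesis using max X(2) by blast
    qed
  qed
  then show ?thesis using that iJ(2) by blast
qed

lemma left_invertible_quotient_iff:
  assumes R: "ring R" and I: "ideal I R" and x: "x \<in> carrier R"
  shows "left_invertible (R Quot I) (I +>\<^bsub>R\<^esub> x) \<longleftrightarrow> (\<exists>y\<in>carrier R. \<one>\<^bsub>R\<^esub> \<ominus>\<^bsub>R\<^esub> y \<otimes>\<^bsub>R\<^esub> x \<in> I)"
proof -
  interpret ideal I R by (rule I)
  have "left_invertible (R Quot I) (I +>\<^bsub>R\<^esub> x) \<longleftrightarrow>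
      (\<exists>y\<in>carrier R. I +>\<^bsub>R\<^esub> (y \<otimes>\<^bsub>R\<^esub> x) = I +>\<^bsub>R\<^esub> \<one>\<^bsub>R\<^esub>)"
    using x by (auto simp: left_invertible_def FactRing_def A_RCOSETS_def' rcoset_mult_add)
  also have "\<dots> \<longleftrightarrow> (\<exists>y\<in>carrier R. I +>\<^bsub>R\<^esub> \<one>\<^bsub>R\<^esub> = I +>\<^bsub>R\<^esub> (y \<otimes>\<^bsub>R\<^esub> x))" by (simp only: eq_commute)
  also have "\<dots> \<longleftrightarrow> (\<exists>y\<in>carrier R. \<one>\<^bsub>R\<^esub> \<ominus>\<^bsub>R\<^esub> y \<otimes>\<^bsub>R\<^esub> x \<in> I)"
    using x quotient_eq_iff_same_a_r_cos[OF I] by auto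
  finally show ?thesis .
qed

lemma op_ring_simps:
  "carrier (op_ring A) = A" "mult (op_ring A) = (o\<^sub>L)" "one (op_ring A) = id_blinfun"
  "ring.zero (op_ring A) = 0" "ring.add (op_ring A) = (+)"
  by (simp_all add: op_ring_def)

lemma op_ring_uminus:
  assumes "ring (op_ring A)" "x \<in> A" "- x \<in> A"
  shows "\<ominus>\<^bsub>op_ring A\<^esub> x = - x"
  by (rule abelian_group.minus_equality[OF ring.is_abelian_group[OF assms(1)]])
    (use assms in \<open>simp_all add: op_ring_simps\<close>)

lemma op_ring_idealI:
  fixes I A :: "('a::complex_hilbert \<Rightarrow>\<^sub>L 'a) set"
  assumes A: "ring (op_ring A)" and I: "I \<subseteq> A" "0 \<in> I"
    and add: "\<And>x y. x \<in> I \<Longrightarrow> y \<in> I \<Longrightarrow> x + y \<in> I" and neg: "\<And>x. x \<in> I \<Longrightarrow> - x \<in> I"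
    and l: "\<And>a x. x \<in> I \<Longrightarrow> a \<in> A \<Longrightarrow> a o\<^sub>L x \<in> I" and r: "\<And>a x. x \<in> I \<Longrightarrow> a \<in> A \<Longrightarrow> x o\<^sub>L a \<in> I"
  shows "ideal I (op_ring A)"
proof (rule idealI[OF A])
  show "subgroup I (add_monoid (op_ring A))"
  proof (rule subgroup.intro)
    show "inv\<^bsub>add_monoid (op_ring A)\<^esub> x \<in> I" if "x \<in> I" for x
    proof -
      have "x \<in> A" "- x \<in> A" using that I neg by blast+
      then have "inv\<^bsub>add_monoid (op_ring A)\<^esub> x = - x" using op_ring_uminus[OF A] by (simp only: a_inv_def)
      then show ?thesis using neg[OF that] by (simp only:)
    qed
  qed (use I add in \<open>auto simp: op_ring_simps\<close>)
qed (use l r in \<open>simp_all add: op_ring_simps\<close>)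

lemma op_ring_ideal_closed:
  assumes "ideal I (op_ring A)"
  shows "I \<subseteq> A" "x \<in> I \<Longrightarrow> y \<in> I \<Longrightarrow> x + y \<in> I" "x \<in> I \<Longrightarrow> a \<in> A \<Longrightarrow> a o\<^sub>L x \<in> I"
    "x \<in> I \<Longrightarrow> a \<in> A \<Longrightarrow> x o\<^sub>L a \<in> I" "0 \<in> I"
proof -
  interpret ideal I "op_ring A" by fact
  show "I \<subseteq> A" "x \<in> I \<Longrightarrow> y \<in> I \<Longrightarrow> x + y \<in> I" "x \<in> I \<Longrightarrow> a \<in> A \<Longrightarrow> a o\<^sub>L x \<in> I"
    "x \<in> I \<Longrightarrow> a \<in> A \<Longrightarrow> x o\<^sub>L a \<in> I" "0 \<in> I"
    using a_subset additive_subgroup.a_closed[OF additive_subgroup_axioms, of x y]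
      I_l_closed[of x a] I_r_closed[of x a] additive_subgroup.zero_closed[OF additive_subgroup_axioms]
    by (simp_all add: op_ring_simps)
qed

section \<open>Complex von Neumann algebras as commutants\<close>

lemma eapp_Endo [simp]: "Endo a \<cdot> x = blinfun_apply a x"
  by (simp add: eapp.rep_eq Endo_inverse)

lemma Endo_compose: "Endo (a o\<^sub>L b) = Endo a * Endo b"
  by (rule endo_eqI) simp

lemma Endo_add: "Endo (a + b) = Endo a + Endo b"
  by (rule endo_eqI) (simp add: blinfun.add_left)

lemma Endo_diff: "Endo (a - b) = Endo a - Endo b"
  by (rule endo_eqI) (simp add: blinfun.diff_left)

lemma Endo_minus: "Endo (- a) = - Endo a"
  by (rule endo_eqI) (simp add: blinfun.minus_left)

lemma Endo_zero: "Endo 0 = 0" and Endo_id: "Endo id_blinfun = 1"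
  by (rule endo_eqI, simp)+

lemma norm_Endo: "norm (Endo a) = norm a"
  by (simp add: norm_endo.rep_eq Endo_inverse)

lemmas Endo_simps = Endo_compose Endo_add Endo_diff Endo_minus Endo_zero Endo_id

lemma Endo_eq_iff: "Endo a = Endo b \<longleftrightarrow> a = b"
  by (simp add: Endo_inject)

lemma Endo_image_iff: "Endo a \<in> Endo ` A \<longleftrightarrow> a \<in> A"
  by (auto simp: Endo_eq_iff)

lemma Endo_sum: "Endo (sum f A) = (\<Sum>i\<in>A. Endo (f i))"
  by (induction A rule: infinite_finite_induct) (simp_all add: Endo_simps)

lemma bounded_linear_Endo: "bounded_linear Endo"
proof (rule bounded_linear_intro[where K = 1])
  show "Endo (r *\<^sub>R a) = r *\<^sub>R Endo a" for r and a :: "'a \<Rightarrow>\<^sub>L 'a"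
    by (rule endo_eqI) (simp add: blinfun.scaleR_left)
qed (simp_all add: Endo_add norm_Endo)

text \<open>Complex scalars as real-linear operators; commuting with all of them expresses complex
  linearity (\<open>bounded_ops_iff\<close>).\<close>

definition scal :: "complex \<Rightarrow> 'a::complex_hilbert endo" where
  "scal c = endo_of (scaleC c)"

lemma scal_app [simp]: "scal c \<cdot> x = scaleC c x"
proof -
  have norm: "norm (scaleC c x) = cmod c * norm x" for x :: 'a
  proof -
    have "(norm (scaleC c x))\<^sup>2 = Re (cnj c * (c * cinner x x))"
      by (simp only: power2_norm_eq_inner Re_cinner[symmetric] cinner_scaleC_left cinner_scaleC_right)
    also have "cnj c * (c * cinner x x) = complex_of_real ((cmod c)\<^sup>2) * cinner x x"
      by (simp only: mult.assoc[symmetric] complex_norm_square mult.commute[of c "cnj c"])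
    also have "Re \<dots> = (cmod c)\<^sup>2 * (norm x)\<^sup>2"
      by (simp add: Re_cinner power2_norm_eq_inner)
    finally have "(norm (scaleC c x))\<^sup>2 = (cmod c * norm x)\<^sup>2" by (simp add: power_mult_distrib)
    then show ?thesis by (simp add: power2_eq_iff_nonneg)
  qed
  have "bounded_linear (scaleC c :: 'a \<Rightarrow> 'a)"
  proof (rule bounded_linear_intro[where K = "cmod c"])
    show "scaleC c (r *\<^sub>R y) = r *\<^sub>R scaleC c y" for r and y :: 'a
      by (simp only: scaleC_of_real[symmetric] scaleC_scaleC mult.commute)
  qed (simp_all add: scaleC_add_right norm)
  then show ?thesis by (simp add: scal_def eapp_endo_of)
qed

lemma scal_dag: "(scal c)\<^sup>\<dagger> = scal (cnj c)"
  by (rule dag_unique) (simp add: Re_cinner[symmetric] cinner_scaleC_left cinner_scaleC_right)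

lemma bounded_ops_iff: "a \<in> bounded_ops \<longleftrightarrow> (\<forall>c. Endo a * scal c = scal c * Endo a)"
proof
  show "a \<in> bounded_ops \<Longrightarrow> \<forall>c. Endo a * scal c = scal c * Endo a"
    by (auto simp: bounded_ops_def intro!: endo_eqI)
  assume "\<forall>c. Endo a * scal c = scal c * Endo a"
  then have "(Endo a * scal c) \<cdot> x = (scal c * Endo a) \<cdot> x" for c x by simp
  then show "a \<in> bounded_ops" by (simp add: bounded_ops_def)
qed

lemma dag_Endo:
  assumes "a \<in> bounded_ops"
  shows "(Endo a)\<^sup>\<dagger> = Endo (adj a)"
  by (rule dag_unique) (simp add: Re_cinner[symmetric] cinner_adj[OF assms])

lemma adj_bounded_ops:
  assumes a: "a \<in> bounded_ops"
  shows "adj a \<in> bounded_ops"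
  unfolding bounded_ops_iff dag_Endo[OF a, symmetric]
proof
  fix c
  have "(Endo a * scal (cnj c))\<^sup>\<dagger> = (scal (cnj c) * Endo a)\<^sup>\<dagger>"
    using a by (simp only: bounded_ops_iff)
  then show "(Endo a)\<^sup>\<dagger> * scal c = scal c * (Endo a)\<^sup>\<dagger>" by (simp add: scal_dag)
qed

locale complex_vn_algebra =
  fixes N :: "('a::complex_hilbert \<Rightarrow>\<^sub>L 'a) set"
  assumes vn: "von_neumann_algebra N"
begin

lemma adj_N: "a \<in> N \<Longrightarrow> adj a \<in> N" and N_eq: "commutant (commutant N) = N"
  using vn by (auto simp: von_neumann_algebra_def)

lemma N_bounded: "a \<in> N \<Longrightarrow> a \<in> bounded_ops"
  using N_eq by (auto simp: commutant_def)

lemma adj_commutant: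
  assumes b: "b \<in> commutant N"
  shows "adj b \<in> commutant N"
proof -
  have bb: "b \<in> bounded_ops" using b by (simp add: commutant_def)
  have "Endo (a o\<^sub>L adj b) = Endo (adj b o\<^sub>L a)" if a: "a \<in> N" for a
  proof -
    have "adj a o\<^sub>L b = b o\<^sub>L adj a" using b adj_N[OF a] by (simp add: commutant_def)
    then have "(Endo (adj a) * Endo b)\<^sup>\<dagger> = (Endo b * Endo (adj a))\<^sup>\<dagger>"
      by (simp only: Endo_compose[symmetric])
    then show ?thesis
      by (simp add: dag_Endo[OF bb] dag_Endo[OF N_bounded[OF a], symmetric] Endo_compose)
  qed
  then show ?thesis using adj_bounded_ops[OF bb] by (simp add: commutant_def Endo_eq_iff)
qed

sublocale commutant_algebra "range scal \<union> Endo ` commutant N" "Endo ` N"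
proof
  fix t assume "t \<in> range scal \<union> Endo ` commutant N"
  then show "t\<^sup>\<dagger> \<in> range scal \<union> Endo ` commutant N"
  proof
    assume "t \<in> Endo ` commutant N"
    then obtain b where b: "t = Endo b" "b \<in> commutant N" by blast
    then have "t\<^sup>\<dagger> = Endo (adj b)" by (simp add: dag_Endo commutant_def)
    then show ?thesis using adj_commutant[OF b(2)] by blast
  qed (auto simp: scal_dag)
next
  have "x \<in> Endo ` N \<longleftrightarrow> (\<forall>t\<in>range scal \<union> Endo ` commutant N. x * t = t * x)" for x
  proof -
    obtain a where x: "x = Endo a" by (metis blinfun_of_endo_inverse)
    have "a \<in> N \<longleftrightarrow> a \<in> commutant (commutant N)" by (simp only: N_eq)
    also have "\<dots> \<longleftrightarrow> a \<in> bounded_ops \<and> (\<forall>b\<in>commutant N. b o\<^sub>L a = a o\<^sub>L b)"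
      by (simp only: commutant_def[of "commutant N"] mem_Collect_eq)
    also have "\<dots> \<longleftrightarrow> (\<forall>t\<in>range scal \<union> Endo ` commutant N. x * t = t * x)"
      by (simp only: bounded_ops_iff ball_Un ball_simps x Endo_compose[symmetric] Endo_eq_iff eq_commute[of "_ o\<^sub>L a"])
    finally show ?thesis by (simp add: x Endo_image_iff)
  qed
  then show "Endo ` N = {x. \<forall>t\<in>range scal \<union> Endo ` commutant N. x * t = t * x}" by blast
qed

lemma dag_Endo_N: "a \<in> N \<Longrightarrow> (Endo a)\<^sup>\<dagger> = Endo (adj a)"
  by (rule dag_Endo[OF N_bounded])

lemma Endo_N: "Endo a \<in> Endo ` N \<longleftrightarrow> a \<in> N"
  by (rule Endo_image_iff)

lemma N_add: "a \<in> N \<Longrightarrow> b \<in> N \<Longrightarrow> a + b \<in> N" and N_diff: "a \<in> N \<Longrightarrow> b \<in> N \<Longrightarrow> a - b \<in> N"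
  and N_minus: "a \<in> N \<Longrightarrow> - a \<in> N" and N_mult: "a \<in> N \<Longrightarrow> b \<in> N \<Longrightarrow> a o\<^sub>L b \<in> N"
  and N_zero: "0 \<in> N" and N_id: "id_blinfun \<in> N"
  unfolding Endo_N[symmetric] by (simp_all add: Endo_simps del: image_eqI)

lemma center_iff: "z \<in> center N \<longleftrightarrow> Endo z \<in> Z"
proof -
  have "z \<in> center N \<longleftrightarrow> z \<in> N \<and> (\<forall>a\<in>N. Endo a * Endo z = Endo z * Endo a)"
    by (simp only: center_def mem_Collect_eq Endo_compose[symmetric] Endo_eq_iff)
  also have "\<dots> \<longleftrightarrow> Endo z \<in> Z"
    unfolding Z_def mem_Collect_eq Endo_N ball_simps by (simp only: eq_commute)
  finally show ?thesis .
qed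

lemma projections_iff: "p \<in> projections N \<longleftrightarrow> p \<in> N \<and> proj (Endo p)"
  by (auto simp: projections_def proj_def dag_Endo_N Endo_eq_iff Endo_compose[symmetric])

text \<open>The witnesses run in opposite directions: one definition maps a subprojection onto
  \<open>p\<close>, the other maps \<open>p\<close> into itself. Taking adjoints exchanges
  them.\<close>

lemma finite_projection_iff: "finite_projection N p \<longleftrightarrow> fin (Endo p)"
proof -
  have "finite_projection N p \<longleftrightarrow> p \<in> N \<and> proj (Endo p) \<and>
    (\<forall>q\<in>projections N. q o\<^sub>L p = q \<and> (\<exists>v\<in>N. adj v o\<^sub>L v = q \<and> v o\<^sub>L adj v = p) \<longrightarrow> q = p)"
    by (simp add: finite_projection_def projections_iff mvn_equiv_def)
  also have "\<dots> \<longleftrightarrow> fin (Endo p)"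
  proof
    assume p: "p \<in> N \<and> proj (Endo p) \<and>
      (\<forall>q\<in>projections N. q o\<^sub>L p = q \<and> (\<exists>v\<in>N. adj v o\<^sub>L v = q \<and> v o\<^sub>L adj v = p) \<longrightarrow> q = p)"
    show "fin (Endo p)" unfolding fin_def
    proof (intro conjI ballI impI)
      fix v assume "v \<in> Endo ` N" and v: "v\<^sup>\<dagger> * v = Endo p \<and> v * v\<^sup>\<dagger> * Endo p = v * v\<^sup>\<dagger>"
      then obtain w where w: "w \<in> N" "v = Endo w" by blast
      note aw = adj_N[OF w(1)]
      have vd: "v\<^sup>\<dagger> = Endo (adj w)" by (simp add: w dag_Endo_N)
      have waw: "Endo (w o\<^sub>L adj w) = v * v\<^sup>\<dagger>" by (simp add: w(2) vd[unfolded w(2)] Endo_compose)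
      have aww: "adj w o\<^sub>L w = p" using v by (simp add: vd w(2)[symmetric] flip: Endo_eq_iff) (simp add: Endo_compose w(2) vd[unfolded w(2)])
      have adjadj: "adj (adj w) = w"
        using dag_Endo_N[OF aw] vd w(2) by (metis Endo_eq_iff dag_dag)
      have "pisom v" by (rule pisomI) (use v p in simp)
      then have "w o\<^sub>L adj w \<in> projections N"
        using pisom_final[of v] w(1) aw by (simp add: projections_iff N_mult waw)
      moreover have "(w o\<^sub>L adj w) o\<^sub>L p = w o\<^sub>L adj w"
        unfolding Endo_eq_iff[symmetric] Endo_compose[of "w o\<^sub>L adj w"] waw using v by simp
      moreover have "\<exists>v\<in>N. adj v o\<^sub>L v = w o\<^sub>L adj w \<and> v o\<^sub>L adj v = p"
        by (rule bexI[OF _ aw]) (simp add: adjadj aww)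
      ultimately have "w o\<^sub>L adj w = p" using p by blast
      then show "v * v\<^sup>\<dagger> = Endo p" using waw by simp
    qed (use p in \<open>simp_all add: Endo_N\<close>)
  next
    assume p: "fin (Endo p)"
    show "p \<in> N \<and> proj (Endo p) \<and>
      (\<forall>q\<in>projections N. q o\<^sub>L p = q \<and> (\<exists>v\<in>N. adj v o\<^sub>L v = q \<and> v o\<^sub>L adj v = p) \<longrightarrow> q = p)"
    proof (intro conjI ballI impI)
      fix q assume q: "q o\<^sub>L p = q \<and> (\<exists>v\<in>N. adj v o\<^sub>L v = q \<and> v o\<^sub>L adj v = p)"
      then obtain v where v: "v \<in> N" "adj v o\<^sub>L v = q" "v o\<^sub>L adj v = p" by blast
      define w where "w = (Endo v)\<^sup>\<dagger>"
      have w: "w = Endo (adj v)" "w\<^sup>\<dagger> = Endo v" unfolding w_def by (rule dag_Endo_N[OF v(1)], rule dag_dag)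
      have "w * w\<^sup>\<dagger> = Endo p"
      proof (rule finD(3)[OF p])
        show "w \<in> Endo ` N" using adj_N[OF v(1)] by (simp add: w(1))
        show "w\<^sup>\<dagger> * w = Endo p" unfolding w(2) unfolding w(1) using v(3) by (simp only: Endo_compose[symmetric])
        show "w * w\<^sup>\<dagger> * Endo p = w * w\<^sup>\<dagger>" unfolding w(2) unfolding w(1) using v(2) q
          by (simp only: Endo_compose[symmetric])
      qed
      then show "q = p" unfolding w(2) unfolding w(1) using v(2) by (simp only: Endo_compose[symmetric] Endo_eq_iff)
    qed (use finD[OF p] in \<open>simp_all only: Endo_N\<close>)
  qed
  finally show ?thesis .
qed

lemma unitaries_iff: "u \<in> unitaries N \<longleftrightarrow> unitary (Endo u)"
proof -
  have "u \<in> unitaries N \<longleftrightarrow> u \<in> N \<and> Endo (adj u) * Endo u = 1 \<and> Endo u * Endo (adj u) = 1"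
    by (simp add: unitaries_def Endo_compose[symmetric] Endo_id[symmetric] Endo_eq_iff)
  then show ?thesis by (auto simp: unitary_def Endo_N dag_Endo_N)
qed

lemma closed_N: "closed N"
proof -
  have "N = (\<Inter>t\<in>range scal \<union> Endo ` commutant N. {a. Endo a * t = t * Endo a})"
    using M_eq Endo_N by auto
  moreover have "closed {a. Endo a * t = t * Endo a}" for t :: "'a endo"
    by (intro closed_Collect_eq continuous_intros linear_continuous_on bounded_linear_Endo)
  ultimately show ?thesis by (metis (no_types, lifting) closed_INT)
qed

lemma ring_N: "ring (op_ring N)"
  by (rule ring_op_ring[OF vn])

section \<open>Norm-closed ideals and approximation by finite sums\<close>

lemma ideal_closed_ideal_generated:
  assumes "S \<subseteq> N"
  shows "ideal (closed_ideal_generated N S) (op_ring N)"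
  unfolding closed_ideal_generated_def
proof (rule ring.i_Intersect[OF ring_N])
  have "N \<in> {I. ideal I (op_ring N) \<and> closed I \<and> S \<subseteq> I}"
    using ring.oneideal[OF ring_N] closed_N assms by (simp add: op_ring_simps)
  then show "{I. ideal I (op_ring N) \<and> closed I \<and> S \<subseteq> I} \<noteq> {}" by blast
qed simp

definition ideal_sum :: "(('a \<Rightarrow>\<^sub>L 'a) \<times> ('a \<Rightarrow>\<^sub>L 'a) \<times> ('a \<Rightarrow>\<^sub>L 'a)) list \<Rightarrow> 'a \<Rightarrow>\<^sub>L 'a" where
  "ideal_sum ts = (\<Sum>(a, s, b)\<leftarrow>ts. a o\<^sub>L s o\<^sub>L b)"

definition ideal_sums :: "('a \<Rightarrow>\<^sub>L 'a) set \<Rightarrow> ('a \<Rightarrow>\<^sub>L 'a) set" where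
  "ideal_sums S = ideal_sum ` lists (N \<times> S \<times> N)"

interpretation comp: bounded_bilinear "(o\<^sub>L) :: ('a \<Rightarrow>\<^sub>L 'a) \<Rightarrow> ('a \<Rightarrow>\<^sub>L 'a) \<Rightarrow> _"
  by (rule bounded_bilinear_blinfun_compose)

lemma comp_assoc: "(a o\<^sub>L b) o\<^sub>L c = a o\<^sub>L (b o\<^sub>L c)" for a b c :: "'a \<Rightarrow>\<^sub>L 'a"
  by (rule blinfun_eqI) simp

lemma ideal_sums_closed:
  shows "x \<in> ideal_sums S \<Longrightarrow> y \<in> ideal_sums S \<Longrightarrow> x + y \<in> ideal_sums S"
    and "x \<in> ideal_sums S \<Longrightarrow> m \<in> N \<Longrightarrow> m o\<^sub>L x \<in> ideal_sums S"
    and "x \<in> ideal_sums S \<Longrightarrow> m \<in> N \<Longrightarrow> x o\<^sub>L m \<in> ideal_sums S"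
    and "x \<in> ideal_sums S \<Longrightarrow> - x \<in> ideal_sums S"
proof -
  have l: "ideal_sum (map (\<lambda>(a, s, b). (m o\<^sub>L a, s, b)) ts) = m o\<^sub>L ideal_sum ts" for m ts
    by (induction ts) (auto simp: ideal_sum_def comp.zero_right comp.add_right comp_assoc)
  have r: "ideal_sum (map (\<lambda>(a, s, b). (a, s, b o\<^sub>L m)) ts) = ideal_sum ts o\<^sub>L m" for m ts
    by (induction ts) (auto simp: ideal_sum_def comp.zero_left comp.add_left comp_assoc)
  have n: "ideal_sum (map (\<lambda>(a, s, b). (- a, s, b)) ts) = - ideal_sum ts" for ts
    by (induction ts) (auto simp: ideal_sum_def comp.minus_left)
  show "x + y \<in> ideal_sums S" if xy: "x \<in> ideal_sums S" "y \<in> ideal_sums S"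
  proof -
    obtain ts us where "ts \<in> lists (N \<times> S \<times> N)" "us \<in> lists (N \<times> S \<times> N)" "x = ideal_sum ts" "y = ideal_sum us"
      using xy by (auto simp: ideal_sums_def)
    then have "x + y = ideal_sum (ts @ us)" "ts @ us \<in> lists (N \<times> S \<times> N)"
      by (simp_all add: ideal_sum_def)
    then show ?thesis unfolding ideal_sums_def by blast
  qed
  assume "x \<in> ideal_sums S"
  then obtain ts where ts: "ts \<in> lists (N \<times> S \<times> N)" "x = ideal_sum ts" by (auto simp: ideal_sums_def)
  show "m o\<^sub>L x \<in> ideal_sums S" "x o\<^sub>L m \<in> ideal_sums S" if m: "m \<in> N"
  proof -
    have "map (\<lambda>(a, s, b). (m o\<^sub>L a, s, b)) ts \<in> lists (N \<times> S \<times> N)"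
      "map (\<lambda>(a, s, b). (a, s, b o\<^sub>L m)) ts \<in> lists (N \<times> S \<times> N)"
      using ts(1) m by (auto simp: in_lists_conv_set intro: N_mult)
    then show "m o\<^sub>L x \<in> ideal_sums S" "x o\<^sub>L m \<in> ideal_sums S"
      unfolding ideal_sums_def ts(2) l[symmetric] r[symmetric] by blast+
  qed
  have "map (\<lambda>(a, s, b). (- a, s, b)) ts \<in> lists (N \<times> S \<times> N)"
    using ts(1) by (auto simp: in_lists_conv_set intro: N_minus)
  then show "- x \<in> ideal_sums S" unfolding ideal_sums_def ts(2) n[symmetric] by blast
qed

text \<open>The finite sums form an ideal containing \<open>S\<close>, and closing it in norm keeps
  the ideal properties; the smallest closed ideal is therefore inside the closure.\<close>

lemma closed_ideal_generated_subset:
  assumes S: "S \<subseteq> N"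
  shows "closed_ideal_generated N S \<subseteq> closure (ideal_sums S)"
proof -
  have "ideal_sum ts \<in> N" if "ts \<in> lists (N \<times> S \<times> N)" for ts
    using that S by (induction ts) (auto simp: ideal_sum_def N_zero intro!: N_add N_mult)
  then have sub: "closure (ideal_sums S) \<subseteq> N"
    by (intro closure_minimal closed_N) (auto simp: ideal_sums_def)
  have "ideal (closure (ideal_sums S)) (op_ring N)"
  proof (rule op_ring_idealI[OF ring_N sub])
    have "ideal_sum [] \<in> ideal_sums S" unfolding ideal_sums_def by blast
    then show "0 \<in> closure (ideal_sums S)" using closure_subset by (auto simp: ideal_sum_def)
    fix x assume "x \<in> closure (ideal_sums S)"
    then obtain X where X: "\<And>n. X n \<in> ideal_sums S" "X \<longlonglongrightarrow> x" by (auto simp: closure_sequential)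
    show "x + y \<in> closure (ideal_sums S)" if "y \<in> closure (ideal_sums S)" for y
    proof -
      obtain Y where Y: "\<And>n. Y n \<in> ideal_sums S" "Y \<longlonglongrightarrow> y"
        using \<open>y \<in> closure (ideal_sums S)\<close> by (auto simp: closure_sequential)
      show ?thesis unfolding closure_sequential
        by (rule exI[of _ "\<lambda>n. X n + Y n"]) (intro conjI allI ideal_sums_closed X Y tendsto_add)
    qed
    show "- x \<in> closure (ideal_sums S)" unfolding closure_sequential
      by (rule exI[of _ "\<lambda>n. - X n"]) (intro conjI allI ideal_sums_closed X tendsto_minus)
    fix m assume m: "m \<in> N"
    show "m o\<^sub>L x \<in> closure (ideal_sums S)" unfolding closure_sequential
      by (rule exI[of _ "\<lambda>n. m o\<^sub>L X n"]) (intro conjI allI ideal_sums_closed X m comp.tendsto tendsto_const)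
    show "x o\<^sub>L m \<in> closure (ideal_sums S)" unfolding closure_sequential
      by (rule exI[of _ "\<lambda>n. X n o\<^sub>L m"]) (intro conjI allI ideal_sums_closed X m comp.tendsto tendsto_const)
  qed
  moreover have "S \<subseteq> closure (ideal_sums S)"
  proof
    fix s assume "s \<in> S"
    then have "ideal_sum [(id_blinfun, s, id_blinfun)] \<in> ideal_sums S"
      unfolding ideal_sums_def by (intro imageI) (auto simp: N_id)
    moreover have "ideal_sum [(id_blinfun, s, id_blinfun)] = s"
      by (rule blinfun_eqI) (simp add: ideal_sum_def)
    ultimately show "s \<in> closure (ideal_sums S)" using closure_subset by auto
  qed
  ultimately show ?thesis unfolding closed_ideal_generated_def by blast
qed

lemma closed_ideal_generated_approx:
  assumes S: "S \<subseteq> N" and x: "x \<in> closed_ideal_generated N S" and \<delta>: "0 < \<delta>"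
  obtains n :: nat and a s b where "\<And>j. j < n \<Longrightarrow> a j \<in> Endo ` N \<and> s j \<in> Endo ` S \<and> b j \<in> Endo ` N"
    "norm (Endo x - (\<Sum>j<n. a j * s j * b j)) < \<delta>"
proof -
  have "x \<in> closure (ideal_sums S)" using closed_ideal_generated_subset[OF S] x by blast
  then obtain y where "y \<in> ideal_sums S" "dist y x < \<delta>" using \<delta> by (meson closure_approachable)
  then obtain ts where ts: "ts \<in> lists (N \<times> S \<times> N)" "norm (x - ideal_sum ts) < \<delta>"
    by (auto simp: ideal_sums_def dist_norm norm_minus_commute)
  define a where "a j = Endo (fst (ts ! j))" for j
  define s where "s j = Endo (fst (snd (ts ! j)))" for j
  define b where "b j = Endo (snd (snd (ts ! j)))" for j
  have eq: "Endo (ideal_sum ts) = (\<Sum>j<length ts. a j * s j * b j)"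
    unfolding ideal_sum_def sum_list_sum_nth Endo_sum length_map atLeast0LessThan
    by (rule sum.cong) (simp_all add: split_beta a_def s_def b_def Endo_compose)
  have "norm (Endo x - (\<Sum>j<length ts. a j * s j * b j)) < \<delta>"
    using ts(2) by (simp only: eq[symmetric] Endo_diff[symmetric] norm_Endo)
  moreover have "a j \<in> Endo ` N \<and> s j \<in> Endo ` S \<and> b j \<in> Endo ` N" if "j < length ts" for j
  proof -
    have "ts ! j \<in> N \<times> S \<times> N" using ts(1) that by (auto simp: in_lists_conv_set)
    then show ?thesis by (auto simp: a_def s_def b_def)
  qed
  ultimately show ?thesis using that by blast
qed

end

section \<open>The left essential central spectrum\<close>

lemma strong_closure_iff:
  fixes A :: "('a::real_normed_vector \<Rightarrow>\<^sub>L 'b::real_normed_vector) set"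
  shows "g \<in> strong_operator_topology closure_of A \<longleftrightarrow>
    (\<forall>S \<epsilon>. finite S \<longrightarrow> 0 < \<epsilon> \<longrightarrow> (\<exists>a\<in>A. \<forall>\<xi>\<in>S. norm (blinfun_apply a \<xi> - blinfun_apply g \<xi>) < \<epsilon>))"
    (is "?L \<longleftrightarrow> ?R")
proof
  assume ?L
  show ?R
  proof (intro allI impI)
    fix S :: "'a set" and \<epsilon> :: real assume S: "finite S" "0 < \<epsilon>"
    define U where "U = {f :: 'a \<Rightarrow>\<^sub>L 'b. \<forall>\<xi>\<in>S. blinfun_apply f \<xi> \<in> ball (blinfun_apply g \<xi>) \<epsilon>}"
    have "openin strong_operator_topology U"
      unfolding U_def by (rule strong_operator_topology_basis[OF S(1)]) simp
    moreover have "g \<in> U" using S(2) by (simp add: U_def)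
    ultimately obtain a where "a \<in> A" "a \<in> U" using \<open>?L\<close> unfolding in_closure_of by blast
    then show "\<exists>a\<in>A. \<forall>\<xi>\<in>S. norm (blinfun_apply a \<xi> - blinfun_apply g \<xi>) < \<epsilon>"
      by (intro bexI[of _ a]) (simp_all add: U_def dist_norm norm_minus_commute)
  qed
next
  assume R: ?R
  show ?L unfolding in_closure_of
  proof (intro conjI allI impI)
    show "g \<in> topspace strong_operator_topology" by (simp add: strong_operator_topology_topspace)
    fix U assume U: "g \<in> U \<and> openin strong_operator_topology U"
    then obtain W where W: "open W" "U = blinfun_apply -` W"
      by (auto simp: strong_operator_topology_def openin_pullback_topology)
    have "openin (product_topology (\<lambda>_. euclidean) UNIV) W" "blinfun_apply g \<in> W"
      using W U by (simp_all add: open_fun_def)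
    from product_topology_open_contains_basis[OF this] obtain X where X: "blinfun_apply g \<in> Pi\<^sub>E UNIV X"
      "\<And>i. openin euclidean (X i)" "finite {i. X i \<noteq> topspace euclidean}" "Pi\<^sub>E UNIV X \<subseteq> W"
      by blast
    define S where "S = {i. X i \<noteq> UNIV}"
    have S: "finite S" using X(3) by (simp add: S_def)
    \<comment> \<open>A basic open set of the product topology restricts finitely many coordinates,
      so one radius serves them all.\<close>
    have "\<exists>\<epsilon>>0. \<forall>i\<in>S. ball (blinfun_apply g i) \<epsilon> \<subseteq> X i"
      using S
    proof (induction S)
      case (insert i S)
      obtain \<epsilon> where \<epsilon>: "\<epsilon> > 0" "\<forall>i\<in>S. ball (blinfun_apply g i) \<epsilon> \<subseteq> X i" using insert.IH by blast
      have "open (X i)" "blinfun_apply g i \<in> X i" using X(1,2) by auto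
      then obtain d where d: "d > 0" "ball (blinfun_apply g i) d \<subseteq> X i" using open_contains_ball by blast
      show ?case
        by (rule exI[of _ "min \<epsilon> d"]) (use \<epsilon> d in \<open>auto simp: subset_eq\<close>)
    qed (auto intro: exI[of _ 1])
    then obtain \<epsilon> where \<epsilon>: "\<epsilon> > 0" "\<And>i. i \<in> S \<Longrightarrow> ball (blinfun_apply g i) \<epsilon> \<subseteq> X i" by blast
    obtain a where a: "a \<in> A" "\<And>\<xi>. \<xi> \<in> S \<Longrightarrow> norm (blinfun_apply a \<xi> - blinfun_apply g \<xi>) < \<epsilon>"
      using R S \<epsilon>(1) by meson
    have "blinfun_apply a i \<in> X i" for i
    proof (cases "i \<in> S")
      case True
      then have "blinfun_apply a i \<in> ball (blinfun_apply g i) \<epsilon>"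
        using a(2) by (simp add: dist_norm norm_minus_commute)
      then show ?thesis using \<epsilon>(2)[OF True] by blast
    qed (simp add: S_def)
    then have "blinfun_apply a \<in> W" using X(4) by auto
    then show "\<exists>y. y \<in> A \<and> y \<in> U" using a(1) W(2) by blast
  qed
qed

text \<open>The sum of the \<open>z\<^sup>\<dagger> * z\<close> dominates each term, so all
  \<open>z j\<close> are small where the sum is small. That place is a nonzero spectral projection,
  because otherwise the sum would be invertible in the center.\<close>

lemma (in commutant_algebra) central_cut:
  assumes J: "finite J" "\<And>j. j \<in> J \<Longrightarrow> z j \<in> Z"
    and ninv: "\<And>y. y \<in> Z \<Longrightarrow> y * (\<Sum>j\<in>J. (z j)\<^sup>\<dagger> * z j) \<noteq> 1" and \<eta>: "0 < \<eta>"
  shows "\<exists>e. proj e \<and> e \<in> Z \<and> e \<noteq> 0 \<and> (\<forall>j\<in>J. norm (z j * e) \<le> \<eta>)"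
proof -
  define d where "d = (\<Sum>j\<in>J. (z j)\<^sup>\<dagger> * z j)"
  have dZ: "d \<in> Z" unfolding d_def using J(2) by (intro Z_sum) simp
  \<comment> \<open>The cut is made on \<open>d\<^sup>\<dagger> * d\<close> at level
    \<open>\<eta>\<close> to the fourth power: on \<open>e\<close> this bounds \<open>d\<close> by
    \<open>\<eta>\<^sup>2\<close>, and hence each \<open>z j\<close> by
    \<open>\<eta>\<close>.\<close>
  have \<eta>4: "0 < (\<eta>\<^sup>2)\<^sup>2" using \<eta> by simp
  obtain g k where g: "proj g" and k: "k \<in> M" "k * k * (d\<^sup>\<dagger> * d) = g"
    and est: "\<And>\<xi>. (norm (d \<cdot> (\<xi> - g \<cdot> \<xi>)))\<^sup>2 \<le> (\<eta>\<^sup>2)\<^sup>2 * (norm (\<xi> - g \<cdot> \<xi>))\<^sup>2"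
    and gZ: "d \<in> Z \<Longrightarrow> g \<in> Z"
    by (rule spectral_cut_M[OF Z_mem[OF dZ] \<eta>4]) blast
  define e where "e = 1 - g"
  have e: "proj e" "e \<in> Z" using g gZ[OF dZ] by (simp_all add: e_def proj_complement)
  have "e \<noteq> 0"
  proof
    assume "e = 0"
    then have kd: "(k * k * d\<^sup>\<dagger>) * d = 1" using k(2) by (simp add: e_def mult.assoc)
    have yM: "k * k * d\<^sup>\<dagger> \<in> M" using k(1) Z_mem[OF dZ] by simp
    have dk: "d * (k * k * d\<^sup>\<dagger>) = 1" using Z_commute[OF dZ yM] kd by simp
    have "k * k * d\<^sup>\<dagger> \<in> Z"
    proof (rule Z_memI[OF yM])
      fix m assume m: "m \<in> M"
      have "(k * k * d\<^sup>\<dagger>) * m = (k * k * d\<^sup>\<dagger>) * m * (d * (k * k * d\<^sup>\<dagger>))" by (simp only: dk mult_1_right)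
      also have "\<dots> = (k * k * d\<^sup>\<dagger>) * (m * d) * (k * k * d\<^sup>\<dagger>)" by (simp only: mult.assoc)
      also have "\<dots> = (k * k * d\<^sup>\<dagger>) * (d * m) * (k * k * d\<^sup>\<dagger>)" by (simp only: Z_commute[OF dZ m])
      also have "\<dots> = ((k * k * d\<^sup>\<dagger>) * d) * m * (k * k * d\<^sup>\<dagger>)" by (simp only: mult.assoc)
      finally show "(k * k * d\<^sup>\<dagger>) * m = m * (k * k * d\<^sup>\<dagger>)" by (simp only: kd mult_1_left)
    qed
    then show False using ninv kd by (simp add: d_def)
  qed
  moreover have "norm (z j * e) \<le> \<eta>" if j: "j \<in> J" for j
  proof (rule norm_endo_bound)
    fix \<xi>
    define \<zeta> where "\<zeta> = e \<cdot> \<xi>"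
    have \<zeta>: "\<zeta> = \<xi> - g \<cdot> \<xi>" by (simp add: \<zeta>_def e_def)
    have "(norm (d \<cdot> \<zeta>))\<^sup>2 \<le> (\<eta>\<^sup>2 * norm \<zeta>)\<^sup>2" using est[of \<xi>] by (simp add: \<zeta> power_mult_distrib)
    then have d\<zeta>: "norm (d \<cdot> \<zeta>) \<le> \<eta>\<^sup>2 * norm \<zeta>" by (rule power2_le_imp_le) simp
    have "(norm (z j \<cdot> \<zeta>))\<^sup>2 \<le> (\<Sum>j\<in>J. (norm (z j \<cdot> \<zeta>))\<^sup>2)"
      using J(1) j by (intro member_le_sum) simp_all
    also have "\<dots> = inner (d \<cdot> \<zeta>) \<zeta>"
      by (simp add: norm_eapp_sq d_def eapp.sum_left inner_sum_left)
    also have "\<dots> \<le> norm (d \<cdot> \<zeta>) * norm \<zeta>" by (rule norm_cauchy_schwarz)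
    also have "\<dots> \<le> \<eta>\<^sup>2 * norm \<zeta> * norm \<zeta>" by (intro mult_right_mono d\<zeta>) simp
    also have "\<dots> = (\<eta> * norm \<zeta>)\<^sup>2" by (simp add: power2_eq_square)
    finally have "norm (z j \<cdot> \<zeta>) \<le> \<eta> * norm \<zeta>" by (rule power2_le_imp_le) (use \<eta> in simp)
    also have "\<dots> \<le> \<eta> * norm \<xi>" unfolding \<zeta>_def
      using \<eta> by (intro mult_left_mono norm_proj_app e) simp
    finally show "norm ((z j * e) \<cdot> \<xi>) \<le> \<eta> * norm \<xi>" by (simp add: \<zeta>_def)
  qed (use \<eta> in simp)
  ultimately show ?thesis using e by blast
qed

section \<open>Left inverses modulo the sum ideal\<close>

context complex_vn_algebra
begin

lemma ring_center: "ring (op_ring (center N))"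
  by (rule ring_op_ring_center[OF vn])

lemma center_subset: "center N \<subseteq> N"
  by (auto simp: center_def)

lemma maximal_ideal_subset:
  assumes "\<zeta> \<in> maximal_ideal_space (center N)"
  shows "ideal \<zeta> (op_ring (center N))" "id_blinfun \<notin> \<zeta>" "\<zeta> \<subseteq> center N" "\<zeta> \<subseteq> N"
proof -
  interpret maximalideal \<zeta> "op_ring (center N)" using assms by (simp add: maximal_ideal_space_def)
  show i: "ideal \<zeta> (op_ring (center N))" by (rule ideal_axioms)
  show "id_blinfun \<notin> \<zeta>" using one_imp_carrier I_notcarr by (auto simp: op_ring_simps)
  show "\<zeta> \<subseteq> center N" by (rule op_ring_ideal_closed[OF i])
  then show "\<zeta> \<subseteq> N" using center_subset by blast
qed

lemma finite_projections_subset: "{p. finite_projection N p} \<subseteq> N"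
proof
  fix p assume "p \<in> {p. finite_projection N p}"
  then have "Endo p \<in> Endo ` N" by (intro finD(1)) (simp add: finite_projection_iff)
  then show "p \<in> N" by (simp only: Endo_N)
qed

lemma generators_subset: "S \<subseteq> closed_ideal_generated N S"
  by (auto simp: closed_ideal_generated_def)

lemma sum_ideal_iff: "x \<in> sum_ideal N \<zeta> \<longleftrightarrow>
    (\<exists>j\<in>closed_ideal_generated N \<zeta>. \<exists>k\<in>compact_ideal N. x = j + k)"
  by (auto simp: sum_ideal_def set_add_def' op_ring_simps)

lemma left_invertible_mod_sum_ideal_iff:
  assumes "\<zeta> \<subseteq> N" "x \<in> N"
  shows "left_invertible (op_ring N Quot sum_ideal N \<zeta>) (sum_ideal N \<zeta> +>\<^bsub>op_ring N\<^esub> x) \<longleftrightarrow>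
    (\<exists>y\<in>N. id_blinfun - (y o\<^sub>L x) \<in> sum_ideal N \<zeta>)"
proof -
  have "ideal (sum_ideal N \<zeta>) (op_ring N)"
    unfolding sum_ideal_def compact_ideal_def
    by (intro ring.add_ideals[OF ring_N] ideal_closed_ideal_generated assms(1) finite_projections_subset)
  moreover have "id_blinfun \<ominus>\<^bsub>op_ring N\<^esub> (y o\<^sub>L x) = id_blinfun - (y o\<^sub>L x)" if "y \<in> N" for y
    using op_ring_uminus[OF ring_N N_mult[OF that assms(2)] N_minus[OF N_mult[OF that assms(2)]]]
    by (simp add: a_minus_def op_ring_simps)
  ultimately show ?thesis
    using left_invertible_quotient_iff[OF ring_N, of "sum_ideal N \<zeta>" x] assms(2)
    by (simp add: op_ring_simps)
qed

text \<open>The adjoint of a central element is central and acts as a multiplier, so each product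
  stays in \<open>\<zeta>\<close>.\<close>

lemma sum_dag_mult_in_ideal:
  fixes s :: "nat \<Rightarrow> 'a endo"
  assumes \<zeta>: "ideal \<zeta> (op_ring (center N))" and s: "\<And>j. j < n \<Longrightarrow> s j \<in> Endo ` \<zeta>"
  shows "(\<Sum>j<n. (s j)\<^sup>\<dagger> * s j) \<in> Endo ` \<zeta>"
  using s
proof (induction n)
  case 0
  then show ?case using op_ring_ideal_closed(5)[OF \<zeta>] Endo_zero by (auto intro: image_eqI[of _ _ 0])
next
  case (Suc n)
  obtain D where D: "(\<Sum>j<n. (s j)\<^sup>\<dagger> * s j) = Endo D" "D \<in> \<zeta>" using Suc by auto
  obtain t where t: "s n = Endo t" "t \<in> \<zeta>" using Suc.prems[of n] by auto
  have tc: "t \<in> center N" using op_ring_ideal_closed(1)[OF \<zeta>] t(2) by blast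
  have dt: "(Endo t)\<^sup>\<dagger> = Endo (adj t)" using tc center_subset by (intro dag_Endo_N) blast
  then have "adj t \<in> center N" using tc center_iff by (metis Z_dag)
  then have "D + (adj t o\<^sub>L t) \<in> \<zeta>" using D(2) t(2) by (intro op_ring_ideal_closed(2,3)[OF \<zeta>])
  moreover have "(\<Sum>j<Suc n. (s j)\<^sup>\<dagger> * s j) = Endo (D + (adj t o\<^sub>L t))"
    by (simp add: D t dt Endo_simps)
  ultimately show ?case by (metis imageI)
qed

lemma not_left_invertible_if_orbit_small:
  assumes inf: "\<And>c. proj c \<Longrightarrow> c \<in> Z \<Longrightarrow> c \<noteq> 0 \<Longrightarrow> \<not> fin c"
    and \<zeta>: "\<zeta> \<in> maximal_ideal_space (center N)" and x: "x \<in> N" and y: "y \<in> N"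
    and small: "\<And>S \<epsilon>. finite S \<Longrightarrow> 0 < \<epsilon> \<Longrightarrow> \<exists>u. unitary u \<and> (\<forall>\<xi>\<in>S. norm (Endo x \<cdot> u \<cdot> \<xi>) < \<epsilon>)"
  shows "id_blinfun - (y o\<^sub>L x) \<notin> sum_ideal N \<zeta>"
proof
  note \<zeta>' = maximal_ideal_subset[OF \<zeta>]
  assume "id_blinfun - (y o\<^sub>L x) \<in> sum_ideal N \<zeta>"
  then obtain j0 k0 where j0: "j0 \<in> closed_ideal_generated N \<zeta>" and k0: "k0 \<in> compact_ideal N"
    and "id_blinfun - (y o\<^sub>L x) = j0 + k0" unfolding sum_ideal_iff by blast
  then have "Endo (id_blinfun - (y o\<^sub>L x)) = Endo (j0 + k0)" by (simp only:)
  then have eq: "1 - Endo y * Endo x = Endo j0 + Endo k0" by (simp only: Endo_simps)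
  obtain n :: nat and a s b where as: "\<And>j. j < n \<Longrightarrow> a j \<in> Endo ` N \<and> s j \<in> Endo ` \<zeta> \<and> b j \<in> Endo ` N"
    and nj: "norm (Endo j0 - (\<Sum>j<n. a j * s j * b j)) < 1 / 8"
    by (rule closed_ideal_generated_approx[OF \<zeta>'(4) j0, of "1 / 8"]) auto
  obtain m :: nat and a' p b' where ap: "\<And>j. j < m \<Longrightarrow> a' j \<in> Endo ` N \<and> p j \<in> Endo ` {p. finite_projection N p} \<and> b' j \<in> Endo ` N"
    and nk: "norm (Endo k0 - (\<Sum>j<m. a' j * p j * b' j)) < 1 / 8"
    by (rule closed_ideal_generated_approx[OF finite_projections_subset k0[unfolded compact_ideal_def], of "1 / 8"]) auto
  define J where "J = (\<Sum>j<n. a j * s j * b j)"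
  define K where "K = (\<Sum>j<m. a' j * p j * b' j)"
  define C where "C = (\<Sum>j<n. norm (a j) * norm (b j))"
  have C: "0 \<le> C" unfolding C_def by (intro sum_nonneg) simp
  \<comment> \<open>Chosen so that the finite sum \<open>J\<close> approximating the
    \<open>\<zeta>\<close> part has norm at most \<open>1 / 8\<close> on \<open>e\<close>; the two
    approximation errors are below \<open>1 / 8\<close> each, and the total stays below
    \<open>1 / 2\<close>.\<close>
  define \<eta> where "\<eta> = 1 / (8 * (C + 1))"
  have \<eta>: "0 < \<eta>" using C by (simp add: \<eta>_def)
  have C\<eta>: "C * \<eta> \<le> 1 / 8" using C by (simp add: \<eta>_def pos_divide_le_eq)
  have sZ: "s j \<in> Z" if "j \<in> {..<n}" for j using as[of j] \<zeta>'(3) that center_iff by auto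
  \<comment> \<open>An inverse in the center would put the unit into the proper ideal
    \<open>\<zeta>\<close>.\<close>
  have ninv: "w * (\<Sum>j\<in>{..<n}. (s j)\<^sup>\<dagger> * s j) \<noteq> 1" if w: "w \<in> Z" for w
  proof
    assume w1: "w * (\<Sum>j\<in>{..<n}. (s j)\<^sup>\<dagger> * s j) = 1"
    obtain D where D: "(\<Sum>j<n. (s j)\<^sup>\<dagger> * s j) = Endo D" "D \<in> \<zeta>"
      using sum_dag_mult_in_ideal[OF \<zeta>'(1), of n s] as by auto
    obtain W where W: "w = Endo W" "W \<in> center N" using w Z_mem[OF w] center_iff by auto
    have "W o\<^sub>L D \<in> \<zeta>" by (rule op_ring_ideal_closed(3)[OF \<zeta>'(1) D(2) W(2)])
    moreover have "Endo (W o\<^sub>L D) = Endo id_blinfun" using w1 by (simp only: D W Endo_compose Endo_id)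
    ultimately show False using \<zeta>'(2) by (simp add: Endo_eq_iff)
  qed
  obtain e where e: "proj e" "e \<in> Z" "e \<noteq> 0" and es: "\<And>j. j \<in> {..<n} \<Longrightarrow> norm (s j * e) \<le> \<eta>"
    using central_cut[OF finite_lessThan sZ ninv \<eta>] by blast
  have "norm (e * J) \<le> 1 / 8"
  proof -
    have "norm (e * (a j * s j * b j)) \<le> norm (a j) * norm (b j) * \<eta>" if j: "j < n" for j
    proof -
      have "e * (a j * s j * b j) = (e * a j) * s j * b j" by (simp only: mult.assoc)
      also have "\<dots> = a j * (e * s j) * b j" using as[OF j] by (simp only: Z_commute[OF e(2)] mult.assoc)
      also have "\<dots> = a j * (s j * e) * b j" using sZ j by (simp only: Z_commute[OF e(2) Z_mem] lessThan_iff)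
      finally have "norm (e * (a j * s j * b j)) \<le> norm (a j) * norm (s j * e) * norm (b j)"
        by (simp only:) (meson mult_right_mono norm_ge_zero norm_mult_ineq order_trans)
      also have "\<dots> \<le> norm (a j) * \<eta> * norm (b j)"
        using es j by (intro mult_right_mono mult_left_mono) simp_all
      finally show ?thesis by (simp add: mult_ac)
    qed
    then have "norm (\<Sum>j<n. e * (a j * s j * b j)) \<le> (\<Sum>j<n. norm (a j) * norm (b j) * \<eta>)"
      by (intro sum_norm_le) simp
    then have "norm (e * J) \<le> C * \<eta>" by (simp only: J_def C_def sum_distrib_left sum_distrib_right)
    then show ?thesis using C\<eta> by (rule order_trans)
  qed
  moreover have "norm (e * w) \<le> norm w" for w
    using norm_mult_ineq[of e w] mult_right_mono[OF norm_proj[OF e(1)], of "norm w"] by simp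
  then have "norm (e * (Endo j0 - J)) \<le> 1 / 8" "norm (e * (Endo k0 - K)) \<le> 1 / 8"
    using nj nk unfolding J_def K_def by (blast intro: order_trans less_imp_le)+
  moreover have "e * (1 - Endo y * Endo x - K) = e * J + (e * (Endo j0 - J) + e * (Endo k0 - K))"
    by (simp add: eq algebra_simps)
  ultimately have near: "norm (e * (1 - Endo y * Endo x - K)) \<le> 1 / 2"
    using norm_triangle_ineq[of "e * J" "e * (Endo j0 - J) + e * (Endo k0 - K)"]
      norm_triangle_ineq[of "e * (Endo j0 - J)" "e * (Endo k0 - K)"] by simp
  show False
  proof (rule no_left_inverse_mod_finite[OF inf e])
    show "Endo x \<in> Endo ` N" "Endo y \<in> Endo ` N" using x y by simp_all
    show "a' j \<in> Endo ` N \<and> fin (p j) \<and> b' j \<in> Endo ` N" if "j \<in> {..<m}" for j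
      using ap[of j] that by (auto simp: finite_projection_iff)
    show "norm (e * (1 - Endo y * Endo x - (\<Sum>j\<in>{..<m}. a' j * p j * b' j))) \<le> 1 / 2"
      using near by (simp only: K_def)
  qed (use small in auto)
qed

lemma small_on_infinite_spectral_projection:
  assumes x: "x \<in> N" and S: "finite S" and \<epsilon>: "0 < \<epsilon>"
    and nli: "\<And>\<zeta> y. \<zeta> \<in> maximal_ideal_space (center N) \<Longrightarrow> y \<in> N \<Longrightarrow> id_blinfun - (y o\<^sub>L x) \<notin> sum_ideal N \<zeta>"
  shows "\<exists>u. unitary u \<and> (\<forall>\<xi>\<in>S. norm (Endo x \<cdot> u \<cdot> \<xi>) < \<epsilon>)"
proof -
  define L where "L = (\<Sum>\<xi>\<in>S. norm \<xi>) + 1"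
  have SL: "norm \<xi> \<le> L" if "\<xi> \<in> S" for \<xi>
    using member_le_sum[OF that _ S, of norm] by (simp add: L_def)
  have L: "0 < L" unfolding L_def by (intro add_nonneg_pos sum_nonneg) simp_all
  define \<eta> where "\<eta> = \<epsilon> / (4 * L)"
  have \<eta>: "0 < \<eta>" using \<epsilon> L by (simp add: \<eta>_def)
  have xM: "Endo x \<in> Endo ` N" using x by simp
  obtain g k where g: "proj g" "g \<in> Endo ` N" and k: "k \<in> Endo ` N" "k * k * ((Endo x)\<^sup>\<dagger> * Endo x) = g"
    and est: "\<And>\<xi>. (norm (Endo x \<cdot> (\<xi> - g \<cdot> \<xi>)))\<^sup>2 \<le> \<eta>\<^sup>2 * (norm (\<xi> - g \<cdot> \<xi>))\<^sup>2"
    by (rule spectral_cut_M[OF xM, of "\<eta>\<^sup>2"]) (use \<eta> in simp, blast)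
  define q where "q = 1 - g"
  have q: "proj q" "q \<in> Endo ` N" using g by (simp_all add: q_def proj_complement)
  obtain q' where q': "q = Endo q'" "q' \<in> N" using q(2) by blast
  have "k * k * (Endo x)\<^sup>\<dagger> \<in> Endo ` N" using k(1) xM by simp
  then obtain y where y: "y \<in> N" "k * k * (Endo x)\<^sup>\<dagger> = Endo y" by blast
  \<comment> \<open>\<open>y * x\<close> is exactly the spectral projection \<open>g\<close>, so the
    defect \<open>1 - y * x\<close> is the complementary projection \<open>q\<close> itself.\<close>
  have "Endo (id_blinfun - (y o\<^sub>L x)) = Endo q'"
    using k(2) by (simp add: Endo_simps y(2)[symmetric] q'(1)[symmetric] q_def mult.assoc)
  then have yx: "id_blinfun - (y o\<^sub>L x) = q'" by (simp only: Endo_eq_iff)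
  have inf: "\<not> fin (c * q)" if c: "proj c" "c \<in> Z" "c \<noteq> 0" for c
  proof
    assume fcq: "fin (c * q)"
    obtain C where C: "c = Endo C" "C \<in> N" using Z_mem[OF c(2)] by blast
    have Cc: "C \<in> center N" using c(2) C(1) by (simp add: center_iff)
    define I where "I = {z \<in> center N. z o\<^sub>L C = 0}"
    have I_iff: "z \<in> I \<longleftrightarrow> Endo z \<in> Z \<and> Endo z * c = 0" for z
      unfolding I_def C(1) by (simp add: center_iff Endo_compose[symmetric] Endo_zero[symmetric] Endo_eq_iff)
    have "ideal I (op_ring (center N))"
    proof (rule op_ring_idealI[OF ring_center])
      show "I \<subseteq> center N" "0 \<in> I" by (auto simp: I_iff Endo_zero center_iff)
      show "v + w \<in> I" if "v \<in> I" "w \<in> I" for v w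
        using that by (simp add: I_iff Endo_add distrib_right)
      show "- v \<in> I" if "v \<in> I" for v
        using that Z_diff[of 0 "Endo v"] by (simp add: I_iff Endo_minus)
      fix v w assume v: "v \<in> I" and w: "w \<in> center N"
      then show "w o\<^sub>L v \<in> I" by (simp add: I_iff Endo_compose center_iff mult.assoc)
      have "Endo v * Endo w = Endo w * Endo v"
        by (rule Z_commute) (use v w in \<open>simp_all add: I_iff center_iff Z_mem\<close>)
      then have "Endo v * Endo w * c = Endo w * (Endo v * c)" by (simp only: mult.assoc)
      then show "v o\<^sub>L w \<in> I" using v w by (simp add: I_iff Endo_compose center_iff)
    qed
    moreover have "id_blinfun \<notin> I" using c(3) by (simp add: I_iff Endo_id)
    ultimately obtain \<zeta> where \<zeta>: "maximalideal \<zeta> (op_ring (center N))" "I \<subseteq> \<zeta>"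
      using exists_maximalideal[OF ring_center, of I] by (auto simp: op_ring_simps)
    then have \<zeta>M: "\<zeta> \<in> maximal_ideal_space (center N)" by (simp add: maximal_ideal_space_def)
    have "id_blinfun - C \<in> I"
      using c by (simp add: I_iff Endo_simps C(1)[symmetric] left_diff_distrib projD)
    then have "id_blinfun - C \<in> closed_ideal_generated N \<zeta>" using \<zeta>(2) generators_subset by blast
    then have 1: "(id_blinfun - C) o\<^sub>L q' \<in> closed_ideal_generated N \<zeta>"
      using op_ring_ideal_closed(4)[OF ideal_closed_ideal_generated[OF maximal_ideal_subset(4)[OF \<zeta>M]]] q'(2) by blast
    have "finite_projection N (C o\<^sub>L q')" using fcq by (simp add: finite_projection_iff Endo_compose C(1) q'(1))
    then have 2: "C o\<^sub>L q' \<in> compact_ideal N" unfolding compact_ideal_def using generators_subset by blast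
    have "q' = ((id_blinfun - C) o\<^sub>L q') + (C o\<^sub>L q')"
      by (rule blinfun_eqI) (simp add: blinfun.diff_left blinfun.add_left)
    then have "q' \<in> sum_ideal N \<zeta>" unfolding sum_ideal_iff using 1 2 by blast
    then show False using nli[OF \<zeta>M y(1)] by (simp add: yx)
  qed
  \<comment> \<open>The part of \<open>u \<cdot> \<xi>\<close> outside \<open>q\<close> costs at
    most \<open>norm x * \<epsilon>'\<close>, hence \<open>\<epsilon> / 2\<close>; the part inside
    \<open>q\<close> costs at most \<open>\<eta> * L\<close>, which is
    \<open>\<epsilon> / 4\<close>.\<close>
  define \<epsilon>' where "\<epsilon>' = (\<epsilon> / 2) / (norm x + 1)"
  have x1: "0 < norm x + 1" by (simp add: add_nonneg_pos)
  have \<epsilon>': "0 < \<epsilon>'" using \<epsilon> x1 by (simp add: \<epsilon>'_def)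
  have x\<epsilon>': "norm x * \<epsilon>' \<le> \<epsilon> / 2"
  proof -
    have "norm x * \<epsilon>' \<le> (norm x + 1) * \<epsilon>'" using \<epsilon>' by (intro mult_right_mono) simp_all
    also have "\<dots> = \<epsilon> / 2" unfolding \<epsilon>'_def
      using nonzero_mult_div_cancel_left[OF less_imp_neq[OF x1, symmetric], of "\<epsilon> / 2"]
      by (simp only: times_divide_eq_right)
    finally show ?thesis .
  qed
  have "\<exists>u. unitary u \<and> (\<forall>\<xi>\<in>S. norm ((1 - q) \<cdot> u \<cdot> \<xi>) < \<epsilon>')"
    by (rule move_vectors_into[OF q inf S \<epsilon>']) auto
  then obtain u where u: "unitary u" "\<And>\<xi>. \<xi> \<in> S \<Longrightarrow> norm ((1 - q) \<cdot> u \<cdot> \<xi>) < \<epsilon>'" by blast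
  have "norm (Endo x \<cdot> u \<cdot> \<xi>) < \<epsilon>" if \<xi>: "\<xi> \<in> S" for \<xi>
  proof -
    define \<zeta> where "\<zeta> = u \<cdot> \<xi>"
    have "(norm (Endo x \<cdot> (\<zeta> - g \<cdot> \<zeta>)))\<^sup>2 \<le> (\<eta> * norm (\<zeta> - g \<cdot> \<zeta>))\<^sup>2"
      using est[of \<zeta>] by (simp add: power_mult_distrib)
    then have "norm (Endo x \<cdot> (\<zeta> - g \<cdot> \<zeta>)) \<le> \<eta> * norm (\<zeta> - g \<cdot> \<zeta>)"
      by (rule power2_le_imp_le) (use \<eta> in simp)
    also have "\<dots> \<le> \<eta> * L"
    proof -
      have "norm (\<zeta> - g \<cdot> \<zeta>) \<le> norm \<zeta>" using norm_proj_app[OF q(1), of \<zeta>] by (simp add: q_def)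
      also have "\<dots> \<le> L" using SL[OF \<xi>] by (simp add: \<zeta>_def norm_unitary_app[OF u(1)])
      finally show ?thesis using \<eta> by (intro mult_left_mono) simp_all
    qed
    also have "\<dots> = \<epsilon> / 4" using L by (simp add: \<eta>_def)
    finally have 1: "norm (Endo x \<cdot> (\<zeta> - g \<cdot> \<zeta>)) \<le> \<epsilon> / 4" .
    have "norm (Endo x \<cdot> g \<cdot> \<zeta>) \<le> norm x * norm (g \<cdot> \<zeta>)"
      using norm_eapp[of "Endo x" "g \<cdot> \<zeta>"] by (simp only: norm_Endo)
    also have "\<dots> \<le> norm x * \<epsilon>'" using u(2)[OF \<xi>] by (intro mult_left_mono) (simp_all add: q_def \<zeta>_def)
    finally have 2: "norm (Endo x \<cdot> g \<cdot> \<zeta>) \<le> \<epsilon> / 2" using x\<epsilon>' by simp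
    have "Endo x \<cdot> \<zeta> = Endo x \<cdot> (\<zeta> - g \<cdot> \<zeta>) + Endo x \<cdot> g \<cdot> \<zeta>" by (simp only: eapp.diff_right) simp
    then have "norm (Endo x \<cdot> \<zeta>) \<le> \<epsilon> / 4 + \<epsilon> / 2"
      using norm_triangle_ineq[of "Endo x \<cdot> (\<zeta> - g \<cdot> \<zeta>)" "Endo x \<cdot> g \<cdot> \<zeta>"] 1 2 by simp
    then show ?thesis using \<epsilon> by (simp add: \<zeta>_def)
  qed
  with u(1) show ?thesis by blast
qed

text \<open>A central \<open>z\<close> commutes with \<open>u\<close>, so the difference is
  \<open>u * (h - z) * u\<^sup>\<dagger>\<close>, and \<open>u\<close> preserves norms. The orbit
  condition thus becomes a condition on \<open>h - z\<close> alone.\<close>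

lemma orbit_distance:
  assumes u: "u \<in> unitaries N" and h: "h \<in> N" and z: "z \<in> center N"
  shows "norm (blinfun_apply (u o\<^sub>L h o\<^sub>L adj u) \<xi> - blinfun_apply z \<xi>) = norm (Endo (h - z) \<cdot> (Endo u)\<^sup>\<dagger> \<cdot> \<xi>)"
proof -
  have uu: "unitary (Endo u)" using u by (simp add: unitaries_iff)
  have uN: "u \<in> N" using u by (simp add: unitaries_def)
  define U where "U = Endo u"
  have UU: "U * U\<^sup>\<dagger> = 1" "U \<in> Endo ` N" using uu by (simp_all add: U_def unitary_def)
  have "U * Endo z = Endo z * U" using Z_commute[of "Endo z" U] z UU(2) by (simp add: center_iff)
  then have "U * Endo (h - z) * U\<^sup>\<dagger> = Endo (u o\<^sub>L h o\<^sub>L adj u) - Endo z"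
    using UU(1) dag_Endo_N[OF uN] by (simp add: Endo_simps U_def left_diff_distrib right_diff_distrib mult.assoc)
  then have "(U * Endo (h - z) * U\<^sup>\<dagger>) \<cdot> \<xi> = (Endo (u o\<^sub>L h o\<^sub>L adj u) - Endo z) \<cdot> \<xi>" by (simp only:)
  then have "U \<cdot> Endo (h - z) \<cdot> U\<^sup>\<dagger> \<cdot> \<xi> = blinfun_apply (u o\<^sub>L h o\<^sub>L adj u) \<xi> - blinfun_apply z \<xi>" by simp
  then show ?thesis using norm_unitary_app[OF uu, of "Endo (h - z) \<cdot> U\<^sup>\<dagger> \<cdot> \<xi>"] by (simp add: U_def)
qed

lemma strong_closure_orbit_iff:
  assumes h: "h \<in> N" and z: "z \<in> center N"
  shows "z \<in> strong_operator_topology closure_of unitary_orbit N h \<longleftrightarrow>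
    (\<forall>S \<epsilon>. finite S \<longrightarrow> 0 < \<epsilon> \<longrightarrow> (\<exists>u. unitary u \<and> (\<forall>\<xi>\<in>S. norm (Endo (h - z) \<cdot> u \<cdot> \<xi>) < \<epsilon>)))"
proof -
  have "(\<exists>a\<in>unitary_orbit N h. \<forall>\<xi>\<in>S. norm (blinfun_apply a \<xi> - blinfun_apply z \<xi>) < \<epsilon>) \<longleftrightarrow>
    (\<exists>u. unitary u \<and> (\<forall>\<xi>\<in>S. norm (Endo (h - z) \<cdot> u \<cdot> \<xi>) < \<epsilon>))" for S \<epsilon>
  proof
    assume "\<exists>a\<in>unitary_orbit N h. \<forall>\<xi>\<in>S. norm (blinfun_apply a \<xi> - blinfun_apply z \<xi>) < \<epsilon>"
    then obtain u where u: "u \<in> unitaries N"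
      "\<forall>\<xi>\<in>S. norm (blinfun_apply (u o\<^sub>L h o\<^sub>L adj u) \<xi> - blinfun_apply z \<xi>) < \<epsilon>"
      by (auto simp only: unitary_orbit_def)
    then have "\<forall>\<xi>\<in>S. norm (Endo (h - z) \<cdot> (Endo u)\<^sup>\<dagger> \<cdot> \<xi>) < \<epsilon>"
      by (simp only: orbit_distance[OF u(1) h z])
    moreover have "unitary ((Endo u)\<^sup>\<dagger>)" using u(1) by (intro unitary_dag) (simp add: unitaries_iff)
    ultimately show "\<exists>u. unitary u \<and> (\<forall>\<xi>\<in>S. norm (Endo (h - z) \<cdot> u \<cdot> \<xi>) < \<epsilon>)" by blast
  next
    assume "\<exists>u. unitary u \<and> (\<forall>\<xi>\<in>S. norm (Endo (h - z) \<cdot> u \<cdot> \<xi>) < \<epsilon>)"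
    then obtain w where w: "unitary w" "\<forall>\<xi>\<in>S. norm (Endo (h - z) \<cdot> w \<cdot> \<xi>) < \<epsilon>" by blast
    have "w\<^sup>\<dagger> \<in> Endo ` N" using unitary_dag[OF w(1)] by (simp add: unitary_def)
    then obtain u where u: "w\<^sup>\<dagger> = Endo u" by blast
    then have uN: "u \<in> unitaries N" using unitary_dag[OF w(1)] by (simp add: unitaries_iff)
    have "w = (Endo u)\<^sup>\<dagger>" using u by (metis dag_dag)
    then have "\<forall>\<xi>\<in>S. norm (blinfun_apply (u o\<^sub>L h o\<^sub>L adj u) \<xi> - blinfun_apply z \<xi>) < \<epsilon>"
      using w(2) by (simp only: orbit_distance[OF uN h z])
    then show "\<exists>a\<in>unitary_orbit N h. \<forall>\<xi>\<in>S. norm (blinfun_apply a \<xi> - blinfun_apply z \<xi>) < \<epsilon>"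
      using uN by (auto simp only: unitary_orbit_def)
  qed
  then show ?thesis by (simp only: strong_closure_iff)
qed

end

theorem theorem6p5:
  fixes M :: "('a::complex_hilbert \<Rightarrow>\<^sub>L 'a) set" and h :: "'a \<Rightarrow>\<^sub>L 'a"
  assumes "von_neumann_algebra M"
    and "properly_infinite M"
    and "h \<in> M"
  shows "(strong_operator_topology closure_of unitary_orbit M h) \<inter> center M =
    left_essential_central_spectrum M h"
proof -
  interpret complex_vn_algebra M by (unfold_locales) (rule assms(1))
  have inf: "\<not> fin c" if c: "proj c" "c \<in> Z" "c \<noteq> 0" for c
  proof -
    obtain p where p: "c = Endo p" "p \<in> M" using Z_mem[OF c(2)] by blast
    have "p \<in> projections M \<inter> center M" "p \<noteq> 0"
      using c p by (auto simp: projections_iff center_iff Endo_zero)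
    then show ?thesis using assms(2) by (auto simp: properly_infinite_def p(1) finite_projection_iff)
  qed
  have "z \<in> strong_operator_topology closure_of unitary_orbit M h \<longleftrightarrow>
      (\<forall>\<zeta>\<in>maximal_ideal_space (center M).
        \<not> left_invertible (op_ring M Quot sum_ideal M \<zeta>) (sum_ideal M \<zeta> +>\<^bsub>op_ring M\<^esub> (h - z)))"
    if z: "z \<in> center M" for z
  proof -
    have x: "h - z \<in> M" using z center_subset assms(3) by (intro N_diff) auto
    have "z \<in> strong_operator_topology closure_of unitary_orbit M h \<longleftrightarrow>
        (\<forall>\<zeta>\<in>maximal_ideal_space (center M). \<forall>y\<in>M. id_blinfun - (y o\<^sub>L (h - z)) \<notin> sum_ideal M \<zeta>)"
      (is "_ \<longleftrightarrow> ?spec")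
      unfolding strong_closure_orbit_iff[OF assms(3) z]
    proof (intro iffI allI impI ballI)
      fix S :: "'a set" and \<epsilon> :: real assume ?spec "finite S" "0 < \<epsilon>"
      then show "\<exists>u. unitary u \<and> (\<forall>\<xi>\<in>S. norm (Endo (h - z) \<cdot> u \<cdot> \<xi>) < \<epsilon>)"
        by (intro small_on_infinite_spectral_projection[OF x]) blast+
    next
      fix \<zeta> y
      assume "\<forall>S \<epsilon>. finite S \<longrightarrow> 0 < \<epsilon> \<longrightarrow> (\<exists>u. unitary u \<and> (\<forall>\<xi>\<in>S. norm (Endo (h - z) \<cdot> u \<cdot> \<xi>) < \<epsilon>))"
        and "\<zeta> \<in> maximal_ideal_space (center M)" "y \<in> M"
      then show "id_blinfun - (y o\<^sub>L (h - z)) \<notin> sum_ideal M \<zeta>"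
        by (intro not_left_invertible_if_orbit_small[OF inf _ x]) blast+
    qed
    also have "\<dots> \<longleftrightarrow> (\<forall>\<zeta>\<in>maximal_ideal_space (center M).
        \<not> left_invertible (op_ring M Quot sum_ideal M \<zeta>) (sum_ideal M \<zeta> +>\<^bsub>op_ring M\<^esub> (h - z)))"
      by (rule ball_cong[OF refl])
        (simp only: left_invertible_mod_sum_ideal_iff[OF maximal_ideal_subset(4) x] bex_simps not_not ball_simps)
    finally show ?thesis .
  qed
  then show ?thesis unfolding left_essential_central_spectrum_def by blast
qed

end
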